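(* There is a monad $\mathbb O$ on the category $\mathsf{GS}$ of graphical species such that the category $\mathsf{MO}$ of modular operads is isomorphic to the Eilenberg–Moore category $\mathsf{GS}^{\mathbb O}$ of algebras for $\mathbb O$.
   Context: **Graphical species.** Let $\mathbf B^{\S}$ be the category whose objects are all finite sets and one extra object $\S$, with: $\mathrm{Hom}(X,Y)$ the set of bijections $X\to Y$; $\mathrm{Hom}(\S,\S)=\{\mathrm{id},\tau\}$ with $\tau^2=\mathrm{id}$; $\mathrm{Hom}(\S,X)=\{ch_x,\ ch_x\circ\tau : x\in X\}$ ($2|X|$ distinct morphisms); no morphisms $X\to\S$; and $f\circ ch_x=ch_{f(x)}$ for bijections $f$. A graphical species is a presheaf $S:(\mathbf B^{\S})^{op}\to\mathsf{Set}$; $\mathsf{GS}$ is the category of these presheaves. Write $S_X,S_{\S}$ for its values and $\omega=S(\tau)$ for the involution on the set $S_{\S}$ of colours. For $\phi\in S_X$, the colour at $x\in X$ is $S(ch_x)(\phi)$. Put $\mathbf 2=\{1,2\}$. **Multiplication.** A multiplication $\diamond$ on $S$ is a family of partial maps $\diamond_{x,y}:S_{X\amalg\{x\}}\times S_{Y\amalg\{y\}}\rightharpoonup S_{X\amalg Y}$ (all finite $X,Y$, all $x,y$), defined exactly on pairs $(\phi,\psi)$ with $S(ch_x)(\phi)=S(ch_y\circ\tau)(\psi)$, preserving the colours at the remaining elements of $X$ and $Y$, such that: (m1) $\psi\diamond_{y,x}\phi=\phi\diamond_{x,y}\psi$; (m2) for bijections $\sigma:X\amalg\{x\}\to W\amalg\{w\}$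 with $\sigma(x)=w$ and $\rho:Y\amalg\{y\}\to Z\amalg\{z\}$ with $\rho(y)=z$, with restrictions $\hat\sigma,\hat\rho$, one has $S(\hat\sigma\sqcup\hat\rho)(\phi\diamond_{w,z}\psi)=S(\sigma)(\phi)\diamond_{x,y}S(\rho)(\psi)$. A unit for $\diamond$ is a map $\epsilon:S_{\S}\to S_{\mathbf 2}$, $c\mapsto\epsilon_c$, such that for all $\phi\in S_{X\amalg\{x\}}$ with $S(ch_x)(\phi)=c$, the products $\phi\diamond_{x,2}\epsilon_c$ and $\epsilon_c\diamond_{2,x}\phi$ are defined and equal $\phi$ (identifying $S_{X\amalg\{1\}}$ with $S_{X\amalg\{x\}}$ along $1\leftrightarrow x$). **Contraction.** A contraction $\zeta$ on $S$ is a family of partial maps $\zeta_{x,y}:S_{X\amalg\{x,y\}}\rightharpoonup S_X$, defined exactly on those $\phi$ with $S(ch_x)(\phi)=S(ch_y\circ\tau)(\phi)$, preserving the colours at elements of $X$, with $\zeta_{x,y}=\zeta_{y,x}$, and equivariant: if $\sigma:X\amalg\{x,y\}\to Z\amalg\{w,z\}$ is a bijection with $\sigma(x)=w$, $\sigma(y)=z$ and restriction $\hat\sigma:X\to Z$, then $S(\hat\sigma)(\zeta_{w,z}(\phi))=\zeta_{x,y}(S(\sigma)(\phi))$. **Modular operads.** A modular operad is a tuple $(S,\diamond,\zeta,\epsilon)$ with $S$ a graphical species, $\diamond$ a multiplication with unit $\epsilon$, and $\zeta$ a contraction, such that whenever both sides are defined: (M1) $(\phi_1\diamond_{w,x}\phi_2)\diamond_{y,z}\phi_3=\phi_1\diamond_{w,x}(\phi_2\diamond_{y,z}\phi_3)$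 for $\phi_1\in S_{X_1\amalg\{w\}}$, $\phi_2\in S_{X_2\amalg\{x,y\}}$, $\phi_3\in S_{X_3\amalg\{z\}}$; (M2) $\zeta_{w,x}\zeta_{y,z}(\phi)=\zeta_{y,z}\zeta_{w,x}(\phi)$ for $\phi\in S_{X\amalg\{w,x,y,z\}}$; (M3) $\zeta_{w,x}(\phi)\diamond_{y,z}\psi=\zeta_{w,x}(\phi\diamond_{y,z}\psi)$ for $\phi\in S_{X_1\amalg\{w,x,y\}}$, $\psi\in S_{X_2\amalg\{z\}}$; (M4) $\zeta_{y,z}(\phi\diamond_{w,x}\psi)=\zeta_{w,x}(\phi\diamond_{y,z}\psi)$ for $\phi\in S_{X_1\amalg\{w,y\}}$, $\psi\in S_{X_2\amalg\{x,z\}}$. Morphisms in $\mathsf{MO}$ are morphisms of graphical species preserving $\diamond$, $\zeta$ and $\epsilon$. *)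

theory Defs
  imports "HOL-Library.FuncSet"
begin

section \<open>Categories, functors, monads\<close>

record ('o, 'a) cat =
  Obj :: "'o set"
  Arr :: "'a set"
  Dom :: "'a \<Rightarrow> 'o"
  Cod :: "'a \<Rightarrow> 'o"
  Ident :: "'o \<Rightarrow> 'a"
  Comp :: "'a \<Rightarrow> 'a \<Rightarrow> 'a" \<comment> \<open>\<open>Comp C g f\<close> is \<open>g\<close> after \<open>f\<close>\<close>

definition Hom :: "('o, 'a) cat \<Rightarrow> 'o \<Rightarrow> 'o \<Rightarrow> 'a set" where
  "Hom C X Y = {f \<in> Arr C. Dom C f = X \<and> Cod C f = Y}"

definition category :: "('o, 'a) cat \<Rightarrow> bool" where
  "category C \<longleftrightarrow>
     (\<forall>f\<in>Arr C. Dom C f \<in> Obj C \<and> Cod C f \<in> Obj C) \<and>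
     (\<forall>X\<in>Obj C. Ident C X \<in> Hom C X X) \<and>
     (\<forall>f\<in>Arr C. \<forall>g\<in>Arr C. Cod C f = Dom C g \<longrightarrow> Comp C g f \<in> Hom C (Dom C f) (Cod C g)) \<and>
     (\<forall>f\<in>Arr C. Comp C f (Ident C (Dom C f)) = f \<and> Comp C (Ident C (Cod C f)) f = f) \<and>
     (\<forall>f\<in>Arr C. \<forall>g\<in>Arr C. \<forall>h\<in>Arr C. Cod C f = Dom C g \<longrightarrow> Cod C g = Dom C h \<longrightarrow>
        Comp C h (Comp C g f) = Comp C (Comp C h g) f)"

definition op_cat :: "('o, 'a) cat \<Rightarrow> ('o, 'a) cat" where
  "op_cat C = \<lparr>Obj = Obj C, Arr = Arr C, Dom = Cod C, Cod = Dom C,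
     Ident = Ident C, Comp = (\<lambda>g f. Comp C f g)\<rparr>"

record ('o, 'a, 'p, 'b) func =
  fobj :: "'o \<Rightarrow> 'p"
  farr :: "'a \<Rightarrow> 'b"

text \<open>
  Functors and natural transformations are required to be extensional, so that HOL equality of
  them is the intended equality.  This matters because they are themselves objects and arrows
  of categories below, and categories are compared up to isomorphism, not just equivalence.
\<close>

definition is_functor ::
  "('o, 'a) cat \<Rightarrow> ('p, 'b) cat \<Rightarrow> ('o, 'a, 'p, 'b) func \<Rightarrow> bool" where
  "is_functor C D F \<longleftrightarrow>
     fobj F \<in> Obj C \<rightarrow>\<^sub>E Obj D \<and> farr F \<in> Arr C \<rightarrow>\<^sub>E Arr D \<and>
     (\<forall>f\<in>Arr C. farr F f \<in> Hom D (fobj F (Dom C f)) (fobj F (Cod C f))) \<and>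
     (\<forall>X\<in>Obj C. farr F (Ident C X) = Ident D (fobj F X)) \<and>
     (\<forall>f\<in>Arr C. \<forall>g\<in>Arr C. Cod C f = Dom C g \<longrightarrow>
        farr F (Comp C g f) = Comp D (farr F g) (farr F f))"

definition id_functor :: "('o, 'a) cat \<Rightarrow> ('o, 'a, 'o, 'a) func" where
  "id_functor C = \<lparr>fobj = (\<lambda>X\<in>Obj C. X), farr = (\<lambda>f\<in>Arr C. f)\<rparr>"

definition comp_functor ::
  "('o, 'a) cat \<Rightarrow> ('p, 'b, 'q, 'c) func \<Rightarrow> ('o, 'a, 'p, 'b) func \<Rightarrow> ('o, 'a, 'q, 'c) func" where
  "comp_functor C G F =
     \<lparr>fobj = compose (Obj C) (fobj G) (fobj F), farr = compose (Arr C) (farr G) (farr F)\<rparr>"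

definition nat_trans ::
  "('o, 'a) cat \<Rightarrow> ('p, 'b) cat \<Rightarrow> ('o, 'a, 'p, 'b) func \<Rightarrow> ('o, 'a, 'p, 'b) func
     \<Rightarrow> ('o \<Rightarrow> 'b) \<Rightarrow> bool" where
  "nat_trans C D F G \<eta> \<longleftrightarrow>
     is_functor C D F \<and> is_functor C D G \<and> \<eta> \<in> extensional (Obj C) \<and>
     (\<forall>X\<in>Obj C. \<eta> X \<in> Hom D (fobj F X) (fobj G X)) \<and>
     (\<forall>f\<in>Arr C. Comp D (farr G f) (\<eta> (Dom C f)) = Comp D (\<eta> (Cod C f)) (farr F f))"

text \<open>Arrows of concrete categories: some underlying data tagged with source and target.\<close>

datatype ('o, 'f) arrow = Arrow (src: 'o) (tgt: 'o) (body: 'f)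

definition functor_cat ::
  "('o, 'a) cat \<Rightarrow> ('p, 'b) cat
     \<Rightarrow> (('o, 'a, 'p, 'b) func, (('o, 'a, 'p, 'b) func, 'o \<Rightarrow> 'b) arrow) cat" where
  "functor_cat C D = \<lparr>
     Obj = {F. is_functor C D F},
     Arr = {Arrow F G \<eta> | F G \<eta>. nat_trans C D F G \<eta>},
     Dom = src, Cod = tgt,
     Ident = (\<lambda>F. Arrow F F (\<lambda>X\<in>Obj C. Ident D (fobj F X))),
     Comp = (\<lambda>\<beta> \<alpha>. Arrow (src \<alpha>) (tgt \<beta>) (\<lambda>X\<in>Obj C. Comp D (body \<beta> X) (body \<alpha> X)))\<rparr>"

definition monad ::
  "('o, 'a) cat \<Rightarrow> ('o, 'a, 'o, 'a) func \<Rightarrow> ('o \<Rightarrow> 'a) \<Rightarrow> ('o \<Rightarrow> 'a) \<Rightarrow> bool" where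
  "monad C T \<eta> \<mu> \<longleftrightarrow>
     category C \<and> is_functor C C T \<and>
     nat_trans C C (id_functor C) T \<eta> \<and>
     nat_trans C C (comp_functor C T T) T \<mu> \<and>
     (\<forall>X\<in>Obj C.
        Comp C (\<mu> X) (farr T (\<mu> X)) = Comp C (\<mu> X) (\<mu> (fobj T X)) \<and>
        Comp C (\<mu> X) (farr T (\<eta> X)) = Ident C (fobj T X) \<and>
        Comp C (\<mu> X) (\<eta> (fobj T X)) = Ident C (fobj T X))"

definition is_algebra ::
  "('o, 'a) cat \<Rightarrow> ('o, 'a, 'o, 'a) func \<Rightarrow> ('o \<Rightarrow> 'a) \<Rightarrow> ('o \<Rightarrow> 'a) \<Rightarrow> 'o \<times> 'a \<Rightarrow> bool" where
  "is_algebra C T \<eta> \<mu> = (\<lambda>(A, \<theta>).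
     A \<in> Obj C \<and> \<theta> \<in> Hom C (fobj T A) A \<and>
     Comp C \<theta> (\<eta> A) = Ident C A \<and>
     Comp C \<theta> (farr T \<theta>) = Comp C \<theta> (\<mu> A))"

definition EM_cat ::
  "('o, 'a) cat \<Rightarrow> ('o, 'a, 'o, 'a) func \<Rightarrow> ('o \<Rightarrow> 'a) \<Rightarrow> ('o \<Rightarrow> 'a)
     \<Rightarrow> ('o \<times> 'a, ('o \<times> 'a, 'a) arrow) cat" where
  "EM_cat C T \<eta> \<mu> = \<lparr>
     Obj = {A. is_algebra C T \<eta> \<mu> A},
     Arr = {Arrow (A, \<theta>) (B, \<theta>') f | A \<theta> B \<theta>' f.
              is_algebra C T \<eta> \<mu> (A, \<theta>) \<and> is_algebra C T \<eta> \<mu> (B, \<theta>') \<and>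
              f \<in> Hom C A B \<and> Comp C f \<theta> = Comp C \<theta>' (farr T f)},
     Dom = src, Cod = tgt,
     Ident = (\<lambda>A. Arrow A A (Ident C (fst A))),
     Comp = (\<lambda>g f. Arrow (src f) (tgt g) (Comp C (body g) (body f)))\<rparr>"

definition isomorphic_cats :: "('o, 'a) cat \<Rightarrow> ('p, 'b) cat \<Rightarrow> bool" where
  "isomorphic_cats C D \<longleftrightarrow> category C \<and> category D \<and>
     (\<exists>F G. is_functor C D F \<and> is_functor D C G \<and>
        comp_functor C G F = id_functor C \<and> comp_functor D F G = id_functor D)"


section \<open>Graphical species\<close>

text \<open>
  The type \<open>'u\<close> plays the role of the universe: a set is a subset of \<open>'u\<close>, a finite set is a
  finite subset of \<open>'u\<close>.
\<close>

definition set_cat :: "('u set, ('u set, 'u \<Rightarrow> 'u) arrow) cat" where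
  "set_cat = \<lparr>
     Obj = UNIV,
     Arr = {Arrow A B f | A B f. f \<in> A \<rightarrow>\<^sub>E B},
     Dom = src, Cod = tgt,
     Ident = (\<lambda>A. Arrow A A (\<lambda>a\<in>A. a)),
     Comp = (\<lambda>g f. Arrow (src f) (tgt g) (compose (src f) (body g) (body f)))\<rparr>"

datatype 'u bobj = Sec | Fin "'u set"

text \<open>
  \<open>SecMor False\<close> and \<open>SecMor True\<close> are the identity and the involution \<open>\<tau>\<close> of the extra object
  \<open>Sec\<close>; \<open>Ch X x False\<close> is \<open>ch\<^sub>x : Sec \<rightarrow> X\<close> and \<open>Ch X x True\<close> is \<open>ch\<^sub>x \<circ> \<tau>\<close>;
  \<open>Bij X Y f\<close> is a bijection \<open>f : X \<rightarrow> Y\<close>.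
\<close>

datatype 'u bmor = SecMor bool | Ch "'u set" 'u bool | Bij "'u set" "'u set" "'u \<Rightarrow> 'u"

fun bdom :: "'u bmor \<Rightarrow> 'u bobj" where
  "bdom (SecMor b) = Sec"
| "bdom (Ch X x b) = Sec"
| "bdom (Bij X Y f) = Fin X"

fun bcod :: "'u bmor \<Rightarrow> 'u bobj" where
  "bcod (SecMor b) = Sec"
| "bcod (Ch X x b) = Fin X"
| "bcod (Bij X Y f) = Fin Y"

fun bident :: "'u bobj \<Rightarrow> 'u bmor" where
  "bident Sec = SecMor False"
| "bident (Fin X) = Bij X X (\<lambda>x\<in>X. x)"

fun bcomp :: "'u bmor \<Rightarrow> 'u bmor \<Rightarrow> 'u bmor" where
  "bcomp (SecMor b) (SecMor b') = SecMor (b \<noteq> b')"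
| "bcomp (Ch X x b) (SecMor b') = Ch X x (b \<noteq> b')"
| "bcomp (Bij X Y f) (Ch X' x b) = Ch Y (f x) b"
| "bcomp (Bij Y Z g) (Bij X Y' f) = Bij X Z (compose X g f)"
| "bcomp _ _ = undefined" \<comment> \<open>not composable\<close>

definition B_cat :: "('u bobj, 'u bmor) cat" where
  "B_cat = \<lparr>
     Obj = {Sec} \<union> {Fin X | X. finite X},
     Arr = range SecMor \<union> {Ch X x b | X x b. finite X \<and> x \<in> X}
           \<union> {Bij X Y f | X Y f. finite X \<and> finite Y \<and> f \<in> extensional X \<and> bij_betw f X Y},
     Dom = bdom, Cod = bcod, Ident = bident, Comp = bcomp\<rparr>"

type_synonym 'u species = "('u bobj, 'u bmor, 'u set, ('u set, 'u \<Rightarrow> 'u) arrow) func"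

type_synonym 'u species_mor =
  "('u species, 'u bobj \<Rightarrow> ('u set, 'u \<Rightarrow> 'u) arrow) arrow"

definition GS :: "('u species, 'u species_mor) cat" where
  "GS = functor_cat (op_cat B_cat) set_cat"

abbreviation colours :: "'u species \<Rightarrow> 'u set" where
  "colours S \<equiv> fobj S Sec"

abbreviation elems :: "'u species \<Rightarrow> 'u set \<Rightarrow> 'u set" where
  "elems S X \<equiv> fobj S (Fin X)"

definition act :: "'u species \<Rightarrow> 'u bmor \<Rightarrow> 'u \<Rightarrow> 'u" where
  "act S m = body (farr S m)"

abbreviation colour :: "'u species \<Rightarrow> 'u set \<Rightarrow> 'u \<Rightarrow> 'u \<Rightarrow> 'u" where
  "colour S X x \<phi> \<equiv> act S (Ch X x False) \<phi>"

abbreviation dual_colour :: "'u species \<Rightarrow> 'u set \<Rightarrow> 'u \<Rightarrow> 'u \<Rightarrow> 'u" where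
  "dual_colour S X x \<phi> \<equiv> act S (Ch X x True) \<phi>"

abbreviation relabel :: "'u species \<Rightarrow> 'u set \<Rightarrow> 'u set \<Rightarrow> ('u \<Rightarrow> 'u) \<Rightarrow> 'u \<Rightarrow> 'u" where
  "relabel S X Y f \<phi> \<equiv> act S (Bij X Y (restrict f X)) \<phi>"

definition app :: "'u species_mor \<Rightarrow> 'u bobj \<Rightarrow> 'u \<Rightarrow> 'u" where
  "app f b = body (body f b)"


section \<open>Multiplication, units, contraction\<close>

text \<open>
  A coproduct \<open>X \<amalg> Y\<close> is read as the union of disjoint sets.  Thus a multiplication consists of
  partial maps \<open>mul X x Y y\<close> from \<open>S\<close> of \<open>X \<union> {x}\<close> times \<open>S\<close> of \<open>Y \<union> {y}\<close> to \<open>S\<close> of \<open>X \<union> Y\<close>, for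
  disjoint finite \<open>X\<close> and \<open>Y\<close> with \<open>x \<notin> X\<close> and \<open>y \<notin> Y\<close>; values on overlapping \<open>X\<close> and \<open>Y\<close> are
  determined by these through equivariance.  Partial maps are total functions into an option
  type, with value \<open>None\<close> also at indices that are not admissible, again in order that HOL
  equality be the intended one.
\<close>

type_synonym 'u mult = "'u set \<Rightarrow> 'u \<Rightarrow> 'u set \<Rightarrow> 'u \<Rightarrow> 'u \<Rightarrow> 'u \<Rightarrow> 'u option"

type_synonym 'u contr = "'u set \<Rightarrow> 'u \<Rightarrow> 'u \<Rightarrow> 'u \<Rightarrow> 'u option"

definition multiplication :: "'u species \<Rightarrow> 'u mult \<Rightarrow> bool" where
  "multiplication S mul \<longleftrightarrow>
     (\<forall>X x Y y \<phi> \<psi>. mul X x Y y \<phi> \<psi> \<noteq> None \<longleftrightarrow>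
        finite X \<and> finite Y \<and> X \<inter> Y = {} \<and> x \<notin> X \<and> y \<notin> Y \<and>
        \<phi> \<in> elems S (X \<union> {x}) \<and> \<psi> \<in> elems S (Y \<union> {y}) \<and>
        colour S (X \<union> {x}) x \<phi> = dual_colour S (Y \<union> {y}) y \<psi>) \<and>
     (\<forall>X x Y y \<phi> \<psi> \<chi>. mul X x Y y \<phi> \<psi> = Some \<chi> \<longrightarrow>
        \<chi> \<in> elems S (X \<union> Y) \<and>
        (\<forall>e\<in>X. colour S (X \<union> Y) e \<chi> = colour S (X \<union> {x}) e \<phi>) \<and>
        (\<forall>e\<in>Y. colour S (X \<union> Y) e \<chi> = colour S (Y \<union> {y}) e \<psi>)) \<and>
     (\<forall>X x Y y \<phi> \<psi>. mul Y y X x \<psi> \<phi> = mul X x Y y \<phi> \<psi>) \<and>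
     (\<forall>X x Y y W w Z z \<sigma> \<rho>.
        finite X \<and> finite Y \<and> X \<inter> Y = {} \<and> x \<notin> X \<and> y \<notin> Y \<and>
        finite W \<and> finite Z \<and> W \<inter> Z = {} \<and> w \<notin> W \<and> z \<notin> Z \<and>
        bij_betw \<sigma> (X \<union> {x}) (W \<union> {w}) \<and> \<sigma> x = w \<and>
        bij_betw \<rho> (Y \<union> {y}) (Z \<union> {z}) \<and> \<rho> y = z \<longrightarrow>
        (\<forall>\<phi>\<in>elems S (W \<union> {w}). \<forall>\<psi>\<in>elems S (Z \<union> {z}).
           map_option (relabel S (X \<union> Y) (W \<union> Z) (\<lambda>e. if e \<in> X then \<sigma> e else \<rho> e))
             (mul W w Z z \<phi> \<psi>)
           = mul X x Y y (relabel S (X \<union> {x}) (W \<union> {w}) \<sigma> \<phi>)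
                         (relabel S (Y \<union> {y}) (Z \<union> {z}) \<rho> \<psi>)))"

text \<open>
  The parameters \<open>p\<close> and \<open>q\<close> are the elements \<open>1\<close> and \<open>2\<close> of the set \<open>\<two> = {1, 2}\<close>.  The product of
  \<open>\<phi>\<close> in \<open>S\<close> of \<open>X \<union> {x}\<close> with a unit lies in \<open>S\<close> of \<open>X \<union> {p}\<close>, hence the relabelling of \<open>x\<close>
  as \<open>p\<close>.
\<close>

definition is_unit_for :: "'u \<Rightarrow> 'u \<Rightarrow> 'u species \<Rightarrow> 'u mult \<Rightarrow> ('u \<Rightarrow> 'u) \<Rightarrow> bool" where
  "is_unit_for p q S mul \<epsilon> \<longleftrightarrow>
     \<epsilon> \<in> colours S \<rightarrow>\<^sub>E elems S {p, q} \<and>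
     (\<forall>X x. finite X \<and> x \<notin> X \<and> p \<notin> X \<longrightarrow>
       (\<forall>\<phi>\<in>elems S (X \<union> {x}).
         let c = colour S (X \<union> {x}) x \<phi>;
             \<phi>' = relabel S (X \<union> {p}) (X \<union> {x}) (\<lambda>e. if e = p then x else e) \<phi>
         in mul X x {p} q \<phi> (\<epsilon> c) = Some \<phi>' \<and> mul {p} q X x (\<epsilon> c) \<phi> = Some \<phi>'))"

definition contraction :: "'u species \<Rightarrow> 'u contr \<Rightarrow> bool" where
  "contraction S con \<longleftrightarrow>
     (\<forall>X x y \<phi>. con X x y \<phi> \<noteq> None \<longleftrightarrow>
        finite X \<and> x \<notin> X \<and> y \<notin> X \<and> x \<noteq> y \<and> \<phi> \<in> elems S (X \<union> {x, y}) \<and>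
        colour S (X \<union> {x, y}) x \<phi> = dual_colour S (X \<union> {x, y}) y \<phi>) \<and>
     (\<forall>X x y \<phi> \<chi>. con X x y \<phi> = Some \<chi> \<longrightarrow>
        \<chi> \<in> elems S X \<and> (\<forall>e\<in>X. colour S X e \<chi> = colour S (X \<union> {x, y}) e \<phi>)) \<and>
     (\<forall>X x y. con X x y = con X y x) \<and>
     (\<forall>X x y Z w z \<sigma>.
        finite X \<and> x \<notin> X \<and> y \<notin> X \<and> x \<noteq> y \<and> finite Z \<and> w \<notin> Z \<and> z \<notin> Z \<and> w \<noteq> z \<and>
        bij_betw \<sigma> (X \<union> {x, y}) (Z \<union> {w, z}) \<and> \<sigma> x = w \<and> \<sigma> y = z \<longrightarrow>
        (\<forall>\<phi>\<in>elems S (Z \<union> {w, z}).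
           map_option (relabel S X Z \<sigma>) (con Z w z \<phi>)
           = con X x y (relabel S (X \<union> {x, y}) (Z \<union> {w, z}) \<sigma> \<phi>)))"


section \<open>Modular operads\<close>

definition agree :: "'b option \<Rightarrow> 'b option \<Rightarrow> bool" (infix "\<triangleq>" 50) where
  "a \<triangleq> b \<longleftrightarrow> (a \<noteq> None \<and> b \<noteq> None \<longrightarrow> a = b)"

type_synonym 'u modop = "'u species \<times> 'u mult \<times> 'u contr \<times> ('u \<Rightarrow> 'u)"

text \<open>
  In the four coherence axioms, definedness of both sides already enforces that the indices are
  distinct, the sets finite and disjoint, and \<open>\<phi>\<close>, \<open>\<psi>\<close> elements of the appropriate sets.
\<close>

definition modular_operad :: "'u \<Rightarrow> 'u \<Rightarrow> 'u modop \<Rightarrow> bool" where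
  "modular_operad p q = (\<lambda>(S, mul, con, \<epsilon>).
     S \<in> Obj GS \<and> multiplication S mul \<and> is_unit_for p q S mul \<epsilon> \<and> contraction S con \<and>
     (\<forall>X1 X2 X3 w x y z \<phi>1 \<phi>2 \<phi>3.
        Option.bind (mul X1 w (X2 \<union> {y}) x \<phi>1 \<phi>2) (\<lambda>a. mul (X1 \<union> X2) y X3 z a \<phi>3) \<triangleq>
        Option.bind (mul (X2 \<union> {x}) y X3 z \<phi>2 \<phi>3) (\<lambda>b. mul X1 w (X2 \<union> X3) x \<phi>1 b)) \<and>
     (\<forall>X w x y z \<phi>.
        Option.bind (con (X \<union> {w, x}) y z \<phi>) (con X w x) \<triangleq>
        Option.bind (con (X \<union> {y, z}) w x \<phi>) (con X y z)) \<and>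
     (\<forall>X1 X2 w x y z \<phi> \<psi>.
        Option.bind (con (X1 \<union> {y}) w x \<phi>) (\<lambda>a. mul X1 y X2 z a \<psi>) \<triangleq>
        Option.bind (mul (X1 \<union> {w, x}) y X2 z \<phi> \<psi>) (con (X1 \<union> X2) w x)) \<and>
     (\<forall>X1 X2 w x y z \<phi> \<psi>.
        Option.bind (mul (X1 \<union> {y}) w (X2 \<union> {z}) x \<phi> \<psi>) (con (X1 \<union> X2) y z) \<triangleq>
        Option.bind (mul (X1 \<union> {w}) y (X2 \<union> {x}) z \<phi> \<psi>) (con (X1 \<union> X2) w x)))"

definition modular_operad_mor ::
  "'u \<Rightarrow> 'u \<Rightarrow> 'u modop \<Rightarrow> 'u modop \<Rightarrow> 'u species_mor \<Rightarrow> bool" where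
  "modular_operad_mor p q = (\<lambda>(S, mul, con, \<epsilon>) (S', mul', con', \<epsilon>') f.
     f \<in> Hom GS S S' \<and>
     (\<forall>X x Y y \<phi> \<psi> \<chi>. mul X x Y y \<phi> \<psi> = Some \<chi> \<longrightarrow>
        mul' X x Y y (app f (Fin (X \<union> {x})) \<phi>) (app f (Fin (Y \<union> {y})) \<psi>)
        = Some (app f (Fin (X \<union> Y)) \<chi>)) \<and>
     (\<forall>X x y \<phi> \<chi>. con X x y \<phi> = Some \<chi> \<longrightarrow>
        con' X x y (app f (Fin (X \<union> {x, y})) \<phi>) = Some (app f (Fin X) \<chi>)) \<and>
     (\<forall>c\<in>colours S. app f (Fin {p, q}) (\<epsilon> c) = \<epsilon>' (app f Sec c)))"

definition MO :: "'u \<Rightarrow> 'u \<Rightarrow> ('u modop, ('u modop, 'u species_mor) arrow) cat" where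
  "MO p q = \<lparr>
     Obj = {M. modular_operad p q M},
     Arr = {Arrow M N f | M N f.
              modular_operad p q M \<and> modular_operad p q N \<and> modular_operad_mor p q M N f},
     Dom = src, Cod = tgt,
     Ident = (\<lambda>M. Arrow M M (Ident GS (fst M))),
     Comp = (\<lambda>g f. Arrow (src f) (tgt g) (Comp GS (body g) (body f)))\<rparr>"

end

theory Submission
  imports Defs
begin

text \<open>
  The forgetful functor from modular operads to graphical species has a left adjoint and is strictly
  monadic.  The free modular operad on a species \<open>S\<close> needs no syntax and no explicit congruence: it is
  the part generated by \<open>S\<close> of the product of all modular operads \<open>M\<close> equipped with a map \<open>S \<rightarrow> M\<close>.
  This product is too large for the universe \<open>'u\<close>, but the generated part is the closure of a small
  set under a small family of finitary operations, so that it has a copy inside \<open>'u\<close>.  Its axioms hold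
  because they hold in every factor.  Conversely, an algebra \<open>\<theta> : T A \<rightarrow> A\<close> equips \<open>A\<close> with the operations
  \<open>\<phi> \<diamond> \<psi> = \<theta> (\<eta> \<phi> \<diamond> \<eta> \<psi>)\<close>, and so on; the algebra laws say that \<open>\<theta>\<close> preserves them.
\<close>

section \<open>Strict monadicity of concrete categories\<close>

text \<open>An isomorphism of categories is wanted, not an equivalence, so every algebra must come
  from exactly one modular operad, with equality of structures on the nose; this is the role of
  \<open>antisym\<close>. The operations are partial, and this shapes both constructions. Their
  domains are described by carriers and colours alone, so any map of species carries composable
  arguments to composable arguments, whether or not it preserves products. Hence \<eta>, which is
  only a map of species, can serve as the section along which an algebra inherits its operations.
  The passage back into \<open>'u\<close> rests on the infinity of \<open>'u\<close>: lists over
  \<open>'u\<close>, hence finite sets, bijections between them and all operation symbols with their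
  indices, are then no more numerous than the elements of \<open>'u\<close>. Infinitely many copies
  of the operations would do no harm; what matters is that each has finitely many arguments and that
  its index sets are finite. The free object and the quotient carried by an algebra satisfy the
  axioms for one common reason, which is isolated in \<open>logical_cover\<close>.\<close>

text \<open>
  A direct form of Beck's theorem, for a category of structured objects with underlying objects given
  by \<open>U\<close>.  The assumptions \<open>final\<close> and \<open>create\<close> replace the creation of coequalizers of split pairs; in
  \<open>create\<close>, \<open>t\<close> and \<open>m\<close> are the parallel pair \<open>T \<theta>\<close> and \<open>\<mu> A\<close>.
\<close>

locale concrete_monadic =
  fixes C :: "('o, 'a) cat" and Ob :: "'m set" and U :: "'m \<Rightarrow> 'o"
    and H :: "'m \<Rightarrow> 'm \<Rightarrow> 'a \<Rightarrow> bool"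
    and F :: "'o \<Rightarrow> 'm" and \<eta> :: "'o \<Rightarrow> 'a"
  assumes cat: "category C"
    and U_obj: "M \<in> Ob \<Longrightarrow> U M \<in> Obj C"
    and H_Hom: "M \<in> Ob \<Longrightarrow> N \<in> Ob \<Longrightarrow> H M N f \<Longrightarrow> f \<in> Hom C (U M) (U N)"
    and H_Ident: "M \<in> Ob \<Longrightarrow> H M M (Ident C (U M))"
    and H_Comp: "L \<in> Ob \<Longrightarrow> M \<in> Ob \<Longrightarrow> N \<in> Ob \<Longrightarrow> H L M f \<Longrightarrow> H M N g \<Longrightarrow> H L N (Comp C g f)"
    and F_obj: "X \<in> Obj C \<Longrightarrow> F X \<in> Ob"
    and \<eta>_Hom: "X \<in> Obj C \<Longrightarrow> \<eta> X \<in> Hom C X (U (F X))"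
    and free: "X \<in> Obj C \<Longrightarrow> M \<in> Ob \<Longrightarrow> f \<in> Hom C X (U M) \<Longrightarrow>
      \<exists>!g. H (F X) M g \<and> Comp C g (\<eta> X) = f"
    and final: "M \<in> Ob \<Longrightarrow> N \<in> Ob \<Longrightarrow> H (F (U M)) M e \<Longrightarrow> Comp C e (\<eta> (U M)) = Ident C (U M) \<Longrightarrow>
      g \<in> Hom C (U M) (U N) \<Longrightarrow> H (F (U M)) N (Comp C g e) \<Longrightarrow> H M N g"
    and antisym: "M \<in> Ob \<Longrightarrow> N \<in> Ob \<Longrightarrow> U M = U N \<Longrightarrow>
      H M N (Ident C (U M)) \<Longrightarrow> H N M (Ident C (U M)) \<Longrightarrow> M = N"
    and create: "A \<in> Obj C \<Longrightarrow> \<theta> \<in> Hom C (U (F A)) A \<Longrightarrow> Comp C \<theta> (\<eta> A) = Ident C A \<Longrightarrow>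
      H (F (U (F A))) (F A) t \<Longrightarrow> Comp C t (\<eta> (U (F A))) = Comp C (\<eta> A) \<theta> \<Longrightarrow>
      H (F (U (F A))) (F A) m \<Longrightarrow> Comp C m (\<eta> (U (F A))) = Ident C (U (F A)) \<Longrightarrow>
      Comp C \<theta> t = Comp C \<theta> m \<Longrightarrow> \<exists>M\<in>Ob. U M = A \<and> H (F A) M \<theta>"
begin

text \<open>Written field by field like \<open>MO\<close>, so that \<open>MO one two\<close> becomes
  an instance of it by unfolding alone.\<close>

definition D :: "('m, ('m, 'a) arrow) cat" where
  "D = \<lparr>Obj = Ob, Arr = {Arrow M N f | M N f. M \<in> Ob \<and> N \<in> Ob \<and> H M N f},
     Dom = src, Cod = tgt, Ident = (\<lambda>M. Arrow M M (Ident C (U M))),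
     Comp = (\<lambda>g f. Arrow (src f) (tgt g) (Comp C (body g) (body f)))\<rparr>"

section \<open>Category laws in terms of hom-sets\<close>

lemma Comp_Hom: "f \<in> Hom C X Y \<Longrightarrow> g \<in> Hom C Y Z \<Longrightarrow> Comp C g f \<in> Hom C X Z"
  using cat unfolding category_def by (auto simp: Hom_def)

lemma Comp_assoc:
  "f \<in> Hom C X Y \<Longrightarrow> g \<in> Hom C Y Z \<Longrightarrow> h \<in> Hom C Z W \<Longrightarrow>
    Comp C (Comp C h g) f = Comp C h (Comp C g f)"
  using cat unfolding category_def by (auto simp: Hom_def)

lemma Ident_Hom: "X \<in> Obj C \<Longrightarrow> Ident C X \<in> Hom C X X"
  using cat unfolding category_def by auto

lemma Comp_Ident: "f \<in> Hom C X Y \<Longrightarrow> Comp C f (Ident C X) = f"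
  and Ident_Comp: "f \<in> Hom C X Y \<Longrightarrow> Comp C (Ident C Y) f = f"
  using cat unfolding category_def by (auto simp: Hom_def)

lemma Hom_obj: "f \<in> Hom C X Y \<Longrightarrow> X \<in> Obj C" "f \<in> Hom C X Y \<Longrightarrow> Y \<in> Obj C"
  using cat unfolding category_def by (auto simp: Hom_def)

section \<open>Extension along the unit, the free functor and the counit\<close>

definition ext :: "'o \<Rightarrow> 'm \<Rightarrow> 'a \<Rightarrow> 'a" where
  "ext X M f = (THE g. H (F X) M g \<and> Comp C g (\<eta> X) = f)"

lemma
  assumes "M \<in> Ob" "f \<in> Hom C X (U M)"
  shows ext_H: "H (F X) M (ext X M f)" and ext_\<eta>: "Comp C (ext X M f) (\<eta> X) = f"
  using theI'[OF free[OF Hom_obj(1)[OF assms(2)] assms]] unfolding ext_def by auto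

lemma ext_unique:
  assumes "X \<in> Obj C" "M \<in> Ob" "H (F X) M g"
  shows "ext X M (Comp C g (\<eta> X)) = g"
proof -
  have "Comp C g (\<eta> X) \<in> Hom C X (U M)"
    using assms H_Hom F_obj \<eta>_Hom Comp_Hom by metis
  from free[OF assms(1,2) this] show ?thesis
    unfolding ext_def by (rule the1_equality) (use assms in auto)
qed

text \<open>The working form of uniqueness in \<open>free\<close>: arrows out of a free object are
  compared on generators. Functoriality of \<open>tarr\<close>, naturality of the counit and one
  unit law of the monad reduce to it.\<close>

lemma free_eqI:
  assumes "X \<in> Obj C" "M \<in> Ob" "H (F X) M g" "H (F X) M h" "Comp C g (\<eta> X) = Comp C h (\<eta> X)"
  shows "g = h"
  using assms ext_unique by metis

lemma ext_Hom: "M \<in> Ob \<Longrightarrow> f \<in> Hom C X (U M) \<Longrightarrow> ext X M f \<in> Hom C (U (F X)) (U M)"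
  using H_Hom ext_H F_obj Hom_obj by metis

abbreviation tobj :: "'o \<Rightarrow> 'o" where "tobj X \<equiv> U (F X)"

definition tarr :: "'a \<Rightarrow> 'a" where
  "tarr f = ext (Dom C f) (F (Cod C f)) (Comp C (\<eta> (Cod C f)) f)"

definition counit :: "'m \<Rightarrow> 'a" where
  "counit M = ext (U M) M (Ident C (U M))"

lemma
  assumes "f \<in> Hom C X Y"
  shows tarr_H: "H (F X) (F Y) (tarr f)" and tarr_\<eta>: "Comp C (tarr f) (\<eta> X) = Comp C (\<eta> Y) f"
    and tarr_Hom: "tarr f \<in> Hom C (tobj X) (tobj Y)"
proof -
  have "Comp C (\<eta> Y) f \<in> Hom C X (tobj Y)" using assms \<eta>_Hom Hom_obj Comp_Hom by metis
  moreover have "tarr f = ext X (F Y) (Comp C (\<eta> Y) f)" using assms by (simp add: tarr_def Hom_def)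
  ultimately show "H (F X) (F Y) (tarr f)" "Comp C (tarr f) (\<eta> X) = Comp C (\<eta> Y) f"
    "tarr f \<in> Hom C (tobj X) (tobj Y)"
    using ext_H ext_\<eta> ext_Hom F_obj Hom_obj[OF assms] by metis+
qed

lemma tarr_Comp:
  assumes f: "f \<in> Hom C X Y" and g: "g \<in> Hom C Y Z"
  shows "tarr (Comp C g f) = Comp C (tarr g) (tarr f)"
proof (rule free_eqI)
  note gf = Comp_Hom[OF f g]
  note obj = Hom_obj[OF f] Hom_obj[OF g]
  show "X \<in> Obj C" "F Z \<in> Ob" using obj F_obj by auto
  show "H (F X) (F Z) (tarr (Comp C g f))" by (rule tarr_H[OF gf])
  show "H (F X) (F Z) (Comp C (tarr g) (tarr f))"
    using H_Comp tarr_H[OF f] tarr_H[OF g] obj F_obj by metis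
  have "Comp C (Comp C (tarr g) (tarr f)) (\<eta> X) = Comp C (tarr g) (Comp C (tarr f) (\<eta> X))"
    using Comp_assoc[OF \<eta>_Hom tarr_Hom[OF f] tarr_Hom[OF g]] obj by simp
  also have "\<dots> = Comp C (tarr g) (Comp C (\<eta> Y) f)" by (simp add: tarr_\<eta>[OF f])
  also have "\<dots> = Comp C (Comp C (tarr g) (\<eta> Y)) f"
    using Comp_assoc[OF f \<eta>_Hom tarr_Hom[OF g]] obj by simp
  also have "\<dots> = Comp C (Comp C (\<eta> Z) g) f" by (simp add: tarr_\<eta>[OF g])
  also have "\<dots> = Comp C (\<eta> Z) (Comp C g f)"
    using Comp_assoc[OF f g \<eta>_Hom] obj by simp
  also have "\<dots> = Comp C (tarr (Comp C g f)) (\<eta> X)" by (simp add: tarr_\<eta>[OF gf])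
  finally show "Comp C (tarr (Comp C g f)) (\<eta> X) = Comp C (Comp C (tarr g) (tarr f)) (\<eta> X)" ..
qed

lemma tarr_Ident: "X \<in> Obj C \<Longrightarrow> tarr (Ident C X) = Ident C (tobj X)"
  using free_eqI[OF _ _ tarr_H[OF Ident_Hom] H_Ident] F_obj tarr_\<eta>[OF Ident_Hom]
    Comp_Ident[OF \<eta>_Hom] Ident_Comp[OF \<eta>_Hom] by metis

lemma
  assumes "M \<in> Ob"
  shows counit_H: "H (F (U M)) M (counit M)"
    and counit_\<eta>: "Comp C (counit M) (\<eta> (U M)) = Ident C (U M)"
    and counit_Hom: "counit M \<in> Hom C (tobj (U M)) (U M)"
  using assms ext_H ext_\<eta> ext_Hom Ident_Hom U_obj unfolding counit_def by metis+

text \<open>Translates being a morphism into the equation that defines algebra maps. Forward, both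
  composites are morphisms out of the free object \<open>F (U M)\<close> and both restrict to
  \<open>f\<close> along \<eta>, so freeness identifies them. Backward, the right-hand side is
  always a morphism, hence so is \<open>f\<close> after the split epimorphism
  \<open>counit M\<close>, and \<open>final\<close> descends this to \<open>f\<close>. Full
  faithfulness of the comparison functor, naturality of \<mu> and associativity of the monad are all
  read off from here.\<close>

lemma H_iff:
  assumes M: "M \<in> Ob" and N: "N \<in> Ob" and f: "f \<in> Hom C (U M) (U N)"
  shows "H M N f \<longleftrightarrow> Comp C f (counit M) = Comp C (counit N) (tarr f)"
proof
  have 1: "H (F (U M)) N (Comp C (counit N) (tarr f))"
    using H_Comp M N U_obj F_obj counit_H tarr_H[OF f] by metis
  {
    assume "H M N f"
    then have 2: "H (F (U M)) N (Comp C f (counit M))"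
      using H_Comp M N U_obj F_obj counit_H by metis
    have "Comp C (Comp C f (counit M)) (\<eta> (U M)) = f"
      using Comp_assoc[OF \<eta>_Hom counit_Hom f] U_obj M counit_\<eta> Comp_Ident[OF f] by simp
    moreover have "Comp C (Comp C (counit N) (tarr f)) (\<eta> (U M)) = f"
      using Comp_assoc[OF \<eta>_Hom tarr_Hom[OF f] counit_Hom[OF N]]
        Comp_assoc[OF f \<eta>_Hom counit_Hom[OF N]] U_obj M N tarr_\<eta>[OF f] counit_\<eta>
        Ident_Comp[OF f] by simp
    ultimately show "Comp C f (counit M) = Comp C (counit N) (tarr f)"
      using free_eqI[OF U_obj[OF M] N 2 1] by simp
  }
  assume "Comp C f (counit M) = Comp C (counit N) (tarr f)"
  then show "H M N f" using final[OF M N counit_H[OF M] counit_\<eta>[OF M] f] 1 by simp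
qed

section \<open>The monad of the adjunction\<close>

definition T :: "('o, 'a, 'o, 'a) func" where
  "T = \<lparr>fobj = restrict tobj (Obj C), farr = restrict tarr (Arr C)\<rparr>"

definition unit :: "'o \<Rightarrow> 'a" where "unit = restrict \<eta> (Obj C)"

definition \<mu> :: "'o \<Rightarrow> 'a" where "\<mu> = (\<lambda>X\<in>Obj C. counit (F X))"

lemma Arr_Hom: "f \<in> Arr C \<Longrightarrow> f \<in> Hom C (Dom C f) (Cod C f)"
  by (simp add: Hom_def)

lemma Hom_simps: "f \<in> Hom C X Y \<Longrightarrow> f \<in> Arr C \<and> Dom C f = X \<and> Cod C f = Y"
  by (simp add: Hom_def)

lemma T_simps [simp]:
  "X \<in> Obj C \<Longrightarrow> fobj T X = tobj X" "f \<in> Arr C \<Longrightarrow> farr T f = tarr f"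
  by (simp_all add: T_def)

lemma farr_T: "f \<in> Hom C X Y \<Longrightarrow> farr T f = tarr f"
  by (simp add: Hom_def)

lemma tobj_obj [simp]: "X \<in> Obj C \<Longrightarrow> tobj X \<in> Obj C"
  using U_obj F_obj by blast

lemma is_functor_T: "is_functor C C T"
  unfolding is_functor_def
proof (intro conjI ballI impI)
  show "fobj T \<in> Obj C \<rightarrow>\<^sub>E Obj C" by (auto simp: T_def)
  show "farr T \<in> Arr C \<rightarrow>\<^sub>E Arr C"
    using Hom_simps[OF tarr_Hom[OF Arr_Hom]] by (auto simp: T_def)
  show "farr T f \<in> Hom C (fobj T (Dom C f)) (fobj T (Cod C f))" if "f \<in> Arr C" for f
    using tarr_Hom[OF Arr_Hom[OF that]] Hom_obj[OF Arr_Hom[OF that]] that by simp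
  show "farr T (Ident C X) = Ident C (fobj T X)" if "X \<in> Obj C" for X
    using that Hom_simps[OF Ident_Hom[OF that]] by (simp add: tarr_Ident)
  show "farr T (Comp C g f) = Comp C (farr T g) (farr T f)"
    if "f \<in> Arr C" "g \<in> Arr C" "Cod C f = Dom C g" for f g
  proof -
    have "f \<in> Hom C (Dom C f) (Cod C f)" "g \<in> Hom C (Cod C f) (Cod C g)" using that by (auto simp: Hom_def)
    from tarr_Comp[OF this] Hom_simps[OF Comp_Hom[OF this]] that show ?thesis by simp
  qed
qed

lemma is_functor_id: "is_functor C C (id_functor C)"
  using cat unfolding is_functor_def id_functor_def category_def
  by (auto simp: Hom_def)

lemma is_functor_TT: "is_functor C C (comp_functor C T T)"
  using is_functor_T cat unfolding is_functor_def comp_functor_def category_def Hom_def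
  by (auto simp: compose_def PiE_def Pi_def)

lemma counit_natural:
  assumes "f \<in> Hom C X Y"
  shows "Comp C (tarr f) (counit (F X)) = Comp C (counit (F Y)) (tarr (tarr f))"
  using H_iff[OF _ _ tarr_Hom[OF assms]] tarr_H[OF assms] F_obj Hom_obj[OF assms] by blast

lemma monad_T: "monad C T unit \<mu>"
  unfolding monad_def
proof (intro conjI ballI)
  show "nat_trans C C (id_functor C) T unit"
    unfolding nat_trans_def
  proof (intro conjI ballI)
    show "unit \<in> extensional (Obj C)" by (simp add: unit_def)
    show "unit X \<in> Hom C (fobj (id_functor C) X) (fobj T X)" if "X \<in> Obj C" for X
      using that \<eta>_Hom by (simp add: unit_def id_functor_def)
    show "Comp C (farr T f) (unit (Dom C f)) = Comp C (unit (Cod C f)) (farr (id_functor C) f)"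
      if "f \<in> Arr C" for f
      using that tarr_\<eta>[OF Arr_Hom[OF that]] Hom_obj[OF Arr_Hom[OF that]]
      by (simp add: unit_def id_functor_def)
  qed (rule is_functor_id is_functor_T)+
  show "nat_trans C C (comp_functor C T T) T \<mu>"
    unfolding nat_trans_def
  proof (intro conjI ballI)
    show "\<mu> \<in> extensional (Obj C)" by (simp add: \<mu>_def)
    show "\<mu> X \<in> Hom C (fobj (comp_functor C T T) X) (fobj T X)" if "X \<in> Obj C" for X
      using that counit_Hom[OF F_obj] by (simp add: \<mu>_def comp_functor_def compose_def)
    show "Comp C (farr T f) (\<mu> (Dom C f)) = Comp C (\<mu> (Cod C f)) (farr (comp_functor C T T) f)"
      if "f \<in> Arr C" for f
      using that counit_natural[OF Arr_Hom[OF that]] Hom_obj[OF Arr_Hom[OF that]]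
        Hom_simps[OF tarr_Hom[OF Arr_Hom[OF that]]]
      by (simp add: \<mu>_def comp_functor_def compose_def)
  qed (rule is_functor_TT is_functor_T)+
  fix X assume X: "X \<in> Obj C"
  have c: "counit (F X) \<in> Hom C (tobj (tobj X)) (tobj X)"
    and u: "\<eta> X \<in> Hom C X (tobj X)" using X counit_Hom F_obj \<eta>_Hom by auto
  \<comment> \<open>Associativity is \<open>H_iff\<close> applied to \<open>counit (F X)\<close>,
    because the counit of a free object is itself a morphism between free objects.\<close>
  show "Comp C (\<mu> X) (farr T (\<mu> X)) = Comp C (\<mu> X) (\<mu> (fobj T X))"
    using X F_obj H_iff[OF _ _ c] counit_H[OF F_obj[OF X]] farr_T[OF c] by (simp add: \<mu>_def)
  show "Comp C (\<mu> X) (unit (fobj T X)) = Ident C (fobj T X)"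
    using X F_obj counit_\<eta>[of "F X"] by (simp add: \<mu>_def unit_def)
  \<comment> \<open>The unit law just shown is \<open>counit_\<eta>\<close> at \<open>F X\<close>.
    The remaining one compares two endomorphisms of the free object \<open>F X\<close>, so it can be
    checked on generators.\<close>
  have "Comp C (counit (F X)) (tarr (\<eta> X)) = Ident C (tobj X)"
  proof (rule free_eqI)
    show "H (F X) (F X) (Comp C (counit (F X)) (tarr (\<eta> X)))"
      using H_Comp tarr_H[OF u] counit_H F_obj X tobj_obj by metis
    have "Comp C (Comp C (counit (F X)) (tarr (\<eta> X))) (\<eta> X) = Comp C (Comp C (counit (F X)) (\<eta> (tobj X))) (\<eta> X)"
      using Comp_assoc[OF u tarr_Hom[OF u] c] Comp_assoc[OF u \<eta>_Hom c] X tarr_\<eta>[OF u] by simp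
    then show "Comp C (Comp C (counit (F X)) (tarr (\<eta> X))) (\<eta> X) = Comp C (Ident C (tobj X)) (\<eta> X)"
      using counit_\<eta>[OF F_obj[OF X]] by simp
  qed (use X F_obj H_Ident in auto)
  then show "Comp C (\<mu> X) (farr T (unit X)) = Ident C (fobj T X)"
    using X farr_T[OF u] by (simp add: \<mu>_def unit_def)
qed (rule cat is_functor_T)+

section \<open>Algebras and the structures they come from\<close>

lemma algebra_iff:
  "is_algebra C T unit \<mu> (A, \<theta>) \<longleftrightarrow> A \<in> Obj C \<and> \<theta> \<in> Hom C (tobj A) A \<and>
     Comp C \<theta> (\<eta> A) = Ident C A \<and> Comp C \<theta> (tarr \<theta>) = Comp C \<theta> (counit (F A))"
  by (auto simp: is_algebra_def unit_def \<mu>_def farr_T)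

lemma algebra_counit: "M \<in> Ob \<Longrightarrow> is_algebra C T unit \<mu> (U M, counit M)"
  using counit_Hom counit_\<eta> counit_H H_iff[OF F_obj[OF U_obj] _ counit_Hom] U_obj
  by (simp add: algebra_iff)

text \<open>Bijectivity of the comparison functor on objects. Existence is \<open>create\<close> for
  the pair \<open>tarr \<theta>\<close> and \<open>counit (F A)\<close>, which the second algebra
  law makes equal after \<theta>. For uniqueness, let two structures on \<open>A\<close> have the
  same counit \<theta>. The identity of \<open>A\<close> composed with \<theta> is \<theta>, a
  morphism into either structure, so by \<open>final\<close> the identity is a morphism in both
  directions, and \<open>antisym\<close> concludes.\<close>

lemma algebra_model:
  assumes "is_algebra C T unit \<mu> (A, \<theta>)"
  shows "\<exists>!M. M \<in> Ob \<and> U M = A \<and> counit M = \<theta>"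
proof -
  have A: "A \<in> Obj C" and \<theta>: "\<theta> \<in> Hom C (tobj A) A" "Comp C \<theta> (\<eta> A) = Ident C A"
    and m: "Comp C \<theta> (tarr \<theta>) = Comp C \<theta> (counit (F A))"
    using assms by (auto simp: algebra_iff)
  obtain M where M: "M \<in> Ob" "U M = A" "H (F A) M \<theta>"
    using create[OF A \<theta> tarr_H[OF \<theta>(1)] tarr_\<eta>[OF \<theta>(1)] counit_H counit_\<eta> m] F_obj[OF A] by blast
  then have "counit M = \<theta>"
    using ext_unique[OF A M(1,3)] \<theta> by (simp add: counit_def)
  moreover have "N = N'" if N: "N \<in> Ob" "U N = A" "counit N = \<theta>"
    and N': "N' \<in> Ob" "U N' = A" "counit N' = \<theta>" for N N'
  proof (rule antisym)
    have "Comp C (Ident C A) \<theta> = \<theta>" using Ident_Comp[OF \<theta>(1)] .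
    then show "H N N' (Ident C (U N))" "H N' N (Ident C (U N))"
      using final[of N N' \<theta> "Ident C A"] final[of N' N \<theta> "Ident C A"] N N' \<theta> A Ident_Hom[OF A]
        counit_H[of N] counit_H[of N'] by auto
  qed (use that in auto)
  ultimately show ?thesis using M by blast
qed

definition model :: "'o \<times> 'a \<Rightarrow> 'm" where
  "model = (\<lambda>(A, \<theta>). THE M. M \<in> Ob \<and> U M = A \<and> counit M = \<theta>)"

lemma model:
  assumes "is_algebra C T unit \<mu> A"
  shows "model A \<in> Ob" "U (model A) = fst A" "counit (model A) = snd A"
  using theI'[OF algebra_model[of "fst A" "snd A"]] assms by (auto simp: model_def split_beta)

lemma model_eq: "M \<in> Ob \<Longrightarrow> model (U M, counit M) = M"
  unfolding model_def using the1_equality[OF algebra_model[OF algebra_counit]] by simp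

section \<open>The comparison isomorphism\<close>

abbreviation EM where "EM \<equiv> EM_cat C T unit \<mu>"

lemma D_simps:
  "Obj D = Ob" "Dom D = src" "Cod D = tgt" "Ident D M = Arrow M M (Ident C (U M))"
  "Comp D g' f' = Arrow (src f') (tgt g') (Comp C (body g') (body f'))"
  "f' \<in> Arr D \<longleftrightarrow> src f' \<in> Ob \<and> tgt f' \<in> Ob \<and> H (src f') (tgt f') (body f')"
  by (cases f'; auto simp: D_def)+

lemma EM_simps:
  "Obj EM = Collect (is_algebra C T unit \<mu>)" "Dom EM = src" "Cod EM = tgt"
  "Ident EM A = Arrow A A (Ident C (fst A))"
  "Comp EM g f = Arrow (src f) (tgt g) (Comp C (body g) (body f))"
  "f \<in> Arr EM \<longleftrightarrow> is_algebra C T unit \<mu> (src f) \<and> is_algebra C T unit \<mu> (tgt f) \<and>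
     body f \<in> Hom C (fst (src f)) (fst (tgt f)) \<and>
     Comp C (body f) (snd (src f)) = Comp C (snd (tgt f)) (tarr (body f))"
  by (cases f; cases "src f"; cases "tgt f"; auto simp: EM_cat_def farr_T)+

lemma category_D: "category D"
  unfolding category_def
proof (intro conjI ballI impI)
  fix f assume "f \<in> Arr D"
  then have f: "src f \<in> Ob" "tgt f \<in> Ob" "H (src f) (tgt f) (body f)" by (auto simp: D_simps)
  then show "Dom D f \<in> Obj D" "Cod D f \<in> Obj D" by (auto simp: D_simps)
  show "Comp D f (Ident D (Dom D f)) = f" "Comp D (Ident D (Cod D f)) f = f"
    using Comp_Ident[OF H_Hom[OF f]] Ident_Comp[OF H_Hom[OF f]] by (auto simp: D_simps)
  fix g assume "g \<in> Arr D" and fg: "Cod D f = Dom D g"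
  then have g: "tgt f = src g" "src g \<in> Ob" "tgt g \<in> Ob" "H (src g) (tgt g) (body g)"
    by (auto simp: D_simps)
  show "Comp D g f \<in> Hom D (Dom D f) (Cod D g)"
    using f g H_Comp[of "src f" "tgt f" "tgt g"] by (auto simp: D_simps Hom_def)
  fix h assume "h \<in> Arr D" "Cod D g = Dom D h"
  then have h: "tgt g = src h" "src h \<in> Ob" "tgt h \<in> Ob" "H (src h) (tgt h) (body h)"
    by (auto simp: D_simps)
  show "Comp D h (Comp D g f) = Comp D (Comp D h g) f"
    using f g h Comp_assoc[OF H_Hom[OF f] H_Hom[of "tgt f" "tgt g"] H_Hom[of "tgt g" "tgt h"]]
    by (simp add: D_simps)
next
  fix M assume "M \<in> Obj D"
  then show "Ident D M \<in> Hom D M M" using H_Ident by (simp add: Hom_def D_simps)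
qed

text \<open>The comparison functor. It changes only the tags of an arrow and keeps its body, as does
  the inverse \<open>K'\<close>; so the isomorphism rests on the bijection on objects and on
  \<open>H_iff\<close>.\<close>

definition K where
  "K = \<lparr>fobj = (\<lambda>M\<in>Ob. (U M, counit M)),
        farr = (\<lambda>f\<in>Arr D. Arrow (U (src f), counit (src f)) (U (tgt f), counit (tgt f)) (body f))\<rparr>"

definition K' where
  "K' = \<lparr>fobj = restrict model (Collect (is_algebra C T unit \<mu>)),
        farr = (\<lambda>f\<in>Arr EM. Arrow (model (src f)) (model (tgt f)) (body f))\<rparr>"

lemma K_arr: "f \<in> Arr D \<Longrightarrow> Arrow (U (src f), counit (src f)) (U (tgt f), counit (tgt f)) (body f) \<in> Arr EM"
  using H_iff[THEN iffD1, OF _ _ H_Hom, of "src f" "tgt f" "body f"] H_Hom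
  by (auto simp: D_simps EM_simps algebra_counit)

lemma K'_arr: "f \<in> Arr EM \<Longrightarrow> Arrow (model (src f)) (model (tgt f)) (body f) \<in> Arr D"
  by (auto simp: D_simps EM_simps model H_iff)

lemma category_EM: "category EM"
proof -
  have id: "Ident C (fst A) \<in> Hom C (fst A) (fst A)"
    "Comp C (Ident C (fst A)) (snd A) = Comp C (snd A) (tarr (Ident C (fst A)))"
    if "is_algebra C T unit \<mu> A" for A
    using that Ident_Hom Ident_Comp Comp_Ident tarr_Ident by (cases A; auto simp: algebra_iff)+
  \<comment> \<open>Closure of algebra maps under composition is not computed from their equations:
    each map is read as a morphism between the models of its algebras, composed there by
    \<open>H_Comp\<close>, and read back through \<open>H_iff\<close>.\<close>
  have comp: "Comp C (Comp C g f) (snd (src f')) = Comp C (snd (tgt g')) (tarr (Comp C g f))"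
    if "f' \<in> Arr EM" "g' \<in> Arr EM" "tgt f' = src g'" "f = body f'" "g = body g'" for f g f' g'
    using H_Comp[of "model (src f')" "model (tgt f')" "model (tgt g')" "body f'" "body g'"]
      K'_arr[OF that(1)] K'_arr[OF that(2)] that H_iff[of "model (src f')" "model (tgt g')" "Comp C g f"]
      H_Hom[of "model (src f')" "model (tgt g')" "Comp C g f"]
      model[of "src f'"] model[of "tgt f'"] model[of "tgt g'"]
    by (auto simp: D_simps EM_simps)
  show ?thesis
    unfolding category_def
  proof (intro conjI ballI impI)
    fix f assume f: "f \<in> Arr EM"
    then show "Dom EM f \<in> Obj EM" "Cod EM f \<in> Obj EM" by (auto simp: EM_simps)
    show "Comp EM f (Ident EM (Dom EM f)) = f" "Comp EM (Ident EM (Cod EM f)) f = f"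
      using f Comp_Ident Ident_Comp by (cases f; auto simp: EM_simps)+
    fix g assume g: "g \<in> Arr EM" and fg: "Cod EM f = Dom EM g"
    show "Comp EM g f \<in> Hom EM (Dom EM f) (Cod EM g)"
      using comp[OF f g] f g fg Comp_Hom by (auto simp: Hom_def[of EM] EM_simps)
    fix h assume "h \<in> Arr EM" "Cod EM g = Dom EM h"
    then show "Comp EM h (Comp EM g f) = Comp EM (Comp EM h g) f"
      using f g fg Comp_assoc by (auto simp: EM_simps)
  next
    fix A assume "A \<in> Obj EM"
    then show "Ident EM A \<in> Hom EM A A" using id by (auto simp: Hom_def[of EM] EM_simps)
  qed
qed

theorem isomorphic_EM: "isomorphic_cats D EM"
  unfolding isomorphic_cats_def
proof (intro conjI exI)
  show "category D" "category EM" by (rule category_D category_EM)+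
  have Comp_D: "Comp D g f \<in> Arr D" if "f \<in> Arr D" "g \<in> Arr D" "Cod D f = Dom D g" for f g
    using that category_D unfolding category_def Hom_def by blast
  have Comp_EM: "Comp EM g f \<in> Arr EM" if "f \<in> Arr EM" "g \<in> Arr EM" "Cod EM f = Dom EM g" for f g
    using that category_EM unfolding category_def Hom_def by blast
  have Id_D: "Ident D M \<in> Arr D" if "M \<in> Obj D" for M
    using that category_D unfolding category_def Hom_def by blast
  have Id_EM: "Ident EM M \<in> Arr EM" if "M \<in> Obj EM" for M
    using that category_EM unfolding category_def Hom_def by blast
  have alg: "is_algebra C T unit \<mu> (src f)" "is_algebra C T unit \<mu> (tgt f)" if "f \<in> Arr EM" for f
    using that by (simp_all add: EM_simps)
  have ob: "src f \<in> Ob" "tgt f \<in> Ob" if "f \<in> Arr D" for f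
    using that by (simp_all add: D_simps)
  have K: "fobj K M = (U M, counit M)" if "M \<in> Ob" for M using that by (simp add: K_def)
  have Ka: "farr K f = Arrow (U (src f), counit (src f)) (U (tgt f), counit (tgt f)) (body f)"
    if "f \<in> Arr D" for f using that by (simp add: K_def)
  have K': "fobj K' A = model A" if "is_algebra C T unit \<mu> A" for A using that by (simp add: K'_def)
  have Ka': "farr K' f = Arrow (model (src f)) (model (tgt f)) (body f)" if "f \<in> Arr EM" for f
    using that by (simp add: K'_def)
  show "is_functor D EM K"
    unfolding is_functor_def
  proof (intro conjI ballI impI)
    show "fobj K \<in> Obj D \<rightarrow>\<^sub>E Obj EM"
      using algebra_counit by (auto simp: K_def D_simps(1) EM_simps(1))
    show "farr K \<in> Arr D \<rightarrow>\<^sub>E Arr EM"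
      using K_arr by (auto simp: K_def)
    show "farr K f \<in> Hom EM (fobj K (Dom D f)) (fobj K (Cod D f))" if "f \<in> Arr D" for f
      using K_arr[OF that] ob[OF that] by (simp add: Ka[OF that] K Hom_def D_simps(2,3) EM_simps(2,3))
    show "farr K (Ident D M) = Ident EM (fobj K M)" if "M \<in> Obj D" for M
      using Ka[OF Id_D[OF that]] that by (simp add: K D_simps(1,4) EM_simps(4))
    show "farr K (Comp D g f) = Comp EM (farr K g) (farr K f)"
      if "f \<in> Arr D" "g \<in> Arr D" "Cod D f = Dom D g" for f g
      using Ka[OF Comp_D[OF that]] that(1,2) by (simp add: Ka D_simps(5) EM_simps(5))
  qed
  show "is_functor EM D K'"
    unfolding is_functor_def
  proof (intro conjI ballI impI)
    show "fobj K' \<in> Obj EM \<rightarrow>\<^sub>E Obj D"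
      using model by (auto simp: K'_def D_simps(1) EM_simps(1))
    show "farr K' \<in> Arr EM \<rightarrow>\<^sub>E Arr D"
      using K'_arr by (auto simp: K'_def)
    show "farr K' f \<in> Hom D (fobj K' (Dom EM f)) (fobj K' (Cod EM f))" if "f \<in> Arr EM" for f
      using K'_arr[OF that] alg[OF that] by (simp add: Ka'[OF that] K' Hom_def D_simps(2,3) EM_simps(2,3))
    show "farr K' (Ident EM A) = Ident D (fobj K' A)" if "A \<in> Obj EM" for A
      using Ka'[OF Id_EM[OF that]] that model by (simp add: K' D_simps(4) EM_simps(1,4))
    show "farr K' (Comp EM g f) = Comp D (farr K' g) (farr K' f)"
      if "f \<in> Arr EM" "g \<in> Arr EM" "Cod EM f = Dom EM g" for f g
      using Ka'[OF Comp_EM[OF that]] that(1,2) by (simp add: Ka' D_simps(5) EM_simps(5))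
  qed
  show "comp_functor D K' K = id_functor D"
  proof -
    have "fobj K' (fobj K M) = M" if "M \<in> Obj D" for M
      using that algebra_counit model_eq by (simp add: D_simps(1) K K')
    moreover have "farr K' (farr K f) = f" if "f \<in> Arr D" for f
      using K_arr[OF that] ob[OF that] by (simp add: Ka[OF that] Ka' model_eq)
    ultimately show ?thesis
      by (auto simp: comp_functor_def id_functor_def compose_def intro!: restrict_ext)
  qed
  show "comp_functor EM K K' = id_functor EM"
  proof -
    have "fobj K (fobj K' A) = A" if "A \<in> Obj EM" for A
      using that model by (simp add: EM_simps(1) K K')
    moreover have "farr K (farr K' f) = f" if "f \<in> Arr EM" for f
      using K'_arr[OF that] alg[OF that] model by (simp add: Ka'[OF that] Ka)
    ultimately show ?thesis
      by (auto simp: comp_functor_def id_functor_def compose_def intro!: restrict_ext)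
  qed
qed

end

section \<open>Graphical species\<close>

lemma B_arrE:
  assumes "m \<in> Arr B_cat"
  obtains (Sec) b where "m = SecMor b"
  | (Ch) X x b where "m = Ch X x b" "finite X" "x \<in> X"
  | (Bij) X Y f where "m = Bij X Y f" "finite X" "finite Y" "f \<in> extensional X" "bij_betw f X Y"
  using assms by (auto simp: B_cat_def)

lemma B_obj_iff [simp]: "Sec \<in> Obj B_cat" "Fin X \<in> Obj B_cat \<longleftrightarrow> finite X"
  by (auto simp: B_cat_def)

lemma B_arr_iff [simp]:
  "SecMor b \<in> Arr B_cat"
  "Ch X x b \<in> Arr B_cat \<longleftrightarrow> finite X \<and> x \<in> X"
  "Bij X Y f \<in> Arr B_cat \<longleftrightarrow> finite X \<and> finite Y \<and> f \<in> extensional X \<and> bij_betw f X Y"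
  by (auto simp: B_cat_def)

lemma B_arr_obj [simp]:
  assumes "m \<in> Arr B_cat"
  shows "bdom m \<in> Obj B_cat" "bcod m \<in> Obj B_cat"
  using assms by (auto elim!: B_arrE)

lemma B_ident [simp]:
  assumes "b \<in> Obj B_cat"
  shows "bident b \<in> Arr B_cat" "bdom (bident b) = b" "bcod (bident b) = b"
  using assms by (cases b; auto simp: bij_betw_def inj_on_def)+

lemma bij_betw_compose:
  "bij_betw f X Y \<Longrightarrow> bij_betw g Y Z \<Longrightarrow> bij_betw (compose X g f) X Z"
  using bij_betw_trans[of f X Y g Z] bij_betw_cong[of X "compose X g f" "g \<circ> f" Z]
  by (simp add: compose_eq)

lemma B_comp [simp]:
  assumes "m \<in> Arr B_cat" "n \<in> Arr B_cat" "bcod n = bdom m"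
  shows "bcomp m n \<in> Arr B_cat" "bdom (bcomp m n) = bdom n" "bcod (bcomp m n) = bcod m"
  using assms by (auto elim!: B_arrE simp: compose_extensional bij_betw_apply intro: bij_betw_compose)

section \<open>Species as sets with a contravariant action\<close>

lemma set_cat_simps [simp]:
  "Obj set_cat = UNIV" "Dom set_cat = src" "Cod set_cat = tgt"
  "Ident set_cat A = Arrow A A (\<lambda>a\<in>A. a)"
  "Comp set_cat g f = Arrow (src f) (tgt g) (compose (src f) (body g) (body f))"
  "Arrow A B f' \<in> Arr set_cat \<longleftrightarrow> f' \<in> A \<rightarrow>\<^sub>E B"
  by (auto simp: set_cat_def)

lemma set_cat_Hom_iff: "f \<in> Hom set_cat A B \<longleftrightarrow> f = Arrow A B (body f) \<and> body f \<in> A \<rightarrow>\<^sub>E B"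
  by (cases f) (auto simp: Hom_def)

lemma op_cat_simps [simp]:
  "Obj (op_cat C) = Obj C" "Arr (op_cat C) = Arr C" "Dom (op_cat C) = Cod C" "Cod (op_cat C) = Dom C"
  "Ident (op_cat C) = Ident C" "Comp (op_cat C) g f = Comp C f g"
  by (auto simp: op_cat_def)

lemma B_cat_simps [simp]:
  "Dom B_cat = bdom" "Cod B_cat = bcod" "Ident B_cat = bident" "Comp B_cat = bcomp"
  by (auto simp: B_cat_def)

text \<open>Dissolves the presheaf into carriers and an action, so that later arguments can work
  with elements. The action is contravariant: \<open>m\<close> goes from the value at
  \<open>bcod m\<close> to the value at \<open>bdom m\<close>, and \<open>bcomp m n\<close> acts by
  \<open>m\<close> before \<open>n\<close>.\<close>

lemma species_iff:
  fixes S :: "'u species"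
  shows "S \<in> Obj GS \<longleftrightarrow> fobj S \<in> extensional (Obj B_cat) \<and> farr S \<in> extensional (Arr B_cat) \<and>
     (\<forall>m\<in>Arr B_cat. farr S m = Arrow (fobj S (bcod m)) (fobj S (bdom m)) (act S m)
         \<and> act S m \<in> fobj S (bcod m) \<rightarrow>\<^sub>E fobj S (bdom m)) \<and>
     (\<forall>b\<in>Obj B_cat. \<forall>x\<in>fobj S b. act S (bident b) x = x) \<and>
     (\<forall>m\<in>Arr B_cat. \<forall>n\<in>Arr B_cat. bcod n = bdom m \<longrightarrow>
        (\<forall>x\<in>fobj S (bcod m). act S (bcomp m n) x = act S n (act S m x)))"
  (is "?L \<longleftrightarrow> ?R")
proof
  assume ?L
  then have *: "is_functor (op_cat B_cat) set_cat S"
    by (simp add: GS_def functor_cat_def)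
  have 1: "farr S m = Arrow (fobj S (bcod m)) (fobj S (bdom m)) (act S m)
         \<and> act S m \<in> fobj S (bcod m) \<rightarrow>\<^sub>E fobj S (bdom m)" if "m \<in> Arr B_cat" for m
    using * that by (auto simp: is_functor_def set_cat_Hom_iff act_def)
  have 2: "act S (bident b) x = x" if "b \<in> Obj B_cat" "x \<in> fobj S b" for b x
    using * that by (auto simp: is_functor_def act_def)
  have 3: "act S (bcomp m n) x = act S n (act S m x)"
    if "m \<in> Arr B_cat" "n \<in> Arr B_cat" "bcod n = bdom m" "x \<in> fobj S (bcod m)" for m n x
  proof -
    have "farr S (bcomp m n) = Comp set_cat (farr S n) (farr S m)"
      using * that by (auto simp: is_functor_def)
    moreover have "src (farr S m) = fobj S (bcod m)" using 1[OF that(1)] by (metis arrow.sel(1))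
    ultimately show ?thesis using that by (simp add: act_def compose_def)
  qed
  from * 1 2 3 show ?R
    by (auto simp: is_functor_def PiE_def)
next
  assume R: ?R
  have "is_functor (op_cat B_cat) set_cat S"
    unfolding is_functor_def
  proof (intro conjI ballI impI)
    show "fobj S \<in> Obj (op_cat B_cat) \<rightarrow>\<^sub>E Obj set_cat"
      using R by (auto simp: PiE_def)
    show "farr S \<in> Arr (op_cat B_cat) \<rightarrow>\<^sub>E Arr set_cat"
    proof (rule PiE_I)
      fix m :: "'u bmor" assume "m \<in> Arr (op_cat B_cat)"
      with R have "farr S m = Arrow (fobj S (bcod m)) (fobj S (bdom m)) (act S m)"
        "act S m \<in> fobj S (bcod m) \<rightarrow>\<^sub>E fobj S (bdom m)" by auto
      then show "farr S m \<in> Arr set_cat" by simp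
    qed (use R in \<open>auto simp: extensional_def\<close>)
    show "farr S f \<in> Hom set_cat (fobj S (Dom (op_cat B_cat) f)) (fobj S (Cod (op_cat B_cat) f))"
      if "f \<in> Arr (op_cat B_cat)" for f
      using R that by (simp add: set_cat_Hom_iff act_def)
    show "farr S (Ident (op_cat B_cat) X) = Ident set_cat (fobj S X)"
      if "X \<in> Obj (op_cat B_cat)" for X
    proof -
      have "bident X \<in> Arr B_cat" using that by simp
      with R have "farr S (bident X) = Arrow (fobj S X) (fobj S X) (act S (bident X))"
        "act S (bident X) \<in> fobj S X \<rightarrow>\<^sub>E fobj S X" using that by fastforce+
      moreover from this R that have "act S (bident X) = (\<lambda>a\<in>fobj S X. a)"
        by (intro extensionalityI[of _ "fobj S X"]) (auto simp: PiE_def)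
      ultimately show ?thesis by simp
    qed
    show "farr S (Comp (op_cat B_cat) g f) = Comp set_cat (farr S g) (farr S f)"
      if "f \<in> Arr (op_cat B_cat)" "g \<in> Arr (op_cat B_cat)" "Cod (op_cat B_cat) f = Dom (op_cat B_cat) g" for f g
    proof -
      have c: "f \<in> Arr B_cat" "g \<in> Arr B_cat" "bcod g = bdom f" using that by auto
      then have "bcomp f g \<in> Arr B_cat" by simp
      with R have "farr S (bcomp f g) = Arrow (fobj S (bcod f)) (fobj S (bdom g)) (act S (bcomp f g))"
        "act S (bcomp f g) \<in> fobj S (bcod f) \<rightarrow>\<^sub>E fobj S (bdom g)" using c by fastforce+
      moreover from this R c have "act S (bcomp f g) = compose (fobj S (bcod f)) (act S g) (act S f)"
        by (intro extensionalityI[of _ "fobj S (bcod f)"]) (auto simp: PiE_def compose_def)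
      moreover have "farr S f = Arrow (fobj S (bcod f)) (fobj S (bdom f)) (act S f)"
        "farr S g = Arrow (fobj S (bcod g)) (fobj S (bdom g)) (act S g)" using R c by blast+
      ultimately show ?thesis by simp
    qed
  qed
  then show ?L by (simp add: GS_def functor_cat_def)
qed

lemma act_mem [simp]:
  "S \<in> Obj GS \<Longrightarrow> m \<in> Arr B_cat \<Longrightarrow> x \<in> fobj S (bcod m) \<Longrightarrow> act S m x \<in> fobj S (bdom m)"
  unfolding species_iff by blast

lemma act_ident: "S \<in> Obj GS \<Longrightarrow> b \<in> Obj B_cat \<Longrightarrow> x \<in> fobj S b \<Longrightarrow> act S (bident b) x = x"
  unfolding species_iff by blast

lemma act_comp:
  "S \<in> Obj GS \<Longrightarrow> m \<in> Arr B_cat \<Longrightarrow> n \<in> Arr B_cat \<Longrightarrow> bcod n = bdom m \<Longrightarrow>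
    x \<in> fobj S (bcod m) \<Longrightarrow> act S n (act S m x) = act S (bcomp m n) x"
  unfolding species_iff by metis

text \<open>Takes care of tags and extensionality once and for all; \<open>mk_species_obj\<close>
  then asks only for closure, identity and composition of the action.\<close>

definition mk_species :: "('u bobj \<Rightarrow> 'u set) \<Rightarrow> ('u bmor \<Rightarrow> 'u \<Rightarrow> 'u) \<Rightarrow> 'u species" where
  "mk_species A a = \<lparr>fobj = restrict A (Obj B_cat),
     farr = (\<lambda>m\<in>Arr B_cat. Arrow (A (bcod m)) (A (bdom m)) (restrict (a m) (A (bcod m))))\<rparr>"

lemma mk_species_simps [simp]:
  "b \<in> Obj B_cat \<Longrightarrow> fobj (mk_species A a) b = A b"
  "m \<in> Arr B_cat \<Longrightarrow> x \<in> A (bcod m) \<Longrightarrow> act (mk_species A a) m x = a m x"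
  by (auto simp: mk_species_def act_def)

lemma mk_species_obj:
  fixes A :: "'u bobj \<Rightarrow> 'u set"
  assumes "\<And>m x. m \<in> Arr B_cat \<Longrightarrow> x \<in> A (bcod m) \<Longrightarrow> a m x \<in> A (bdom m)"
    and "\<And>b x. b \<in> Obj B_cat \<Longrightarrow> x \<in> A b \<Longrightarrow> a (bident b) x = x"
    and "\<And>m n x. m \<in> Arr B_cat \<Longrightarrow> n \<in> Arr B_cat \<Longrightarrow> bcod n = bdom m \<Longrightarrow> x \<in> A (bcod m) \<Longrightarrow>
           a (bcomp m n) x = a n (a m x)"
  shows "mk_species A a \<in> Obj GS"
  unfolding species_iff
proof (intro conjI ballI impI)
  fix m :: "'u bmor" assume "m \<in> Arr B_cat"
  then show "farr (mk_species A a) m = Arrow (fobj (mk_species A a) (bcod m))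
      (fobj (mk_species A a) (bdom m)) (act (mk_species A a) m)"
    "act (mk_species A a) m \<in> fobj (mk_species A a) (bcod m) \<rightarrow>\<^sub>E fobj (mk_species A a) (bdom m)"
    using assms(1) by (auto simp: mk_species_def act_def)
qed (use assms in \<open>auto simp: mk_species_def act_def\<close>)

section \<open>Maps of species and their category\<close>

lemma GS_Dom_Cod [simp]: "Dom GS = src" "Cod GS = tgt"
  by (auto simp: GS_def functor_cat_def)

lemma GS_Ident_Comp:
  "Ident GS S = Arrow S S (\<lambda>b\<in>Obj B_cat. Ident set_cat (fobj S b))"
  "Comp GS g f = Arrow (src f) (tgt g) (\<lambda>b\<in>Obj B_cat. Comp set_cat (body g b) (body f b))"
  by (auto simp: GS_def functor_cat_def)

text \<open>The counterpart of \<open>species_iff\<close> for natural transformations: the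
  naturality squares become one equation per arrow and element.\<close>

lemma GS_Hom_iff:
  "f \<in> Hom GS S S' \<longleftrightarrow> S \<in> Obj GS \<and> S' \<in> Obj GS \<and> src f = S \<and> tgt f = S' \<and>
     body f \<in> extensional (Obj B_cat) \<and>
     (\<forall>b\<in>Obj B_cat. body f b = Arrow (fobj S b) (fobj S' b) (app f b) \<and>
        app f b \<in> fobj S b \<rightarrow>\<^sub>E fobj S' b) \<and>
     (\<forall>m\<in>Arr B_cat. \<forall>x\<in>fobj S (bcod m).
        app f (bdom m) (act S m x) = act S' m (app f (bcod m) x))"
  (is "?L \<longleftrightarrow> ?R")
proof -
  have ob: "is_functor (op_cat B_cat) set_cat F \<longleftrightarrow> F \<in> Obj GS" for F :: "'a species"
    by (simp add: GS_def functor_cat_def)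
  obtain F F' h where f: "f = Arrow F F' h" by (cases f)
  have L: "?L \<longleftrightarrow> F = S \<and> F' = S' \<and> nat_trans (op_cat B_cat) set_cat F F' h"
    unfolding f by (auto simp: Hom_def GS_def functor_cat_def)
  \<comment> \<open>Both sides of the naturality square carry the same source and target tags, so
    their equality is that of two restricted functions, that is, equality at every element.\<close>
  have sq: "Comp set_cat (farr S' m) (h (bcod m)) = Comp set_cat (h (bdom m)) (farr S m) \<longleftrightarrow>
       (\<forall>x\<in>fobj S (bcod m). app f (bdom m) (act S m x) = act S' m (app f (bcod m) x))"
    if "S \<in> Obj GS" "S' \<in> Obj GS" "m \<in> Arr B_cat"
      "\<forall>b\<in>Obj B_cat. h b = Arrow (fobj S b) (fobj S' b) (app f b)" for m
  proof -
    have "farr S m = Arrow (fobj S (bcod m)) (fobj S (bdom m)) (act S m)"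
      "farr S' m = Arrow (fobj S' (bcod m)) (fobj S' (bdom m)) (act S' m)"
      using that unfolding species_iff by auto
    then show ?thesis using that
      by (auto simp: compose_def fun_eq_iff restrict_def)
  qed
  have eq: "Arrow a b c = Arrow a b c' \<longleftrightarrow> c = c'" for a b :: "'a set" and c c' by auto
  show ?thesis
  proof
    assume ?L
    then have *: "F = S" "F' = S'" "nat_trans (op_cat B_cat) set_cat S S' h" using L by auto
    have 1: "h b = Arrow (fobj S b) (fobj S' b) (app f b)" "app f b \<in> fobj S b \<rightarrow>\<^sub>E fobj S' b"
      if "b \<in> Obj B_cat" for b
      using *(3) that by (auto simp: nat_trans_def set_cat_Hom_iff app_def f)
    have 2: "S \<in> Obj GS" "S' \<in> Obj GS" using *(3) by (auto simp: nat_trans_def ob)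
    have "Comp set_cat (farr S' m) (h (bcod m)) = Comp set_cat (h (bdom m)) (farr S m)"
      if "m \<in> Arr B_cat" for m
      using *(3) that unfolding nat_trans_def by (metis B_cat_simps(1,2) op_cat_simps(2-4))
    then have 3: "\<forall>m\<in>Arr B_cat. \<forall>x\<in>fobj S (bcod m). app f (bdom m) (act S m x) = act S' m (app f (bcod m) x)"
      using sq[OF 2] 1(1) by blast
    show ?R using 1 2 3 * by (auto simp: f nat_trans_def)
  next
    assume ?R
    then have 1: "S \<in> Obj GS" "S' \<in> Obj GS" "F = S" "F' = S'" "h \<in> extensional (Obj B_cat)"
     and 2: "\<forall>b\<in>Obj B_cat. h b = Arrow (fobj S b) (fobj S' b) (app f b)"
     and 3: "\<forall>b\<in>Obj B_cat. app f b \<in> fobj S b \<rightarrow>\<^sub>E fobj S' b"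
     and 4: "\<forall>m\<in>Arr B_cat. \<forall>x\<in>fobj S (bcod m). app f (bdom m) (act S m x) = act S' m (app f (bcod m) x)"
      by (auto simp: f)
    have "h b \<in> Hom set_cat (fobj S b) (fobj S' b)" if "b \<in> Obj B_cat" for b
      using 2 3 that by (simp add: set_cat_Hom_iff app_def f)
    moreover have "Comp set_cat (farr S' m) (h (bcod m)) = Comp set_cat (h (bdom m)) (farr S m)"
      if "m \<in> Arr B_cat" for m using sq[OF 1(1,2) that 2] 4 that by blast
    ultimately have "nat_trans (op_cat B_cat) set_cat S S' h"
      unfolding nat_trans_def using 1 ob by (simp del: set_cat_simps(5))
    then show ?L using L 1 by simp
  qed
qed

lemma GS_Hom_obj: "f \<in> Hom GS S S' \<Longrightarrow> S \<in> Obj GS \<and> S' \<in> Obj GS"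
  unfolding GS_Hom_iff by blast

lemma app_mem: "f \<in> Hom GS S S' \<Longrightarrow> b \<in> Obj B_cat \<Longrightarrow> x \<in> fobj S b \<Longrightarrow> app f b x \<in> fobj S' b"
  unfolding GS_Hom_iff by blast

lemma app_act:
  "f \<in> Hom GS S S' \<Longrightarrow> m \<in> Arr B_cat \<Longrightarrow> x \<in> fobj S (bcod m) \<Longrightarrow>
    app f (bdom m) (act S m x) = act S' m (app f (bcod m) x)"
  unfolding GS_Hom_iff by blast

lemma GS_Hom_eqI:
  assumes "f \<in> Hom GS S S'" "g \<in> Hom GS S S'"
    and "\<And>b x. b \<in> Obj B_cat \<Longrightarrow> x \<in> fobj S b \<Longrightarrow> app f b x = app g b x"
  shows "f = g"
proof -
  have "app f b = app g b" if "b \<in> Obj B_cat" for b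
    using assms that unfolding GS_Hom_iff
    by (intro extensionalityI[of _ "fobj S b"]) (auto simp: PiE_def)
  then have "body f = body g"
    using assms(1,2) unfolding GS_Hom_iff by (intro extensionalityI[of _ "Obj B_cat"]) auto
  with assms(1,2) show ?thesis unfolding GS_Hom_iff by (auto intro: arrow.expand)
qed

definition mk_mor :: "'u species \<Rightarrow> 'u species \<Rightarrow> ('u bobj \<Rightarrow> 'u \<Rightarrow> 'u) \<Rightarrow> 'u species_mor" where
  "mk_mor S S' h =
     Arrow S S' (\<lambda>b\<in>Obj B_cat. Arrow (fobj S b) (fobj S' b) (restrict (h b) (fobj S b)))"

lemma app_mk_mor [simp]: "b \<in> Obj B_cat \<Longrightarrow> x \<in> fobj S b \<Longrightarrow> app (mk_mor S S' h) b x = h b x"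
  by (simp add: app_def mk_mor_def)

lemma mk_mor_Hom:
  assumes "S \<in> Obj GS" "S' \<in> Obj GS"
    and "\<And>b x. b \<in> Obj B_cat \<Longrightarrow> x \<in> fobj S b \<Longrightarrow> h b x \<in> fobj S' b"
    and "\<And>m x. m \<in> Arr B_cat \<Longrightarrow> x \<in> fobj S (bcod m) \<Longrightarrow>
           h (bdom m) (act S m x) = act S' m (h (bcod m) x)"
  shows "mk_mor S S' h \<in> Hom GS S S'"
  unfolding GS_Hom_iff
proof (intro conjI ballI)
  fix m x assume "m \<in> Arr B_cat" "x \<in> fobj S (bcod m)"
  with assms show "app (mk_mor S S' h) (bdom m) (act S m x) = act S' m (app (mk_mor S S' h) (bcod m) x)"
    by simp
qed (use assms in \<open>auto simp: mk_mor_def app_def\<close>)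

lemma Ident_GS: "S \<in> Obj GS \<Longrightarrow> Ident GS S \<in> Hom GS S S"
  unfolding GS_Hom_iff by (auto simp: GS_Ident_Comp app_def)

lemma app_Ident [simp]: "b \<in> Obj B_cat \<Longrightarrow> x \<in> fobj S b \<Longrightarrow> app (Ident GS S) b x = x"
  by (simp add: GS_Ident_Comp app_def)

lemma app_Comp:
  "f \<in> Hom GS S S' \<Longrightarrow> b \<in> Obj B_cat \<Longrightarrow> x \<in> fobj S b \<Longrightarrow>
    app (Comp GS g f) b x = app g b (app f b x)"
proof -
  assume f: "f \<in> Hom GS S S'" and b: "b \<in> Obj B_cat" "x \<in> fobj S b"
  then have "src (body f b) = fobj S b" unfolding GS_Hom_iff by (metis arrow.sel(1))
  with b show ?thesis by (simp add: GS_Ident_Comp app_def compose_def)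
qed

lemma Comp_GS:
  assumes f: "f \<in> Hom GS S S'" and g: "g \<in> Hom GS S' S''"
  shows "Comp GS g f \<in> Hom GS S S''"
  unfolding GS_Hom_iff
proof (intro conjI ballI)
  fix b :: "'a bobj" assume b: "b \<in> Obj B_cat"
  have *: "body (Comp GS g f) b = Arrow (fobj S b) (fobj S'' b) (compose (fobj S b) (app g b) (app f b))"
  proof -
    have "body f b = Arrow (fobj S b) (fobj S' b) (app f b)"
      "body g b = Arrow (fobj S' b) (fobj S'' b) (app g b)"
      using f g b unfolding GS_Hom_iff by blast+
    then show ?thesis using b by (simp add: GS_Ident_Comp)
  qed
  then show "body (Comp GS g f) b = Arrow (fobj S b) (fobj S'' b) (app (Comp GS g f) b)"
    by (simp add: app_def)
  show "app (Comp GS g f) b \<in> fobj S b \<rightarrow>\<^sub>E fobj S'' b"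
    using app_mem[OF f b] app_mem[OF g b] unfolding app_def[of "Comp GS g f"] *
    by (auto simp: compose_def)
next
  fix m x assume m: "m \<in> Arr B_cat" "x \<in> fobj S (bcod m)"
  then show "app (Comp GS g f) (bdom m) (act S m x) = act S'' m (app (Comp GS g f) (bcod m) x)"
    using GS_Hom_obj[OF f] by (simp add: app_Comp[OF f] app_act[OF f] app_act[OF g] app_mem[OF f])
qed (use f g in \<open>auto simp: GS_Hom_iff GS_Ident_Comp\<close>)

lemma category_GS: "category (GS :: ('u species, 'u species_mor) cat)"
proof -
  have Arr: "f \<in> Arr GS \<longleftrightarrow> f \<in> Hom GS (src f) (tgt f)" for f :: "'u species_mor"
    by (simp add: Hom_def)
  show ?thesis
    unfolding category_def Arr GS_Dom_Cod
  proof (intro conjI ballI impI)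
    fix f :: "'u species_mor" assume "f \<in> Arr GS"
    then have f: "f \<in> Hom GS (src f) (tgt f)" using Arr by blast
    note obj = GS_Hom_obj[OF f]
    then show "src f \<in> Obj GS" "tgt f \<in> Obj GS" by auto
    show "Comp GS f (Ident GS (src f)) = f"
      using obj by (intro GS_Hom_eqI[OF Comp_GS[OF Ident_GS f] f]) (auto simp: app_Comp[OF Ident_GS])
    show "Comp GS (Ident GS (tgt f)) f = f"
      using obj by (intro GS_Hom_eqI[OF Comp_GS[OF f Ident_GS] f]) (auto simp: app_Comp[OF f] app_mem[OF f])
    fix g :: "'u species_mor" assume "g \<in> Arr GS" and fg: "tgt f = src g"
    then have g: "g \<in> Hom GS (tgt f) (tgt g)" using Arr by simp
    show "Comp GS g f \<in> Hom GS (src f) (tgt g)" using Comp_GS[OF f g] .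
    fix h :: "'u species_mor" assume "h \<in> Arr GS" and "tgt g = src h"
    then have h: "h \<in> Hom GS (tgt g) (tgt h)" using Arr by simp
    show "Comp GS h (Comp GS g f) = Comp GS (Comp GS h g) f"
      by (rule GS_Hom_eqI[OF Comp_GS[OF Comp_GS[OF f g] h] Comp_GS[OF f Comp_GS[OF g h]]])
        (simp add: app_Comp[OF f] app_Comp[OF g] app_Comp[OF Comp_GS[OF f g]] app_mem[OF f])
  qed (rule Ident_GS)
qed

section \<open>Structures covered by modular operads\<close>

text \<open>By contravariance, precomposing \<open>ch\<close> with \<tau> means applying the
  involution to the colour. The domain condition of a product compares a colour with a dual colour
  and so is not visibly symmetric; together with \<open>act_involution\<close> this lemma makes it
  so.\<close>

lemma dual_colour_eq:
  assumes "S \<in> Obj GS" "finite X" "x \<in> X" "\<phi> \<in> elems S X"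
  shows "dual_colour S X x \<phi> = act S (SecMor True) (colour S X x \<phi>)"
  using act_comp[of S "Ch X x False" "SecMor True" \<phi>] assms by simp

lemma act_involution:
  assumes "S \<in> Obj GS" "c \<in> colours S"
  shows "act S (SecMor True) (act S (SecMor True) c) = c"
  using act_comp[of S "SecMor True" "SecMor True" c] act_ident[of S Sec c] assms by simp

lemma colour_mem: "S \<in> Obj GS \<Longrightarrow> finite X \<Longrightarrow> x \<in> X \<Longrightarrow> \<phi> \<in> elems S X \<Longrightarrow> act S (Ch X x b) \<phi> \<in> colours S"
  using act_mem[of S "Ch X x b" \<phi>] by simp

lemma Bij_Arr: "finite X \<Longrightarrow> finite Y \<Longrightarrow> bij_betw f X Y \<Longrightarrow> Bij X Y (restrict f X) \<in> Arr B_cat"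
  by (simp add: bij_betw_restrict_eq)

lemma relabel_mem:
  "S \<in> Obj GS \<Longrightarrow> finite X \<Longrightarrow> finite Y \<Longrightarrow> bij_betw f X Y \<Longrightarrow> \<phi> \<in> elems S Y \<Longrightarrow> relabel S X Y f \<phi> \<in> elems S X"
  using act_mem[OF _ Bij_Arr] by fastforce

text \<open>The relation between bijections and the arrows \<open>ch\<close> of the indexing
  category, read contravariantly. It is the reason why the two sides of an equivariance law are
  defined together.\<close>

lemma colour_relabel:
  "S \<in> Obj GS \<Longrightarrow> finite X \<Longrightarrow> finite Y \<Longrightarrow> bij_betw f X Y \<Longrightarrow> \<phi> \<in> elems S Y \<Longrightarrow> x \<in> X \<Longrightarrow>
    act S (Ch X x b) (relabel S X Y f \<phi>) = act S (Ch Y (f x) b) \<phi>"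
  using act_comp[OF _ Bij_Arr[of X Y f], of S "Ch X x b" \<phi>] by simp

section \<open>The axioms of multiplication, contraction, unit and modular operad as rules\<close>

lemma
  assumes "multiplication S mul"
  shows mul_dom: "mul X x Y y \<phi> \<psi> \<noteq> None \<longleftrightarrow>
        finite X \<and> finite Y \<and> X \<inter> Y = {} \<and> x \<notin> X \<and> y \<notin> Y \<and>
        \<phi> \<in> elems S (X \<union> {x}) \<and> \<psi> \<in> elems S (Y \<union> {y}) \<and>
        colour S (X \<union> {x}) x \<phi> = dual_colour S (Y \<union> {y}) y \<psi>"
    and mul_mem: "mul X x Y y \<phi> \<psi> = Some \<chi> \<Longrightarrow> \<chi> \<in> elems S (X \<union> Y)"
    and mul_colour1: "mul X x Y y \<phi> \<psi> = Some \<chi> \<Longrightarrow> e \<in> X \<Longrightarrow>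
        colour S (X \<union> Y) e \<chi> = colour S (X \<union> {x}) e \<phi>"
    and mul_colour2: "mul X x Y y \<phi> \<psi> = Some \<chi> \<Longrightarrow> e \<in> Y \<Longrightarrow>
        colour S (X \<union> Y) e \<chi> = colour S (Y \<union> {y}) e \<psi>"
    and mul_comm: "mul Y y X x \<psi> \<phi> = mul X x Y y \<phi> \<psi>"
    and mul_equivariant: "\<lbrakk>finite X; finite Y; X \<inter> Y = {}; x \<notin> X; y \<notin> Y;
        finite W; finite Z; W \<inter> Z = {}; w \<notin> W; z \<notin> Z;
        bij_betw \<sigma> (X \<union> {x}) (W \<union> {w}); \<sigma> x = w;
        bij_betw \<rho> (Y \<union> {y}) (Z \<union> {z}); \<rho> y = z; \<phi> \<in> elems S (W \<union> {w}); \<psi> \<in> elems S (Z \<union> {z})\<rbrakk> \<Longrightarrow>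
           map_option (relabel S (X \<union> Y) (W \<union> Z) (\<lambda>e. if e \<in> X then \<sigma> e else \<rho> e))
             (mul W w Z z \<phi> \<psi>)
           = mul X x Y y (relabel S (X \<union> {x}) (W \<union> {w}) \<sigma> \<phi>)
                         (relabel S (Y \<union> {y}) (Z \<union> {z}) \<rho> \<psi>)"
proof -
  note * = assms[unfolded multiplication_def]
  show "mul X x Y y \<phi> \<psi> \<noteq> None \<longleftrightarrow>
        finite X \<and> finite Y \<and> X \<inter> Y = {} \<and> x \<notin> X \<and> y \<notin> Y \<and>
        \<phi> \<in> elems S (X \<union> {x}) \<and> \<psi> \<in> elems S (Y \<union> {y}) \<and>
        colour S (X \<union> {x}) x \<phi> = dual_colour S (Y \<union> {y}) y \<psi>"
    by (rule *[THEN conjunct1, rule_format])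
  show "mul X x Y y \<phi> \<psi> = Some \<chi> \<Longrightarrow> \<chi> \<in> elems S (X \<union> Y)"
    "mul X x Y y \<phi> \<psi> = Some \<chi> \<Longrightarrow> e \<in> X \<Longrightarrow>
        colour S (X \<union> Y) e \<chi> = colour S (X \<union> {x}) e \<phi>"
    "mul X x Y y \<phi> \<psi> = Some \<chi> \<Longrightarrow> e \<in> Y \<Longrightarrow>
        colour S (X \<union> Y) e \<chi> = colour S (Y \<union> {y}) e \<psi>"
    using *[THEN conjunct2, THEN conjunct1] by blast+
  show "mul Y y X x \<psi> \<phi> = mul X x Y y \<phi> \<psi>"
    by (rule *[THEN conjunct2, THEN conjunct2, THEN conjunct1, rule_format])
  show "\<lbrakk>finite X; finite Y; X \<inter> Y = {}; x \<notin> X; y \<notin> Y;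
        finite W; finite Z; W \<inter> Z = {}; w \<notin> W; z \<notin> Z;
        bij_betw \<sigma> (X \<union> {x}) (W \<union> {w}); \<sigma> x = w;
        bij_betw \<rho> (Y \<union> {y}) (Z \<union> {z}); \<rho> y = z; \<phi> \<in> elems S (W \<union> {w}); \<psi> \<in> elems S (Z \<union> {z})\<rbrakk> \<Longrightarrow>
           map_option (relabel S (X \<union> Y) (W \<union> Z) (\<lambda>e. if e \<in> X then \<sigma> e else \<rho> e))
             (mul W w Z z \<phi> \<psi>)
           = mul X x Y y (relabel S (X \<union> {x}) (W \<union> {w}) \<sigma> \<phi>)
                         (relabel S (Y \<union> {y}) (Z \<union> {z}) \<rho> \<psi>)"
    by (rule *[THEN conjunct2, THEN conjunct2, THEN conjunct2, rule_format]; (intro conjI)?) assumption+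
qed

lemma
  assumes "contraction S con"
  shows con_dom: "con X x y \<phi> \<noteq> None \<longleftrightarrow>
        finite X \<and> x \<notin> X \<and> y \<notin> X \<and> x \<noteq> y \<and> \<phi> \<in> elems S (X \<union> {x, y}) \<and>
        colour S (X \<union> {x, y}) x \<phi> = dual_colour S (X \<union> {x, y}) y \<phi>"
    and con_mem: "con X x y \<phi> = Some \<chi> \<Longrightarrow> \<chi> \<in> elems S X"
    and con_colour: "con X x y \<phi> = Some \<chi> \<Longrightarrow> e \<in> X \<Longrightarrow>
        colour S X e \<chi> = colour S (X \<union> {x, y}) e \<phi>"
    and con_comm: "con X x y = con X y x"
    and con_equivariant: "\<lbrakk>finite X; x \<notin> X; y \<notin> X; x \<noteq> y; finite Z; w \<notin> Z; z \<notin> Z; w \<noteq> z;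
        bij_betw \<sigma> (X \<union> {x, y}) (Z \<union> {w, z}); \<sigma> x = w; \<sigma> y = z; \<phi> \<in> elems S (Z \<union> {w, z})\<rbrakk> \<Longrightarrow>
        map_option (relabel S X Z \<sigma>) (con Z w z \<phi>)
           = con X x y (relabel S (X \<union> {x, y}) (Z \<union> {w, z}) \<sigma> \<phi>)"
proof -
  note * = assms[unfolded contraction_def]
  show "con X x y \<phi> \<noteq> None \<longleftrightarrow>
        finite X \<and> x \<notin> X \<and> y \<notin> X \<and> x \<noteq> y \<and> \<phi> \<in> elems S (X \<union> {x, y}) \<and>
        colour S (X \<union> {x, y}) x \<phi> = dual_colour S (X \<union> {x, y}) y \<phi>"
    by (rule *[THEN conjunct1, rule_format])
  show "con X x y \<phi> = Some \<chi> \<Longrightarrow> \<chi> \<in> elems S X"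
    "con X x y \<phi> = Some \<chi> \<Longrightarrow> e \<in> X \<Longrightarrow>
        colour S X e \<chi> = colour S (X \<union> {x, y}) e \<phi>"
    using *[THEN conjunct2, THEN conjunct1] by blast+
  show "con X x y = con X y x"
    by (rule *[THEN conjunct2, THEN conjunct2, THEN conjunct1, rule_format])
  show "\<lbrakk>finite X; x \<notin> X; y \<notin> X; x \<noteq> y; finite Z; w \<notin> Z; z \<notin> Z; w \<noteq> z;
        bij_betw \<sigma> (X \<union> {x, y}) (Z \<union> {w, z}); \<sigma> x = w; \<sigma> y = z; \<phi> \<in> elems S (Z \<union> {w, z})\<rbrakk> \<Longrightarrow>
        map_option (relabel S X Z \<sigma>) (con Z w z \<phi>)
           = con X x y (relabel S (X \<union> {x, y}) (Z \<union> {w, z}) \<sigma> \<phi>)"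
    by (rule *[THEN conjunct2, THEN conjunct2, THEN conjunct2, rule_format]; (intro conjI)?) assumption+
qed

lemma
  assumes "is_unit_for p q S mul \<epsilon>"
  shows unit_PiE: "\<epsilon> \<in> colours S \<rightarrow>\<^sub>E elems S {p, q}"
    and unit_mem: "c \<in> colours S \<Longrightarrow> \<epsilon> c \<in> elems S {p, q}"
    and unit_right: "\<lbrakk>finite X; x \<notin> X; p \<notin> X; \<phi> \<in> elems S (X \<union> {x})\<rbrakk> \<Longrightarrow>
      mul X x {p} q \<phi> (\<epsilon> (colour S (X \<union> {x}) x \<phi>)) =
        Some (relabel S (X \<union> {p}) (X \<union> {x}) (\<lambda>e. if e = p then x else e) \<phi>)"
  using assms unfolding is_unit_for_def Let_def by blast+

abbreviation sp :: "'u modop \<Rightarrow> 'u species" where "sp M \<equiv> fst M"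
abbreviation ml :: "'u modop \<Rightarrow> 'u mult" where "ml M \<equiv> fst (snd M)"
abbreviation cn :: "'u modop \<Rightarrow> 'u contr" where "cn M \<equiv> fst (snd (snd M))"
abbreviation un :: "'u modop \<Rightarrow> 'u \<Rightarrow> 'u" where "un M \<equiv> snd (snd (snd M))"

lemma agreeI: "(\<And>l r. a = Some l \<Longrightarrow> b = Some r \<Longrightarrow> l = r) \<Longrightarrow> a \<triangleq> b"
  unfolding agree_def by (metis not_None_eq)

lemma bind_eq_SomeE:
  assumes "Option.bind m f = Some l"
  obtains a where "m = Some a" "f a = Some l"
  using assms by (auto simp: bind_eq_Some_conv)

lemma agreeD: "a \<triangleq> b \<Longrightarrow> a = Some l \<Longrightarrow> b = Some r \<Longrightarrow> l = r"
  unfolding agree_def by auto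

lemma
  assumes "modular_operad p q M"
  shows modop_GS: "sp M \<in> Obj GS"
    and modop_mul: "multiplication (sp M) (ml M)"
    and modop_unit: "is_unit_for p q (sp M) (ml M) (un M)"
    and modop_con: "contraction (sp M) (cn M)"
    and modop_M1: "\<lbrakk>ml M X1 w (X2 \<union> {y}) x \<phi>1 \<phi>2 = Some a; ml M (X1 \<union> X2) y X3 z a \<phi>3 = Some l;
        ml M (X2 \<union> {x}) y X3 z \<phi>2 \<phi>3 = Some b; ml M X1 w (X2 \<union> X3) x \<phi>1 b = Some r\<rbrakk> \<Longrightarrow> l = r"
    and modop_M2: "\<lbrakk>cn M (X \<union> {w, x}) y z \<phi> = Some a; cn M X w x a = Some l;
        cn M (X \<union> {y, z}) w x \<phi> = Some b; cn M X y z b = Some r\<rbrakk> \<Longrightarrow> l = r"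
    and modop_M3: "\<lbrakk>cn M (X1 \<union> {y}) w x \<phi> = Some a; ml M X1 y X2 z a \<psi> = Some l;
        ml M (X1 \<union> {w, x}) y X2 z \<phi> \<psi> = Some b; cn M (X1 \<union> X2) w x b = Some r\<rbrakk> \<Longrightarrow> l = r"
    and modop_M4: "\<lbrakk>ml M (X1 \<union> {y}) w (X2 \<union> {z}) x \<phi> \<psi> = Some a; cn M (X1 \<union> X2) y z a = Some l;
        ml M (X1 \<union> {w}) y (X2 \<union> {x}) z \<phi> \<psi> = Some b; cn M (X1 \<union> X2) w x b = Some r\<rbrakk> \<Longrightarrow> l = r"
proof -
  obtain S mul con \<epsilon> where M: "M = (S, mul, con, \<epsilon>)" by (cases M)
  note * = assms[unfolded M modular_operad_def prod.case]
  show "sp M \<in> Obj GS" "multiplication (sp M) (ml M)" "is_unit_for p q (sp M) (ml M) (un M)"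
    "contraction (sp M) (cn M)" using * unfolding M by simp_all
  note * = *[THEN conjunct2, THEN conjunct2, THEN conjunct2, THEN conjunct2]
  {
    assume a: "ml M X1 w (X2 \<union> {y}) x \<phi>1 \<phi>2 = Some a" "ml M (X1 \<union> X2) y X3 z a \<phi>3 = Some l"
        "ml M (X2 \<union> {x}) y X3 z \<phi>2 \<phi>3 = Some b" "ml M X1 w (X2 \<union> X3) x \<phi>1 b = Some r"
    show "l = r"
      by (rule agreeD[OF *[THEN conjunct1, rule_format, of X1 w X2 y x \<phi>1 \<phi>2 X3 z \<phi>3]])
        (use a in \<open>simp_all only: M fst_conv snd_conv bind.bind_lunit\<close>)
  next
    assume a: "cn M (X \<union> {w, x}) y z \<phi> = Some a" "cn M X w x a = Some l"
        "cn M (X \<union> {y, z}) w x \<phi> = Some b" "cn M X y z b = Some r"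
    show "l = r"
      by (rule agreeD[OF *[THEN conjunct2, THEN conjunct1, rule_format, of X w x y z \<phi>]])
        (use a in \<open>simp_all only: M fst_conv snd_conv bind.bind_lunit\<close>)
  next
    assume a: "cn M (X1 \<union> {y}) w x \<phi> = Some a" "ml M X1 y X2 z a \<psi> = Some l"
        "ml M (X1 \<union> {w, x}) y X2 z \<phi> \<psi> = Some b" "cn M (X1 \<union> X2) w x b = Some r"
    show "l = r"
      by (rule agreeD[OF *[THEN conjunct2, THEN conjunct2, THEN conjunct1, rule_format, of X1 y w x \<phi> X2 z \<psi>]])
        (use a in \<open>simp_all only: M fst_conv snd_conv bind.bind_lunit\<close>)
  next
    assume a: "ml M (X1 \<union> {y}) w (X2 \<union> {z}) x \<phi> \<psi> = Some a" "cn M (X1 \<union> X2) y z a = Some l"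
        "ml M (X1 \<union> {w}) y (X2 \<union> {x}) z \<phi> \<psi> = Some b" "cn M (X1 \<union> X2) w x b = Some r"
    show "l = r"
      by (rule agreeD[OF *[THEN conjunct2, THEN conjunct2, THEN conjunct2, rule_format, of X1 y w X2 z x \<phi> \<psi>]])
        (use a in \<open>simp_all only: M fst_conv snd_conv bind.bind_lunit\<close>)
  }
qed

text \<open>
  Here \<open>R i b a' a\<close> says that \<open>a'\<close> in the \<open>i\<close>-th modular operad lifts \<open>a\<close>.  Every side of a coherence
  axiom that is defined in \<open>A\<close> lifts to each \<open>M i\<close>, and \<open>R_sep\<close> turns the equality of the lifts into the
  equality in \<open>A\<close>.  This covers subobjects of products and split quotients alike.  Units are only
  required to lift at the colours of actual elements: if no element has colour \<open>c\<close>, the unit law says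
  nothing about \<open>\<epsilon> c\<close>, not even about its colours.
\<close>

locale logical_cover =
  fixes p q :: 'u and A :: "'u species" and mul :: "'u mult" and con :: "'u contr" and \<epsilon> :: "'u \<Rightarrow> 'u"
    and I :: "'i set" and M :: "'i \<Rightarrow> 'u modop" and R :: "'i \<Rightarrow> 'u bobj \<Rightarrow> 'u \<Rightarrow> 'u \<Rightarrow> bool"
  assumes pq: "p \<noteq> q" and A: "A \<in> Obj GS" and M: "i \<in> I \<Longrightarrow> modular_operad p q (M i)"
    and R_mem: "i \<in> I \<Longrightarrow> R i b a' a \<Longrightarrow> a' \<in> fobj (sp (M i)) b"
    and R_total: "i \<in> I \<Longrightarrow> b \<in> Obj B_cat \<Longrightarrow> a \<in> fobj A b \<Longrightarrow> \<exists>a'. R i b a' a"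
    and R_sep: "b \<in> Obj B_cat \<Longrightarrow> a1 \<in> fobj A b \<Longrightarrow> a2 \<in> fobj A b \<Longrightarrow>
      (\<And>i. i \<in> I \<Longrightarrow> \<exists>a'. R i b a' a1 \<and> R i b a' a2) \<Longrightarrow> a1 = a2"
    and R_act: "i \<in> I \<Longrightarrow> m \<in> Arr B_cat \<Longrightarrow> R i (bcod m) a' a \<Longrightarrow>
      R i (bdom m) (act (sp (M i)) m a') (act A m a)"
    and R_mul: "i \<in> I \<Longrightarrow> R i (Fin (X \<union> {x})) \<phi>' \<phi> \<Longrightarrow> R i (Fin (Y \<union> {y})) \<psi>' \<psi> \<Longrightarrow>
      mul X x Y y \<phi> \<psi> = Some \<chi> \<Longrightarrow> \<exists>\<chi>'. ml (M i) X x Y y \<phi>' \<psi>' = Some \<chi>' \<and> R i (Fin (X \<union> Y)) \<chi>' \<chi>"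
    and R_con: "i \<in> I \<Longrightarrow> R i (Fin (X \<union> {x, y})) \<phi>' \<phi> \<Longrightarrow> con X x y \<phi> = Some \<chi> \<Longrightarrow>
      \<exists>\<chi>'. cn (M i) X x y \<phi>' = Some \<chi>' \<and> R i (Fin X) \<chi>' \<chi>"
    and R_unit: "i \<in> I \<Longrightarrow> finite X \<Longrightarrow> x \<notin> X \<Longrightarrow> p \<notin> X \<Longrightarrow> R i (Fin (X \<union> {x})) \<phi>' \<phi> \<Longrightarrow>
      R i (Fin {p, q}) (un (M i) (colour (sp (M i)) (X \<union> {x}) x \<phi>')) (\<epsilon> (colour A (X \<union> {x}) x \<phi>))"
    and dom_mul: "mul X x Y y \<phi> \<psi> \<noteq> None \<longleftrightarrow>
        finite X \<and> finite Y \<and> X \<inter> Y = {} \<and> x \<notin> X \<and> y \<notin> Y \<and>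
        \<phi> \<in> elems A (X \<union> {x}) \<and> \<psi> \<in> elems A (Y \<union> {y}) \<and>
        colour A (X \<union> {x}) x \<phi> = dual_colour A (Y \<union> {y}) y \<psi>"
    and mem_mul: "mul X x Y y \<phi> \<psi> = Some \<chi> \<Longrightarrow> \<chi> \<in> elems A (X \<union> Y)"
    and dom_con: "con X x y \<phi> \<noteq> None \<longleftrightarrow>
        finite X \<and> x \<notin> X \<and> y \<notin> X \<and> x \<noteq> y \<and> \<phi> \<in> elems A (X \<union> {x, y}) \<and>
        colour A (X \<union> {x, y}) x \<phi> = dual_colour A (X \<union> {x, y}) y \<phi>"
    and mem_con: "con X x y \<phi> = Some \<chi> \<Longrightarrow> \<chi> \<in> elems A X"
    and \<epsilon>_PiE: "\<epsilon> \<in> colours A \<rightarrow>\<^sub>E elems A {p, q}"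
begin

section \<open>The laws of the covered structure\<close>

lemma R_lift:
  assumes "i \<in> I" "finite X" "\<phi> \<in> elems A X"
  obtains \<phi>' where "R i (Fin X) \<phi>' \<phi>" "\<phi>' \<in> elems (sp (M i)) X"
  using R_total[OF assms(1) _ assms(3)] R_mem assms by auto

text \<open>The index sets \<open>U\<close>, \<open>V\<close>, \<open>W\<close> are variables tied
  by equations because consecutive operations bracket the same union in different ways; the
  reassociation is then a side goal about sets.\<close>

lemma R_mulE:
  assumes "i \<in> I" "R i (Fin U) \<phi>' \<phi>" "R i (Fin V) \<psi>' \<psi>" "mul X x Y y \<phi> \<psi> = Some \<chi>"
    "U = X \<union> {x}" "V = Y \<union> {y}" "W = X \<union> Y"
  obtains \<chi>' where "ml (M i) X x Y y \<phi>' \<psi>' = Some \<chi>'" "R i (Fin W) \<chi>' \<chi>"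
  using R_mul assms by blast

lemma R_conE:
  assumes "i \<in> I" "R i (Fin U) \<phi>' \<phi>" "con X x y \<phi> = Some \<chi>" "U = X \<union> {x, y}"
  obtains \<chi>' where "cn (M i) X x y \<phi>' = Some \<chi>'" "R i (Fin X) \<chi>' \<chi>"
  using R_con assms by blast

lemma R_Ch:
  assumes "i \<in> I" "R i (Fin X) \<phi>' \<phi>" "finite X" "x \<in> X"
  shows "R i Sec (act (sp (M i)) (Ch X x b) \<phi>') (act A (Ch X x b) \<phi>)"
  using R_act[of i "Ch X x b"] assms by simp

lemma R_relabel:
  assumes "i \<in> I" "R i (Fin Y) \<phi>' \<phi>" "finite X" "finite Y" "bij_betw f X Y"
  shows "R i (Fin X) (relabel (sp (M i)) X Y f \<phi>') (relabel A X Y f \<phi>)"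
  using R_act[OF _ Bij_Arr] assms by fastforce

text \<open>Each law has two halves. Whether a side is defined is decided in \<open>A\<close> by
  \<open>dom_mul\<close>, through colours. The values of two defined sides are then compared on
  lifts; both lifts have to be computed from the same lifts of the arguments, so that the law in
  \<open>M i\<close> relates them.\<close>

lemma multiplication: "multiplication A mul"
proof -
  have col: "colour A (X \<union> Y) e \<chi> = colour A (X \<union> {x}) e \<phi>"
    if mul: "mul X x Y y \<phi> \<psi> = Some \<chi>" and e: "e \<in> X" for X x Y y \<phi> \<psi> \<chi> e
  proof (rule R_sep)
    note d = dom_mul[of X x Y y \<phi> \<psi>, THEN iffD1, OF option.discI[OF mul]]
    show "colour A (X \<union> Y) e \<chi> \<in> colours A" "colour A (X \<union> {x}) e \<phi> \<in> colours A"
      using d mem_mul[OF mul] e A by (auto intro!: colour_mem)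
    fix i assume i: "i \<in> I"
    obtain \<phi>' \<psi>' where \<phi>': "R i (Fin (X \<union> {x})) \<phi>' \<phi>" and \<psi>': "R i (Fin (Y \<union> {y})) \<psi>' \<psi>"
      using R_lift[OF i] d by (metis finite.emptyI finite_Un finite_insert)
    obtain \<chi>' where \<chi>': "ml (M i) X x Y y \<phi>' \<psi>' = Some \<chi>'" "R i (Fin (X \<union> Y)) \<chi>' \<chi>"
      using R_mul[OF i \<phi>' \<psi>' mul] by blast
    have "colour (sp (M i)) (X \<union> Y) e \<chi>' = colour (sp (M i)) (X \<union> {x}) e \<phi>'"
      by (rule mul_colour1[OF modop_mul[OF M[OF i]] \<chi>'(1) e])
    then show "\<exists>a'. R i Sec a' (colour A (X \<union> Y) e \<chi>) \<and> R i Sec a' (colour A (X \<union> {x}) e \<phi>)"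
      using R_Ch[OF i \<chi>'(2), of e False] R_Ch[OF i \<phi>', of e False] d e by auto
  qed simp
  have comm: "mul Y y X x \<psi> \<phi> = mul X x Y y \<phi> \<psi>" for X x Y y \<phi> \<psi>
  proof -
    \<comment> \<open>Applying the involution to both sides of the matching condition exchanges the
      roles of \<phi> and \<psi>.\<close>
    have swap: "mul Y y X x \<psi> \<phi> \<noteq> None" if "mul X x Y y \<phi> \<psi> \<noteq> None" for X x Y y \<phi> \<psi>
    proof -
      have d: "finite X" "finite Y" "X \<inter> Y = {}" "x \<notin> X" "y \<notin> Y" "\<phi> \<in> elems A (X \<union> {x})"
        "\<psi> \<in> elems A (Y \<union> {y})" "colour A (X \<union> {x}) x \<phi> = dual_colour A (Y \<union> {y}) y \<psi>"
        using that unfolding dom_mul by blast+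
      have "dual_colour A (X \<union> {x}) x \<phi> = act A (SecMor True) (colour A (X \<union> {x}) x \<phi>)"
        by (rule dual_colour_eq) (use d A in auto)
      moreover have "dual_colour A (Y \<union> {y}) y \<psi> = act A (SecMor True) (colour A (Y \<union> {y}) y \<psi>)"
        by (rule dual_colour_eq) (use d A in auto)
      moreover have "colour A (Y \<union> {y}) y \<psi> \<in> colours A" by (rule colour_mem) (use d A in auto)
      ultimately have "colour A (Y \<union> {y}) y \<psi> = dual_colour A (X \<union> {x}) x \<phi>"
        using d(8) act_involution[OF A] by simp
      then show ?thesis unfolding dom_mul using d by (simp add: Int_commute)
    qed
    show ?thesis
    proof (cases "mul X x Y y \<phi> \<psi>")
      case None
      with swap[of Y y X x \<psi> \<phi>] show ?thesis by (cases "mul Y y X x \<psi> \<phi>") simp_all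
    next
      case (Some \<chi>)
      then obtain \<chi>2 where \<chi>2: "mul Y y X x \<psi> \<phi> = Some \<chi>2" using swap by fastforce
      note d = dom_mul[of X x Y y \<phi> \<psi>, THEN iffD1, OF option.discI[OF Some]]
      have "\<chi>2 = \<chi>"
      proof (rule R_sep)
        show "Fin (X \<union> Y) \<in> Obj B_cat" using d by simp
        show "\<chi>2 \<in> elems A (X \<union> Y)" "\<chi> \<in> elems A (X \<union> Y)"
          using mem_mul[OF \<chi>2] mem_mul[OF Some] by (auto simp: Un_commute)
        fix i assume i: "i \<in> I"
        obtain \<phi>' \<psi>' where \<phi>': "R i (Fin (X \<union> {x})) \<phi>' \<phi>" and \<psi>': "R i (Fin (Y \<union> {y})) \<psi>' \<psi>"
          using R_lift[OF i] d by (metis finite.emptyI finite_Un finite_insert)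
        obtain \<chi>' where 1: "ml (M i) X x Y y \<phi>' \<psi>' = Some \<chi>'" "R i (Fin (X \<union> Y)) \<chi>' \<chi>"
          using R_mul[OF i \<phi>' \<psi>' Some] by blast
        obtain \<chi>2' where 2: "ml (M i) Y y X x \<psi>' \<phi>' = Some \<chi>2'" "R i (Fin (X \<union> Y)) \<chi>2' \<chi>2"
          using R_mul[OF i \<psi>' \<phi>' \<chi>2] by (auto simp: Un_commute)
        show "\<exists>a'. R i (Fin (X \<union> Y)) a' \<chi>2 \<and> R i (Fin (X \<union> Y)) a' \<chi>"
          using 1 2 mul_comm[OF modop_mul[OF M[OF i]]] by fastforce
      qed
      then show ?thesis using Some \<chi>2 by simp
    qed
  qed
  have col2: "colour A (X \<union> Y) e \<chi> = colour A (Y \<union> {y}) e \<psi>"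
    if "mul X x Y y \<phi> \<psi> = Some \<chi>" "e \<in> Y" for X x Y y \<phi> \<psi> \<chi> e
    using col[of Y y X x \<psi> \<phi> \<chi> e] that comm[of Y y X x \<psi> \<phi>] by (simp add: Un_commute)
  have equi: "map_option (relabel A (X \<union> Y) (W \<union> Z) (\<lambda>e. if e \<in> X then \<sigma> e else \<rho> e))
             (mul W w Z z \<phi> \<psi>)
           = mul X x Y y (relabel A (X \<union> {x}) (W \<union> {w}) \<sigma> \<phi>)
                         (relabel A (Y \<union> {y}) (Z \<union> {z}) \<rho> \<psi>)" (is "?L = mul X x Y y ?\<phi> ?\<psi>")
    if fin: "finite X" "finite Y" and XY: "X \<inter> Y = {}" "x \<notin> X" "y \<notin> Y"
      and fin': "finite W" "finite Z" and WZ: "W \<inter> Z = {}" "w \<notin> W" "z \<notin> Z"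
      and \<sigma>: "bij_betw \<sigma> (X \<union> {x}) (W \<union> {w})" "\<sigma> x = w"
      and \<rho>: "bij_betw \<rho> (Y \<union> {y}) (Z \<union> {z})" "\<rho> y = z"
      and \<phi>: "\<phi> \<in> elems A (W \<union> {w})" and \<psi>: "\<psi> \<in> elems A (Z \<union> {z})"
    for X x Y y W w Z z \<sigma> \<rho> \<phi> \<psi>
  proof -
    have \<phi>2: "?\<phi> \<in> elems A (X \<union> {x})" and \<psi>2: "?\<psi> \<in> elems A (Y \<union> {y})"
      using that by (auto intro!: relabel_mem[OF A] simp del: Un_insert_right)
    \<comment> \<open>Since \<open>\<sigma> x = w\<close> and \<open>\<rho> y = z\<close>,
      relabelling leaves the two colours that have to match unchanged, so both sides of the law are
      defined together.\<close>
    have "colour A (X \<union> {x}) x ?\<phi> = colour A (W \<union> {w}) w \<phi>"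
      using colour_relabel[OF A _ _ \<sigma>(1) \<phi>, of x False] fin fin' \<sigma>(2) by simp
    moreover have "dual_colour A (Y \<union> {y}) y ?\<psi> = dual_colour A (Z \<union> {z}) z \<psi>"
      using colour_relabel[OF A _ _ \<rho>(1) \<psi>, of y True] fin fin' \<rho>(2) by simp
    ultimately have dom: "mul W w Z z \<phi> \<psi> \<noteq> None \<longleftrightarrow> mul X x Y y ?\<phi> ?\<psi> \<noteq> None"
      unfolding dom_mul using \<phi>2 \<psi>2 that(1-10) \<phi> \<psi> by simp
    let ?f = "\<lambda>e. if e \<in> X then \<sigma> e else \<rho> e"
    have "bij_betw \<sigma> X W" using \<sigma> XY WZ by (auto simp: bij_betw_def inj_on_def)
    moreover have "bij_betw \<rho> Y Z" using \<rho> XY WZ by (auto simp: bij_betw_def inj_on_def)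
    ultimately have f: "bij_betw ?f (X \<union> Y) (W \<union> Z)"
      using XY WZ by (intro bij_betw_disjoint_Un) (auto simp: bij_betw_cong[of X ?f \<sigma>] disjoint_iff cong: bij_betw_cong)
    show ?thesis
    proof (cases "mul W w Z z \<phi> \<psi>")
      case None
      then show ?thesis using dom by simp
    next
      case (Some \<chi>)
      then obtain \<chi>2 where \<chi>2: "mul X x Y y ?\<phi> ?\<psi> = Some \<chi>2" using dom by fastforce
      have "relabel A (X \<union> Y) (W \<union> Z) ?f \<chi> = \<chi>2"
      proof (rule R_sep)
        show "Fin (X \<union> Y) \<in> Obj B_cat" using fin by simp
        show "\<chi>2 \<in> elems A (X \<union> Y)" by (rule mem_mul[OF \<chi>2])
        show "relabel A (X \<union> Y) (W \<union> Z) ?f \<chi> \<in> elems A (X \<union> Y)"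
          using relabel_mem[OF A _ _ f] mem_mul[OF Some] fin fin' by simp
        fix i assume i: "i \<in> I"
        obtain \<phi>' \<psi>' where \<phi>': "R i (Fin (W \<union> {w})) \<phi>' \<phi>" and \<psi>': "R i (Fin (Z \<union> {z})) \<psi>' \<psi>"
          using R_lift[OF i] \<phi> \<psi> fin' by (metis finite.emptyI finite_Un finite_insert)
        note \<phi>2' = R_relabel[OF i \<phi>' _ _ \<sigma>(1)] and \<psi>2' = R_relabel[OF i \<psi>' _ _ \<rho>(1)]
        obtain \<chi>' where 1: "ml (M i) W w Z z \<phi>' \<psi>' = Some \<chi>'" "R i (Fin (W \<union> Z)) \<chi>' \<chi>"
          using R_mul[OF i \<phi>' \<psi>' Some] by blast
        obtain \<chi>2' where 2: "ml (M i) X x Y y (relabel (sp (M i)) (X \<union> {x}) (W \<union> {w}) \<sigma> \<phi>')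
            (relabel (sp (M i)) (Y \<union> {y}) (Z \<union> {z}) \<rho> \<psi>') = Some \<chi>2'" "R i (Fin (X \<union> Y)) \<chi>2' \<chi>2"
          using R_mul[OF i \<phi>2' \<psi>2' \<chi>2] fin fin' by blast
        have "relabel (sp (M i)) (X \<union> Y) (W \<union> Z) ?f \<chi>' = \<chi>2'"
          using mul_equivariant[OF modop_mul[OF M[OF i]] that(1-14), of \<phi>' \<psi>'] 1 2 R_mem[OF i] \<phi>' \<psi>'
          by simp
        then show "\<exists>a'. R i (Fin (X \<union> Y)) a' (relabel A (X \<union> Y) (W \<union> Z) ?f \<chi>) \<and> R i (Fin (X \<union> Y)) a' \<chi>2"
          using R_relabel[OF i 1(2) _ _ f] fin fin' 2(2) by auto
      qed
      then show ?thesis using Some \<chi>2 by simp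
    qed
  qed
  show ?thesis
    unfolding multiplication_def
    by (intro conjI allI impI ballI; (rule dom_mul | erule mem_mul | erule (1) col
        | erule (1) col2 | rule comm | (elim conjE, rule equi; assumption)))
qed

lemma contraction: "contraction A con"
proof -
  have colour: "colour A X e \<chi> = colour A (X \<union> {x, y}) e \<phi>"
    if con: "con X x y \<phi> = Some \<chi>" and e: "e \<in> X" for X x y \<phi> \<chi> e
  proof (rule R_sep)
    note d = dom_con[of X x y \<phi>, THEN iffD1, OF option.discI[OF con]]
    show "colour A X e \<chi> \<in> colours A" "colour A (X \<union> {x, y}) e \<phi> \<in> colours A"
      using d mem_con[OF con] e A by (auto intro!: colour_mem)
    fix i assume i: "i \<in> I"
    obtain \<phi>' where \<phi>': "R i (Fin (X \<union> {x, y})) \<phi>' \<phi>"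
      using R_lift[OF i, of "X \<union> {x, y}"] d by blast
    obtain \<chi>' where \<chi>': "cn (M i) X x y \<phi>' = Some \<chi>'" "R i (Fin X) \<chi>' \<chi>"
      using R_con[OF i \<phi>' con] by blast
    have "colour (sp (M i)) X e \<chi>' = colour (sp (M i)) (X \<union> {x, y}) e \<phi>'"
      by (rule con_colour[OF modop_con[OF M[OF i]] \<chi>'(1) e])
    then show "\<exists>a'. R i Sec a' (colour A X e \<chi>) \<and> R i Sec a' (colour A (X \<union> {x, y}) e \<phi>)"
      using R_Ch[OF i \<chi>'(2), of e False] R_Ch[OF i \<phi>', of e False] d e by auto
  qed simp
  have comm: "con X x y = con X y x" for X x y
  proof
    fix \<phi>
    have swap: "con X y x \<phi> \<noteq> None" if "con X x y \<phi> \<noteq> None" for x y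
    proof -
      have d: "finite X" "x \<notin> X" "y \<notin> X" "x \<noteq> y" "\<phi> \<in> elems A (X \<union> {x, y})"
        "colour A (X \<union> {x, y}) x \<phi> = dual_colour A (X \<union> {x, y}) y \<phi>"
        using that unfolding dom_con by blast+
      have "dual_colour A (X \<union> {x, y}) x \<phi> = act A (SecMor True) (colour A (X \<union> {x, y}) x \<phi>)"
        by (rule dual_colour_eq) (use d A in auto)
      moreover have "dual_colour A (X \<union> {x, y}) y \<phi> = act A (SecMor True) (colour A (X \<union> {x, y}) y \<phi>)"
        by (rule dual_colour_eq) (use d A in auto)
      moreover have "colour A (X \<union> {x, y}) y \<phi> \<in> colours A" by (rule colour_mem) (use d A in auto)
      ultimately have "colour A (X \<union> {x, y}) y \<phi> = dual_colour A (X \<union> {x, y}) x \<phi>"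
        using d(6) act_involution[OF A] by simp
      then show ?thesis unfolding dom_con using d by (simp add: insert_commute)
    qed
    show "con X x y \<phi> = con X y x \<phi>"
    proof (cases "con X x y \<phi>")
      case None
      with swap[of y x] show ?thesis by (cases "con X y x \<phi>") simp_all
    next
      case (Some \<chi>)
      then obtain \<chi>2 where \<chi>2: "con X y x \<phi> = Some \<chi>2" using swap by fastforce
      note d = dom_con[of X x y \<phi>, THEN iffD1, OF option.discI[OF Some]]
      have "\<chi>2 = \<chi>"
      proof (rule R_sep)
        show "Fin X \<in> Obj B_cat" using d by simp
        show "\<chi>2 \<in> elems A X" "\<chi> \<in> elems A X"
          using mem_con[OF \<chi>2] mem_con[OF Some] by auto
        fix i assume i: "i \<in> I"
        obtain \<phi>' where \<phi>': "R i (Fin (X \<union> {x, y})) \<phi>' \<phi>"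
          using R_lift[OF i, of "X \<union> {x, y}"] d by blast
        obtain \<chi>' where 1: "cn (M i) X x y \<phi>' = Some \<chi>'" "R i (Fin X) \<chi>' \<chi>"
          using R_con[OF i \<phi>' Some] by blast
        obtain \<chi>2' where 2: "cn (M i) X y x \<phi>' = Some \<chi>2'" "R i (Fin X) \<chi>2' \<chi>2"
          using R_con[OF i _ \<chi>2, of \<phi>'] \<phi>' by (auto simp: insert_commute)
        show "\<exists>a'. R i (Fin X) a' \<chi>2 \<and> R i (Fin X) a' \<chi>"
          using 1 2 con_comm[OF modop_con[OF M[OF i]], of X x y] by auto
      qed
      then show ?thesis using Some \<chi>2 by simp
    qed
  qed
  have equi: "map_option (relabel A X Z \<sigma>) (con Z w z \<phi>)
           = con X x y (relabel A (X \<union> {x, y}) (Z \<union> {w, z}) \<sigma> \<phi>)" (is "_ = con X x y ?\<phi>")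
    if XZ: "finite X" "x \<notin> X" "y \<notin> X" "x \<noteq> y" "finite Z" "w \<notin> Z" "z \<notin> Z" "w \<noteq> z"
      and \<sigma>: "bij_betw \<sigma> (X \<union> {x, y}) (Z \<union> {w, z})" "\<sigma> x = w" "\<sigma> y = z"
      and \<phi>: "\<phi> \<in> elems A (Z \<union> {w, z})" for X x y Z w z \<sigma> \<phi>
  proof -
    have \<phi>2: "?\<phi> \<in> elems A (X \<union> {x, y})"
      using that by (auto intro!: relabel_mem[OF A] simp del: Un_insert_right)
    have "colour A (X \<union> {x, y}) x ?\<phi> = colour A (Z \<union> {w, z}) w \<phi>"
      using colour_relabel[OF A _ _ \<sigma>(1) \<phi>, of x False] XZ \<sigma>(2) by simp
    moreover have "dual_colour A (X \<union> {x, y}) y ?\<phi> = dual_colour A (Z \<union> {w, z}) z \<phi>"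
      using colour_relabel[OF A _ _ \<sigma>(1) \<phi>, of y True] XZ \<sigma>(3) by simp
    ultimately have dom: "con Z w z \<phi> \<noteq> None \<longleftrightarrow> con X x y ?\<phi> \<noteq> None"
      unfolding dom_con using \<phi>2 XZ \<phi> by simp
    have f: "bij_betw \<sigma> X Z" using \<sigma> XZ by (auto simp: bij_betw_def inj_on_def)
    show ?thesis
    proof (cases "con Z w z \<phi>")
      case None
      then show ?thesis using dom by simp
    next
      case (Some \<chi>)
      then obtain \<chi>2 where \<chi>2: "con X x y ?\<phi> = Some \<chi>2" using dom by fastforce
      have "relabel A X Z \<sigma> \<chi> = \<chi>2"
      proof (rule R_sep)
        show "Fin X \<in> Obj B_cat" using XZ by simp
        show "\<chi>2 \<in> elems A X" by (rule mem_con[OF \<chi>2])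
        show "relabel A X Z \<sigma> \<chi> \<in> elems A X"
          using relabel_mem[OF A _ _ f] mem_con[OF Some] XZ by simp
        fix i assume i: "i \<in> I"
        obtain \<phi>' where \<phi>': "R i (Fin (Z \<union> {w, z})) \<phi>' \<phi>"
          using R_lift[OF i _ \<phi>] XZ by blast
        note \<phi>2' = R_relabel[OF i \<phi>' _ _ \<sigma>(1)]
        obtain \<chi>' where 1: "cn (M i) Z w z \<phi>' = Some \<chi>'" "R i (Fin Z) \<chi>' \<chi>"
          using R_con[OF i \<phi>' Some] by blast
        obtain \<chi>2' where 2: "cn (M i) X x y (relabel (sp (M i)) (X \<union> {x, y}) (Z \<union> {w, z}) \<sigma> \<phi>')
            = Some \<chi>2'" "R i (Fin X) \<chi>2' \<chi>2"
          using R_con[OF i \<phi>2' \<chi>2] XZ by blast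
        have "relabel (sp (M i)) X Z \<sigma> \<chi>' = \<chi>2'"
          using con_equivariant[OF modop_con[OF M[OF i]] that(1-11), of \<phi>'] 1 2 R_mem[OF i] \<phi>'
          by simp
        then show "\<exists>a'. R i (Fin X) a' (relabel A X Z \<sigma> \<chi>) \<and> R i (Fin X) a' \<chi>2"
          using R_relabel[OF i 1(2) _ _ f] XZ 2(2) by auto
      qed
      then show ?thesis using Some \<chi>2 by simp
    qed
  qed
  show ?thesis
    unfolding contraction_def
    by (intro conjI allI impI ballI; (rule dom_con | erule mem_con | erule (1) colour
        | rule comm | (elim conjE, rule equi; assumption)))
qed

text \<open>That \<epsilon> has colours fit for the product is not among the assumptions but is
  recovered from the lifts. In each \<open>M i\<close> the product of a lift of \<phi> with the unit
  at its colour is defined, which forces the colours to match there, and \<open>R_sep\<close> at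
  \<open>Sec\<close> transfers the match to \<open>A\<close>. Only then does the product in
  \<open>A\<close> exist, and its value is compared in a second use of \<open>R_sep\<close>.\<close>

lemma is_unit: "is_unit_for p q A mul \<epsilon>"
proof -
  have "mul X x {p} q \<phi> (\<epsilon> (colour A (X \<union> {x}) x \<phi>)) =
        Some (relabel A (X \<union> {p}) (X \<union> {x}) (\<lambda>e. if e = p then x else e) \<phi>)" (is "mul X x {p} q \<phi> ?u = Some ?r")
    if X: "finite X" "x \<notin> X" "p \<notin> X" and \<phi>: "\<phi> \<in> elems A (X \<union> {x})" for X x \<phi>
  proof -
    let ?c = "colour A (X \<union> {x}) x \<phi>" and ?f = "\<lambda>e. if e = p then x else e"
    have c: "?c \<in> colours A" by (rule colour_mem) (use X \<phi> A in auto)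
    have u: "?u \<in> elems A ({p} \<union> {q})" using PiE_mem[OF \<epsilon>_PiE c] by (simp add: insert_commute)
    have f: "bij_betw ?f (X \<union> {p}) (X \<union> {x})" using X by (auto simp: bij_betw_def inj_on_def)
    \<comment> \<open>One choice of \<phi>' has to serve throughout: the unit is lifted by the unit
      of \<open>M i\<close> at the colour of this very \<phi>', so that the unit law of
      \<open>M i\<close> evaluates their product.\<close>
    have *: "\<exists>\<phi>' u'. R i (Fin (X \<union> {x})) \<phi>' \<phi> \<and> R i (Fin ({p} \<union> {q})) u' ?u \<and>
        R i Sec (colour (sp (M i)) (X \<union> {x}) x \<phi>') ?c \<and> R i Sec (dual_colour (sp (M i)) ({p} \<union> {q}) q u') (dual_colour A ({p} \<union> {q}) q ?u) \<and>
        ml (M i) X x {p} q \<phi>' u' = Some (relabel (sp (M i)) (X \<union> {p}) (X \<union> {x}) ?f \<phi>')"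
      if i: "i \<in> I" for i
    proof -
      obtain \<phi>' where \<phi>': "R i (Fin (X \<union> {x})) \<phi>' \<phi>"
        using R_lift[OF i _ \<phi>] X by blast
      let ?c' = "colour (sp (M i)) (X \<union> {x}) x \<phi>'"
      have c': "R i Sec ?c' ?c" using R_Ch[OF i \<phi>'] X by auto
      have u': "R i (Fin ({p} \<union> {q})) (un (M i) ?c') ?u" using R_unit[OF i X \<phi>'] by (simp add: insert_commute)
      have "R i Sec (dual_colour (sp (M i)) ({p} \<union> {q}) q (un (M i) ?c')) (dual_colour A ({p} \<union> {q}) q ?u)"
        using R_Ch[OF i u'] by simp
      then show ?thesis
        using \<phi>' u' c' unit_right[OF modop_unit[OF M[OF i]] X R_mem[OF i \<phi>']] by blast
    qed
    have "?c = dual_colour A ({p} \<union> {q}) q ?u"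
    proof (rule R_sep)
      show "?c \<in> colours A" by (rule c)
      show "dual_colour A ({p} \<union> {q}) q ?u \<in> colours A" by (rule colour_mem) (use u A in auto)
      fix i assume i: "i \<in> I"
      from *[OF i] obtain \<phi>' u' where "R i Sec (colour (sp (M i)) (X \<union> {x}) x \<phi>') ?c"
        "R i Sec (dual_colour (sp (M i)) ({p} \<union> {q}) q u') (dual_colour A ({p} \<union> {q}) q ?u)"
        "ml (M i) X x {p} q \<phi>' u' \<noteq> None" by blast
      then show "\<exists>a'. R i Sec a' ?c \<and> R i Sec a' (dual_colour A ({p} \<union> {q}) q ?u)"
        unfolding mul_dom[OF modop_mul[OF M[OF i]]] by metis
    qed simp
    \<comment> \<open>Here \<open>p \<noteq> q\<close> enters: the index \<open>q\<close> must lie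
      outside the remaining index set \<open>{p}\<close>.\<close>
    then have "mul X x {p} q \<phi> ?u \<noteq> None"
      unfolding dom_mul using X \<phi> u pq by simp
    then obtain \<chi> where \<chi>: "mul X x {p} q \<phi> ?u = Some \<chi>" by blast
    have "\<chi> = ?r"
    proof (rule R_sep)
      show "Fin (X \<union> {p}) \<in> Obj B_cat" using X by simp
      show "\<chi> \<in> elems A (X \<union> {p})" by (rule mem_mul[OF \<chi>])
      show "?r \<in> elems A (X \<union> {p})" by (rule relabel_mem[OF A _ _ f \<phi>]) (use X in auto)
      fix i assume i: "i \<in> I"
      from *[OF i] obtain \<phi>' u' where 1: "R i (Fin (X \<union> {x})) \<phi>' \<phi>" "R i (Fin ({p} \<union> {q})) u' ?u"
        "ml (M i) X x {p} q \<phi>' u' = Some (relabel (sp (M i)) (X \<union> {p}) (X \<union> {x}) ?f \<phi>')" by blast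
      obtain \<chi>' where "ml (M i) X x {p} q \<phi>' u' = Some \<chi>'" "R i (Fin (X \<union> {p})) \<chi>' \<chi>"
        using R_mul[OF i 1(1,2) \<chi>] by blast
      moreover have "R i (Fin (X \<union> {p})) (relabel (sp (M i)) (X \<union> {p}) (X \<union> {x}) ?f \<phi>') ?r"
        by (rule R_relabel[OF i 1(1) _ _ f]) (use X in auto)
      ultimately show "\<exists>a'. R i (Fin (X \<union> {p})) a' \<chi> \<and> R i (Fin (X \<union> {p})) a' ?r"
        using 1(3) by auto
    qed
    with \<chi> show ?thesis by simp
  qed
  then show ?thesis
    \<comment> \<open>Commutativity turns the two unit laws into one.\<close>
    unfolding is_unit_for_def Let_def mul_comm[OF multiplication, of _ _ "{p}" q]
    using \<epsilon>_PiE by simp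
qed

text \<open>The axioms are asserted only where both sides are defined, so all intermediate values
  exist in \<open>A\<close>. Lifts of the inputs are chosen once; lifts of the intermediate values
  are produced by the operations of \<open>M i\<close>, whose definedness is part of
  \<open>R_mul\<close> and \<open>R_con\<close>. Both sides are thus evaluated in \<open>M i\<close>
  on the same inputs, where the axiom holds.\<close>

theorem modular_operad: "modular_operad p q (A, mul, con, \<epsilon>)"
  unfolding modular_operad_def prod.case
proof (intro conjI allI A multiplication contraction is_unit agreeI)
  fix X1 X2 X3 w x y z \<phi>1 \<phi>2 \<phi>3 l r
  assume "Option.bind (mul X1 w (X2 \<union> {y}) x \<phi>1 \<phi>2) (\<lambda>a. mul (X1 \<union> X2) y X3 z a \<phi>3) = Some l"
    and "Option.bind (mul (X2 \<union> {x}) y X3 z \<phi>2 \<phi>3) (\<lambda>b. mul X1 w (X2 \<union> X3) x \<phi>1 b) = Some r"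
  then obtain a b where a: "mul X1 w (X2 \<union> {y}) x \<phi>1 \<phi>2 = Some a" and l: "mul (X1 \<union> X2) y X3 z a \<phi>3 = Some l"
    and b: "mul (X2 \<union> {x}) y X3 z \<phi>2 \<phi>3 = Some b" and r: "mul X1 w (X2 \<union> X3) x \<phi>1 b = Some r"
    by (elim bind_eq_SomeE)
  have d: "finite X1" "finite X2" "finite X3" "\<phi>1 \<in> elems A (X1 \<union> {w})"
    "\<phi>2 \<in> elems A (X2 \<union> {x} \<union> {y})" "\<phi>3 \<in> elems A (X3 \<union> {z})"
    using dom_mul[of X1 w "X2 \<union> {y}" x \<phi>1 \<phi>2] a dom_mul[of "X2 \<union> {x}" y X3 z \<phi>2 \<phi>3] b by auto
  show "l = r"
  proof (rule R_sep)
    show "Fin (X1 \<union> X2 \<union> X3) \<in> Obj B_cat" using d by simp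
    show "l \<in> elems A (X1 \<union> X2 \<union> X3)" "r \<in> elems A (X1 \<union> X2 \<union> X3)"
      using mem_mul[OF l] mem_mul[OF r] by (auto simp: Un_assoc)
    fix i assume i: "i \<in> I"
    obtain \<phi>1' \<phi>2' \<phi>3' where \<phi>': "R i (Fin (X1 \<union> {w})) \<phi>1' \<phi>1" "R i (Fin (X2 \<union> {x} \<union> {y})) \<phi>2' \<phi>2"
      "R i (Fin (X3 \<union> {z})) \<phi>3' \<phi>3"
      using R_lift[OF i _ d(4)] R_lift[OF i _ d(5)] R_lift[OF i _ d(6)] d(1-3)
      by (metis finite.emptyI finite_Un finite_insert)
    obtain a' where a': "ml (M i) X1 w (X2 \<union> {y}) x \<phi>1' \<phi>2' = Some a'" "R i (Fin (X1 \<union> X2 \<union> {y})) a' a"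
      by (rule R_mulE[OF i \<phi>'(1,2) a, where W = "X1 \<union> X2 \<union> {y}"]) auto
    obtain l' where l': "ml (M i) (X1 \<union> X2) y X3 z a' \<phi>3' = Some l'" "R i (Fin (X1 \<union> X2 \<union> X3)) l' l"
      by (rule R_mulE[OF i a'(2) \<phi>'(3) l, where W = "X1 \<union> X2 \<union> X3"]) auto
    obtain b' where b': "ml (M i) (X2 \<union> {x}) y X3 z \<phi>2' \<phi>3' = Some b'" "R i (Fin (X2 \<union> X3 \<union> {x})) b' b"
      by (rule R_mulE[OF i \<phi>'(2,3) b, where W = "X2 \<union> X3 \<union> {x}"]) auto
    obtain r' where r': "ml (M i) X1 w (X2 \<union> X3) x \<phi>1' b' = Some r'" "R i (Fin (X1 \<union> X2 \<union> X3)) r' r"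
      by (rule R_mulE[OF i \<phi>'(1) b'(2) r, where W = "X1 \<union> X2 \<union> X3"]) auto
    have "l' = r'" by (rule modop_M1[OF M[OF i] a'(1) l'(1) b'(1) r'(1)])
    then show "\<exists>a'. R i (Fin (X1 \<union> X2 \<union> X3)) a' l \<and> R i (Fin (X1 \<union> X2 \<union> X3)) a' r"
      using l' r' by auto
  qed
next
  fix X w x y z \<phi> l r
  assume "Option.bind (con (X \<union> {w, x}) y z \<phi>) (con X w x) = Some l"
    and "Option.bind (con (X \<union> {y, z}) w x \<phi>) (con X y z) = Some r"
  then obtain a b where a: "con (X \<union> {w, x}) y z \<phi> = Some a" and l: "con X w x a = Some l"
    and b: "con (X \<union> {y, z}) w x \<phi> = Some b" and r: "con X y z b = Some r"
    by (elim bind_eq_SomeE)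
  have d: "finite X" "\<phi> \<in> elems A (X \<union> {w, x} \<union> {y, z})"
    using dom_con[of "X \<union> {w, x}" y z \<phi>] a by auto
  show "l = r"
  proof (rule R_sep)
    show "Fin X \<in> Obj B_cat" using d by simp
    show "l \<in> elems A X" "r \<in> elems A X"
      using mem_con[OF l] mem_con[OF r] by auto
    fix i assume i: "i \<in> I"
    obtain \<phi>' where \<phi>': "R i (Fin (X \<union> {w, x} \<union> {y, z})) \<phi>' \<phi>"
      using R_lift[OF i _ d(2)] d(1) by blast
    obtain a' where a': "cn (M i) (X \<union> {w, x}) y z \<phi>' = Some a'" "R i (Fin (X \<union> {w, x})) a' a"
      by (rule R_conE[OF i \<phi>' a]) auto
    obtain l' where l': "cn (M i) X w x a' = Some l'" "R i (Fin X) l' l"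
      by (rule R_conE[OF i a'(2) l]) auto
    obtain b' where b': "cn (M i) (X \<union> {y, z}) w x \<phi>' = Some b'" "R i (Fin (X \<union> {y, z})) b' b"
      by (rule R_conE[OF i \<phi>' b]) auto
    obtain r' where r': "cn (M i) X y z b' = Some r'" "R i (Fin X) r' r"
      by (rule R_conE[OF i b'(2) r]) auto
    have "l' = r'" by (rule modop_M2[OF M[OF i] a'(1) l'(1) b'(1) r'(1)])
    then show "\<exists>a'. R i (Fin X) a' l \<and> R i (Fin X) a' r"
      using l' r' by auto
  qed
next
  fix X1 X2 w x y z \<phi> \<psi> l r
  assume "Option.bind (con (X1 \<union> {y}) w x \<phi>) (\<lambda>a. mul X1 y X2 z a \<psi>) = Some l"
    and "Option.bind (mul (X1 \<union> {w, x}) y X2 z \<phi> \<psi>) (con (X1 \<union> X2) w x) = Some r"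
  then obtain a b where a: "con (X1 \<union> {y}) w x \<phi> = Some a" and l: "mul X1 y X2 z a \<psi> = Some l"
    and b: "mul (X1 \<union> {w, x}) y X2 z \<phi> \<psi> = Some b" and r: "con (X1 \<union> X2) w x b = Some r"
    by (elim bind_eq_SomeE)
  have d: "finite X1" "finite X2" "\<phi> \<in> elems A (X1 \<union> {w, x} \<union> {y})" "\<psi> \<in> elems A (X2 \<union> {z})"
    using dom_mul[of "X1 \<union> {w, x}" y X2 z \<phi> \<psi>] b by auto
  show "l = r"
  proof (rule R_sep)
    show "Fin (X1 \<union> X2) \<in> Obj B_cat" using d by simp
    show "l \<in> elems A (X1 \<union> X2)" "r \<in> elems A (X1 \<union> X2)"
      using mem_mul[OF l] mem_con[OF r] by auto
    fix i assume i: "i \<in> I"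
    obtain \<phi>' \<psi>' where \<phi>': "R i (Fin (X1 \<union> {w, x} \<union> {y})) \<phi>' \<phi>" and \<psi>': "R i (Fin (X2 \<union> {z})) \<psi>' \<psi>"
      using R_lift[OF i _ d(3)] R_lift[OF i _ d(4)] d(1,2)
      by (metis finite.emptyI finite_Un finite_insert)
    obtain a' where a': "cn (M i) (X1 \<union> {y}) w x \<phi>' = Some a'" "R i (Fin (X1 \<union> {y})) a' a"
      by (rule R_conE[OF i \<phi>' a]) auto
    obtain l' where l': "ml (M i) X1 y X2 z a' \<psi>' = Some l'" "R i (Fin (X1 \<union> X2)) l' l"
      by (rule R_mulE[OF i a'(2) \<psi>' l, where W = "X1 \<union> X2"]) auto
    obtain b' where b': "ml (M i) (X1 \<union> {w, x}) y X2 z \<phi>' \<psi>' = Some b'" "R i (Fin (X1 \<union> X2 \<union> {w, x})) b' b"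
      by (rule R_mulE[OF i \<phi>' \<psi>' b, where W = "X1 \<union> X2 \<union> {w, x}"]) auto
    obtain r' where r': "cn (M i) (X1 \<union> X2) w x b' = Some r'" "R i (Fin (X1 \<union> X2)) r' r"
      by (rule R_conE[OF i b'(2) r]) auto
    have "l' = r'" by (rule modop_M3[OF M[OF i] a'(1) l'(1) b'(1) r'(1)])
    then show "\<exists>a'. R i (Fin (X1 \<union> X2)) a' l \<and> R i (Fin (X1 \<union> X2)) a' r"
      using l' r' by auto
  qed
next
  fix X1 X2 w x y z \<phi> \<psi> l r
  assume "Option.bind (mul (X1 \<union> {y}) w (X2 \<union> {z}) x \<phi> \<psi>) (con (X1 \<union> X2) y z) = Some l"
    and "Option.bind (mul (X1 \<union> {w}) y (X2 \<union> {x}) z \<phi> \<psi>) (con (X1 \<union> X2) w x) = Some r"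
  then obtain a b where a: "mul (X1 \<union> {y}) w (X2 \<union> {z}) x \<phi> \<psi> = Some a" and l: "con (X1 \<union> X2) y z a = Some l"
    and b: "mul (X1 \<union> {w}) y (X2 \<union> {x}) z \<phi> \<psi> = Some b" and r: "con (X1 \<union> X2) w x b = Some r"
    by (elim bind_eq_SomeE)
  have d: "finite X1" "finite X2" "\<phi> \<in> elems A (X1 \<union> {w} \<union> {y})" "\<psi> \<in> elems A (X2 \<union> {x} \<union> {z})"
    using dom_mul[of "X1 \<union> {w}" y "X2 \<union> {x}" z \<phi> \<psi>] b by auto
  show "l = r"
  proof (rule R_sep)
    show "Fin (X1 \<union> X2) \<in> Obj B_cat" using d by simp
    show "l \<in> elems A (X1 \<union> X2)" "r \<in> elems A (X1 \<union> X2)"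
      using mem_con[OF l] mem_con[OF r] by auto
    fix i assume i: "i \<in> I"
    obtain \<phi>' \<psi>' where \<phi>': "R i (Fin (X1 \<union> {w} \<union> {y})) \<phi>' \<phi>" and \<psi>': "R i (Fin (X2 \<union> {x} \<union> {z})) \<psi>' \<psi>"
      using R_lift[OF i _ d(3)] R_lift[OF i _ d(4)] d(1,2)
      by (metis finite.emptyI finite_Un finite_insert)
    obtain a' where a': "ml (M i) (X1 \<union> {y}) w (X2 \<union> {z}) x \<phi>' \<psi>' = Some a'" "R i (Fin (X1 \<union> X2 \<union> {y, z})) a' a"
      by (rule R_mulE[OF i \<phi>' \<psi>' a, where W = "X1 \<union> X2 \<union> {y, z}"]) auto
    obtain l' where l': "cn (M i) (X1 \<union> X2) y z a' = Some l'" "R i (Fin (X1 \<union> X2)) l' l"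
      by (rule R_conE[OF i a'(2) l]) auto
    obtain b' where b': "ml (M i) (X1 \<union> {w}) y (X2 \<union> {x}) z \<phi>' \<psi>' = Some b'" "R i (Fin (X1 \<union> X2 \<union> {w, x})) b' b"
      by (rule R_mulE[OF i \<phi>' \<psi>' b, where W = "X1 \<union> X2 \<union> {w, x}"]) auto
    obtain r' where r': "cn (M i) (X1 \<union> X2) w x b' = Some r'" "R i (Fin (X1 \<union> X2)) r' r"
      by (rule R_conE[OF i b'(2) r]) auto
    have "l' = r'" by (rule modop_M4[OF M[OF i] a'(1) l'(1) b'(1) r'(1)])
    then show "\<exists>a'. R i (Fin (X1 \<union> X2)) a' l \<and> R i (Fin (X1 \<union> X2)) a' r"
      using l' r' by auto
  qed
qed

end

section \<open>Cardinality of closures\<close>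

unbundle cardinal_syntax

lemma card_of_Times_le: "infinite K \<Longrightarrow> |A| \<le>o |K| \<Longrightarrow> |B| \<le>o |K| \<Longrightarrow> |A \<times> B| \<le>o |K|"
  by (rule card_of_Times_ordLeq_infinite_Field[OF _ _ _ card_of_Card_order]) (simp_all add: Field_card_of)

lemma card_of_Un_le: "infinite K \<Longrightarrow> |A| \<le>o |K| \<Longrightarrow> |B| \<le>o |K| \<Longrightarrow> |A \<union> B| \<le>o |K|"
  by (rule card_of_Un_ordLeq_infinite_Field[OF _ _ _ card_of_Card_order]) (simp_all add: Field_card_of)

lemma card_of_image_le: "|A| \<le>o |K| \<Longrightarrow> |f ` A| \<le>o |K|"
  using card_of_image ordLeq_transitive by blast

text \<open>The closure is the union of countably many stages, each of size at most \<open>K\<close>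
  because \<open>K\<close> is infinite. A single family of binary operations covers all arities up
  to two: an operation of lower arity ignores arguments, and \<open>b\<close> supplies values for
  them.\<close>

lemma small_closure:
  fixes f :: "'d \<Rightarrow> 'h \<Rightarrow> 'h \<Rightarrow> 'h"
  assumes inf: "infinite K" and D: "|D| \<le>o |K|"
  obtains C where "|C| \<le>o |K|" "b \<in> C" "\<And>d h k. d \<in> D \<Longrightarrow> h \<in> C \<Longrightarrow> k \<in> C \<Longrightarrow> f d h k \<in> C"
proof
  define C where "C = rec_nat {b} (\<lambda>_ C. C \<union> (\<lambda>(d, h, k). f d h k) ` (D \<times> C \<times> C))"
  have C_simps: "C 0 = {b}" "\<And>n. C (Suc n) = C n \<union> (\<lambda>(d, h, k). f d h k) ` (D \<times> C n \<times> C n)"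
    by (simp_all add: C_def)
  have "|C n| \<le>o |K|" for n
  proof (induction n)
    case 0
    show ?case using inf by (simp add: C_simps card_of_singl_ordLeq infinite_imp_nonempty)
  next
    case (Suc n)
    have "|D \<times> C n \<times> C n| \<le>o |K|"
      by (intro card_of_Times_le inf D Suc)
    then show ?case
      unfolding C_simps
      by (intro card_of_Un_le inf Suc card_of_image_le)
  qed
  then show "|\<Union>n. C n| \<le>o |K|"
    using inf by (intro card_of_UNION_ordLeq_infinite ballI) (simp_all add: infinite_iff_card_of_nat)
  show "b \<in> (\<Union>n. C n)" using C_simps(1) by blast
  have mono: "C m \<subseteq> C n" if "m \<le> n" for m n
    using that by (rule lift_Suc_mono_le[rotated]) (simp add: C_simps)
  fix d h k assume d: "d \<in> D" and "h \<in> (\<Union>n. C n)" "k \<in> (\<Union>n. C n)"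
  then obtain m n where "h \<in> C m" "k \<in> C n" by blast
  then have "h \<in> C (max m n)" "k \<in> C (max m n)" using mono[of _ "max m n"] by (meson max.cobounded1 max.cobounded2 subsetD)+
  then have "f d h k \<in> C (Suc (max m n))" using d unfolding C_simps by force
  then show "f d h k \<in> (\<Union>n. C n)" by blast
qed

text \<open>Lists are the closure of \<open>[]\<close> under unary operations, one for each element
  that can be put in front.\<close>

lemma small_lists:
  assumes "infinite (UNIV :: 'u set)"
  shows "|UNIV :: 'u list set| \<le>o |UNIV :: 'u set|"
proof -
  obtain C :: "'u list set" where C: "|C| \<le>o |UNIV :: 'u set|" "[] \<in> C" "\<And>x h k. x \<in> UNIV \<Longrightarrow> h \<in> C \<Longrightarrow> k \<in> C \<Longrightarrow> x # h \<in> C"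
    by (rule small_closure[OF assms card_of_mono1[OF subset_UNIV], where b = "[]" and f = "\<lambda>x h _. x # h"]) (rule that)
  have "xs \<in> C" for xs by (induction xs) (use C in auto)
  then have "C = UNIV" by blast
  with C show ?thesis by simp
qed

lemma small_finite_sets:
  assumes "infinite (UNIV :: 'u set)"
  shows "|{X :: 'u set. finite X}| \<le>o |UNIV :: 'u set|"
proof -
  have "{X :: 'u set. finite X} = range set" using finite_list by blast
  then show ?thesis using card_of_image small_lists[OF assms] ordLeq_transitive by metis
qed

lemma small_B_obj:
  assumes "infinite (UNIV :: 'u set)"
  shows "|Obj (B_cat :: ('u bobj, 'u bmor) cat)| \<le>o |UNIV :: 'u set|"
proof -
  have "Obj B_cat = {Sec} \<union> Fin ` {X :: 'u set. finite X}" by (auto simp: B_cat_def)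
  then show ?thesis
    using assms small_finite_sets[OF assms]
    by (auto intro!: card_of_Un_le intro: card_of_image_le card_of_singl_ordLeq
        simp del: Un_insert_left insert_is_Un)
qed

lemma small_B_arr:
  assumes inf: "infinite (UNIV :: 'u set)"
  shows "|Arr (B_cat :: ('u bobj, 'u bmor) cat)| \<le>o |UNIV :: 'u set|"
proof -
  let ?S = "range SecMor :: 'u bmor set"
  let ?C = "(\<lambda>(X, x, b). Ch X x b) ` ({X :: 'u set. finite X} \<times> UNIV \<times> UNIV)"
  \<comment> \<open>A bijection is coded by a list of the elements of its source and the list of
    their images. There are too many functions on the universe to count them directly, but an
    extensional one on a finite set is determined by this finite table.\<close>
  let ?B = "(\<lambda>(xs, ys). Bij (set xs) (set ys) (\<lambda>x\<in>set xs. the (map_of (zip xs ys) x))) `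
    (UNIV \<times> UNIV :: ('u list \<times> 'u list) set)"
  have Bool: "|UNIV :: bool set| \<le>o |UNIV :: 'u set|"
  proof -
    have "|UNIV :: bool set| \<le>o |UNIV :: nat set|"
      unfolding card_of_ordLeq[symmetric] by (intro exI[of _ of_bool]) (auto simp: inj_def)
    with inf show ?thesis using ordLeq_transitive unfolding infinite_iff_card_of_nat by blast
  qed
  have "Bij X Y f \<in> ?B" if "finite X" "finite Y" "f \<in> extensional X" "bij_betw f X Y" for X Y f
  proof -
    obtain xs where xs: "set xs = X" "distinct xs" using \<open>finite X\<close> finite_distinct_list by blast
    have "f = (\<lambda>x\<in>set xs. the (map_of (zip xs (map f xs)) x))"
      using \<open>f \<in> extensional X\<close> xs by (intro extensionalityI[of f X]) (auto simp: map_of_zip_map)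
    moreover have "set (map f xs) = Y" using that xs by (auto simp: bij_betw_def)
    ultimately show ?thesis
      using xs by (intro image_eqI[of _ _ "(xs, map f xs)"]) auto
  qed
  note B = this
  have "m \<in> ?S \<union> ?C \<union> ?B" if "m \<in> Arr B_cat" for m
    using that
  proof (cases rule: B_arrE)
    case (Ch X x b)
    then have "m \<in> ?C" by (intro image_eqI[of _ _ "(X, x, b)"]) auto
    then show ?thesis by blast
  next
    case (Bij X Y f)
    then show ?thesis using B by blast
  qed blast
  then have "Arr B_cat \<subseteq> ?S \<union> ?C \<union> ?B" by blast
  moreover have "|?S \<union> ?C \<union> ?B| \<le>o |UNIV :: 'u set|"
    by (intro card_of_Un_le inf card_of_image_le
        card_of_Times_le Bool small_finite_sets small_lists card_of_mono1 subset_UNIV)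
  ultimately show ?thesis using card_of_mono1 ordLeq_transitive by blast
qed

section \<open>Free modular operads\<close>

lemma modop_mor_iff:
  "modular_operad_mor p q M N f \<longleftrightarrow> f \<in> Hom GS (sp M) (sp N) \<and>
     (\<forall>X x Y y \<phi> \<psi> \<chi>. ml M X x Y y \<phi> \<psi> = Some \<chi> \<longrightarrow>
        ml N X x Y y (app f (Fin (X \<union> {x})) \<phi>) (app f (Fin (Y \<union> {y})) \<psi>) = Some (app f (Fin (X \<union> Y)) \<chi>)) \<and>
     (\<forall>X x y \<phi> \<chi>. cn M X x y \<phi> = Some \<chi> \<longrightarrow>
        cn N X x y (app f (Fin (X \<union> {x, y})) \<phi>) = Some (app f (Fin X) \<chi>)) \<and>
     (\<forall>c\<in>colours (sp M). app f (Fin {p, q}) (un M c) = un N (app f Sec c))"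
  by (cases M; cases N) (simp add: modular_operad_mor_def)

lemma
  assumes "modular_operad_mor p q M N f"
  shows mor_Hom: "f \<in> Hom GS (sp M) (sp N)"
    and mor_mul: "ml M X x Y y \<phi> \<psi> = Some \<chi> \<Longrightarrow>
        ml N X x Y y (app f (Fin (X \<union> {x})) \<phi>) (app f (Fin (Y \<union> {y})) \<psi>) = Some (app f (Fin (X \<union> Y)) \<chi>)"
    and mor_con: "cn M X x y \<phi> = Some \<chi> \<Longrightarrow>
        cn N X x y (app f (Fin (X \<union> {x, y})) \<phi>) = Some (app f (Fin X) \<chi>)"
    and mor_unit: "c \<in> colours (sp M) \<Longrightarrow> app f (Fin {p, q}) (un M c) = un N (app f Sec c)"
  using assms unfolding modop_mor_iff by blast+

text \<open>Symbols for a single application of a generating rule, not terms: \<open>Gen\<close> is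
  nullary, \<open>Mul\<close> binary, the others unary. They serve only to count the
  operations.\<close>

datatype 'u opn = Gen "'u bobj" 'u | Act "'u bmor" | Mul "'u set" 'u "'u set" 'u | Con "'u set" 'u 'u | Unit

text \<open>The index sets of \<open>Mul\<close> and \<open>Con\<close> are restricted to finite
  ones because the universe has more subsets than elements. For the same reason \<open>Act\<close>
  and \<open>Gen\<close> range over arrows and objects of \<open>B_cat\<close> only.\<close>

lemma small_opn:
  assumes inf: "infinite (UNIV :: 'u set)"
  shows "|{Gen b x | b x. b \<in> Obj B_cat} \<union> Act ` Arr B_cat \<union>
    {Mul X x Y y | X x Y y. finite X \<and> finite Y} \<union> {Con X x y | X x y. finite X} \<union> {Unit :: 'u opn}|
    \<le>o |UNIV :: 'u set|"
    (is "|?G \<union> ?A \<union> ?M \<union> ?C \<union> _| \<le>o _")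
proof -
  let ?f = "{X :: 'u set. finite X}" and ?U = "UNIV :: 'u set"
  have "?G = (\<lambda>(b, x). Gen b x) ` (Obj B_cat \<times> ?U)" by force
  moreover have "?M = (\<lambda>(X, x, Y, y). Mul X x Y y) ` (?f \<times> ?U \<times> ?f \<times> ?U)"
    by (simp add: set_eq_iff image_iff) blast
  moreover have "?C = (\<lambda>(X, x, y). Con X x y) ` (?f \<times> ?U \<times> ?U)"
    by (simp add: set_eq_iff image_iff) blast
  ultimately show ?thesis
    by (simp only:) (intro card_of_Un_le inf card_of_image_le card_of_Times_le small_finite_sets
        small_B_obj small_B_arr card_of_mono1 subset_UNIV card_of_singl_ordLeq UNIV_not_empty)
qed

locale free_modop =
  fixes p q :: 'u and S :: "'u species"
  assumes inf: "infinite (UNIV :: 'u set)" and pq: "p \<noteq> q" and S: "S \<in> Obj GS"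
begin

text \<open>The map is part of the index, so that a modular operad occurs once for every map from
  \<open>S\<close> into it. The definition is impredicative: the pair of \<open>M\<close> and \<eta>
  constructed below is again an element.\<close>

definition I :: "('u modop \<times> 'u species_mor) set" where
  "I = {(M, f). modular_operad p q M \<and> f \<in> Hom GS S (sp M)}"

text \<open>An element of the product is a family over \<open>I\<close>. The rules for partial
  operations ask that the result be defined in every factor. The conditions on the index sets are
  separate premises because definedness in every factor implies them only if there is a
  factor.\<close>

inductive G :: "'u bobj \<Rightarrow> ('u modop \<times> 'u species_mor \<Rightarrow> 'u) \<Rightarrow> bool" where
  gen: "b \<in> Obj B_cat \<Longrightarrow> x \<in> fobj S b \<Longrightarrow> G b (\<lambda>i\<in>I. app (snd i) b x)"
| act: "m \<in> Arr B_cat \<Longrightarrow> G (bcod m) h \<Longrightarrow> G (bdom m) (\<lambda>i\<in>I. act (sp (fst i)) m (h i))"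
| mul: "finite X \<Longrightarrow> finite Y \<Longrightarrow> X \<inter> Y = {} \<Longrightarrow> x \<notin> X \<Longrightarrow> y \<notin> Y \<Longrightarrow> G (Fin (X \<union> {x})) h \<Longrightarrow> G (Fin (Y \<union> {y})) k \<Longrightarrow>
    (\<And>i. i \<in> I \<Longrightarrow> ml (fst i) X x Y y (h i) (k i) \<noteq> None) \<Longrightarrow>
    G (Fin (X \<union> Y)) (\<lambda>i\<in>I. the (ml (fst i) X x Y y (h i) (k i)))"
| con: "finite X \<Longrightarrow> x \<notin> X \<Longrightarrow> y \<notin> X \<Longrightarrow> x \<noteq> y \<Longrightarrow> G (Fin (X \<union> {x, y})) h \<Longrightarrow> (\<And>i. i \<in> I \<Longrightarrow> cn (fst i) X x y (h i) \<noteq> None) \<Longrightarrow>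
    G (Fin X) (\<lambda>i\<in>I. the (cn (fst i) X x y (h i)))"
| unit: "G Sec h \<Longrightarrow> G (Fin {p, q}) (\<lambda>i\<in>I. un (fst i) (h i))"

lemma I_D:
  assumes "i \<in> I"
  shows "modular_operad p q (fst i)" "snd i \<in> Hom GS S (sp (fst i))"
  using assms by (auto simp: I_def)

lemmas I_GS = modop_GS[OF I_D(1)] and I_mul = modop_mul[OF I_D(1)] and I_con = modop_con[OF I_D(1)]
  and I_unit = modop_unit[OF I_D(1)]

lemma G_obj: "G b h \<Longrightarrow> b \<in> Obj B_cat"
  by (induction rule: G.induct) auto

lemma G_ext: "G b h \<Longrightarrow> h \<in> extensional I"
  by (induction rule: G.induct) (rule restrict_extensional)+

lemma G_mem: "G b h \<Longrightarrow> i \<in> I \<Longrightarrow> h i \<in> fobj (sp (fst i)) b"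
proof (induction rule: G.induct)
  case (gen b x)
  then show ?case using app_mem[OF I_D(2)] by simp
next
  case (act m h)
  then show ?case using I_GS by simp
next
  case (mul X Y x y h k)
  then obtain c where "ml (fst i) X x Y y (h i) (k i) = Some c" by blast
  then show ?case using mul_mem[OF I_mul] mul by simp
next
  case (con X x y h)
  then obtain c where "cn (fst i) X x y (h i) = Some c" by blast
  then show ?case using con_mem[OF I_con] con by simp
next
  case (unit h)
  then show ?case using unit_mem[OF I_unit] by simp
qed

lemma G_eqI: "G b h \<Longrightarrow> G b k \<Longrightarrow> (\<And>i. i \<in> I \<Longrightarrow> h i = k i) \<Longrightarrow> h = k"
  using G_ext extensionalityI by metis

text \<open>A total version of the rules of \<open>G\<close>: \<open>the\<close> returns an
  arbitrary value where a partial operation is undefined. This can only enlarge the closure, so a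
  bound on its size is still a bound for \<open>G\<close>.\<close>

fun opn :: "'u opn \<Rightarrow> ('u modop \<times> 'u species_mor \<Rightarrow> 'u) \<Rightarrow> ('u modop \<times> 'u species_mor \<Rightarrow> 'u)
    \<Rightarrow> 'u modop \<times> 'u species_mor \<Rightarrow> 'u" where
  "opn (Gen b x) h k = (\<lambda>i\<in>I. app (snd i) b x)"
| "opn (Act m) h k = (\<lambda>i\<in>I. act (sp (fst i)) m (h i))"
| "opn (Mul X x Y y) h k = (\<lambda>i\<in>I. the (ml (fst i) X x Y y (h i) (k i)))"
| "opn (Con X x y) h k = (\<lambda>i\<in>I. the (cn (fst i) X x y (h i)))"
| "opn Unit h k = (\<lambda>i\<in>I. un (fst i) (h i))"

lemma G_small: "|{h. \<exists>b. G b h}| \<le>o |UNIV :: 'u set|"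
proof -
  \<comment> \<open>The closure starts from \<open>undefined\<close>, which stands in for the
    arguments that \<open>Gen\<close> and the unary operations ignore.\<close>
  obtain C where C: "|C| \<le>o |UNIV :: 'u set|" "undefined \<in> C"
    and cl: "\<And>d h k. d \<in> {Gen b x | b x. b \<in> Obj B_cat} \<union> Act ` Arr B_cat \<union>
    {Mul X x Y y | X x Y y. finite X \<and> finite Y} \<union> {Con X x y | X x y. finite X} \<union> {Unit} \<Longrightarrow>
      h \<in> C \<Longrightarrow> k \<in> C \<Longrightarrow> opn d h k \<in> C"
    by (rule small_closure[OF inf small_opn[OF inf], where f = opn]) (rule that)
  have "h \<in> C" if "G b h" for b h
    using that
  proof (induction rule: G.induct)
    case (gen b x)
    then show ?case using cl[of "Gen b x" undefined undefined, unfolded opn.simps] C by blast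
  next
    case (act m h)
    then show ?case using cl[of "Act m" h undefined, unfolded opn.simps] C by blast
  next
    case (mul X Y x y h k)
    then show ?case using cl[of "Mul X x Y y" h k, unfolded opn.simps] by blast
  next
    case (con X x y h)
    then show ?case using cl[of "Con X x y" h undefined, unfolded opn.simps] C by blast
  next
    case (unit h)
    then show ?case using cl[of Unit h undefined, unfolded opn.simps] C by blast
  qed
  then have "{h. \<exists>b. G b h} \<subseteq> C" by blast
  with C show ?thesis using card_of_mono1 ordLeq_transitive by blast
qed

text \<open>
  By \<open>G_small\<close> the set in the next definition is not larger than the universe, so the choice is from a
  nonempty set.
\<close>

definition enc :: "('u modop \<times> 'u species_mor \<Rightarrow> 'u) \<Rightarrow> 'u" where
  "enc = (SOME e. inj_on e {h. \<exists>b. G b h})"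

definition dec :: "'u \<Rightarrow> 'u modop \<times> 'u species_mor \<Rightarrow> 'u" where
  "dec = inv_into {h. \<exists>b. G b h} enc"

text \<open>One injection codes the families of all sorts, so that \<open>dec\<close> needs no sort.
  Carriers at different sorts may overlap, which is harmless for a presheaf.\<close>

definition car :: "'u bobj \<Rightarrow> 'u set" where "car b = enc ` {h. G b h}"

lemma dec_enc [simp]: "G b h \<Longrightarrow> dec (enc h) = h"
proof -
  have "\<exists>e :: _ \<Rightarrow> 'u. inj_on e {h. \<exists>b. G b h}"
    using G_small unfolding card_of_ordLeq[symmetric] by blast
  then have "inj_on enc {h. \<exists>b. G b h}" unfolding enc_def by (rule someI_ex)
  then show "G b h \<Longrightarrow> dec (enc h) = h" unfolding dec_def by (intro inv_into_f_f) auto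
qed

lemma enc_mem: "G b h \<Longrightarrow> enc h \<in> car b"
  by (simp add: car_def)

lemma carD: "a \<in> car b \<Longrightarrow> G b (dec a)" "a \<in> car b \<Longrightarrow> enc (dec a) = a"
  by (auto simp: car_def)

lemma car_obj: "a \<in> car b \<Longrightarrow> b \<in> Obj B_cat"
  using G_obj carD(1) by blast

lemma dec_mem: "a \<in> car b \<Longrightarrow> i \<in> I \<Longrightarrow> dec a i \<in> fobj (sp (fst i)) b"
  using G_mem carD(1) by blast

lemma car_eqI: "a \<in> car b \<Longrightarrow> a' \<in> car b \<Longrightarrow> (\<And>i. i \<in> I \<Longrightarrow> dec a i = dec a' i) \<Longrightarrow> a = a'"
  using G_eqI carD by metis

section \<open>Operations on the coded families\<close>

definition F :: "'u species" where
  "F = mk_species car (\<lambda>m a. enc (\<lambda>i\<in>I. act (sp (fst i)) m (dec a i)))"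

definition mul :: "'u mult" where
  "mul X x Y y a b = (if finite X \<and> finite Y \<and> X \<inter> Y = {} \<and> x \<notin> X \<and> y \<notin> Y \<and>
      a \<in> car (Fin (X \<union> {x})) \<and> b \<in> car (Fin (Y \<union> {y})) \<and>
      (\<forall>i\<in>I. ml (fst i) X x Y y (dec a i) (dec b i) \<noteq> None)
    then Some (enc (\<lambda>i\<in>I. the (ml (fst i) X x Y y (dec a i) (dec b i)))) else None)"

definition con :: "'u contr" where
  "con X x y a = (if finite X \<and> x \<notin> X \<and> y \<notin> X \<and> x \<noteq> y \<and> a \<in> car (Fin (X \<union> {x, y})) \<and>
      (\<forall>i\<in>I. cn (fst i) X x y (dec a i) \<noteq> None)
    then Some (enc (\<lambda>i\<in>I. the (cn (fst i) X x y (dec a i)))) else None)"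

definition \<epsilon> :: "'u \<Rightarrow> 'u" where
  "\<epsilon> = (\<lambda>c\<in>car Sec. enc (\<lambda>i\<in>I. un (fst i) (dec c i)))"

definition M :: "'u modop" where "M = (F, mul, con, \<epsilon>)"

lemma fobj_F [simp]: "b \<in> Obj B_cat \<Longrightarrow> fobj F b = car b"
  by (simp add: F_def)

lemma act_F_eq:
  "m \<in> Arr B_cat \<Longrightarrow> a \<in> car (bcod m) \<Longrightarrow> act F m a = enc (\<lambda>i\<in>I. act (sp (fst i)) m (dec a i))"
  by (simp add: F_def)

lemma act_F:
  assumes "m \<in> Arr B_cat" "a \<in> car (bcod m)"
  shows "act F m a \<in> car (bdom m)" "i \<in> I \<Longrightarrow> dec (act F m a) i = act (sp (fst i)) m (dec a i)"
proof -
  have "G (bdom m) (\<lambda>i\<in>I. act (sp (fst i)) m (dec a i))"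
    by (rule G.act[OF assms(1) carD(1)[OF assms(2)]])
  then show "act F m a \<in> car (bdom m)"
    "i \<in> I \<Longrightarrow> dec (act F m a) i = act (sp (fst i)) m (dec a i)"
    by (simp_all add: enc_mem act_F_eq[OF assms])
qed

lemma F_obj: "F \<in> Obj GS"
proof -
  have mem: "enc (\<lambda>i\<in>I. act (sp (fst i)) m (dec a i)) \<in> car (bdom m)"
    if "m \<in> Arr B_cat" "a \<in> car (bcod m)" for m a
    by (rule act_F(1)[OF that, unfolded act_F_eq[OF that]])
  have dec: "dec (enc (\<lambda>i\<in>I. act (sp (fst i)) m (dec a i))) i = act (sp (fst i)) m (dec a i)"
    if "m \<in> Arr B_cat" "a \<in> car (bcod m)" "i \<in> I" for m a i
    by (rule act_F(2)[OF that, unfolded act_F_eq[OF that(1,2)]])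
  show ?thesis
    unfolding F_def
  proof (rule mk_species_obj)
    fix b a assume b: "b \<in> Obj B_cat" and a: "a \<in> car b"
    have m: "bident b \<in> Arr B_cat" "a \<in> car (bcod (bident b))" using a b by simp_all
    show "enc (\<lambda>i\<in>I. act (sp (fst i)) (bident b) (dec a i)) = a"
    proof (rule car_eqI[of _ b])
      show "enc (\<lambda>i\<in>I. act (sp (fst i)) (bident b) (dec a i)) \<in> car b" using mem[OF m] b by simp
      show "dec (enc (\<lambda>i\<in>I. act (sp (fst i)) (bident b) (dec a i))) i = dec a i" if i: "i \<in> I" for i
        unfolding dec[OF m i] by (rule act_ident[OF I_GS[OF i] b dec_mem[OF a i]])
    qed (rule a)
  next
    fix m n a assume m: "m \<in> Arr B_cat" and n: "n \<in> Arr B_cat" and mn: "bcod n = bdom m"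
      and a: "a \<in> car (bcod m)"
    let ?a = "enc (\<lambda>i\<in>I. act (sp (fst i)) m (dec a i))"
    have c: "bcomp m n \<in> Arr B_cat" "a \<in> car (bcod (bcomp m n))" "bdom (bcomp m n) = bdom n"
      using m n mn a by simp_all
    have a': "?a \<in> car (bcod n)" using mem[OF m a] mn by simp
    show "enc (\<lambda>i\<in>I. act (sp (fst i)) (bcomp m n) (dec a i)) = enc (\<lambda>i\<in>I. act (sp (fst i)) n (dec ?a i))"
    proof (rule car_eqI[of _ "bdom n"])
      show "enc (\<lambda>i\<in>I. act (sp (fst i)) (bcomp m n) (dec a i)) \<in> car (bdom n)"
        using mem[OF c(1,2)] c(3) by simp
      show "enc (\<lambda>i\<in>I. act (sp (fst i)) n (dec ?a i)) \<in> car (bdom n)" by (rule mem[OF n a'])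
      show "dec (enc (\<lambda>i\<in>I. act (sp (fst i)) (bcomp m n) (dec a i))) i =
          dec (enc (\<lambda>i\<in>I. act (sp (fst i)) n (dec ?a i))) i" if i: "i \<in> I" for i
        unfolding dec[OF c(1,2) i] dec[OF n a' i] dec[OF m a i]
        by (rule act_comp[OF I_GS[OF i] m n mn dec_mem[OF a i], symmetric])
    qed
  qed (rule mem)
qed

lemma mulD:
  assumes "mul X x Y y a b = Some c"
  shows "finite X" "finite Y" "a \<in> car (Fin (X \<union> {x}))" "b \<in> car (Fin (Y \<union> {y}))" "c \<in> car (Fin (X \<union> Y))"
    "i \<in> I \<Longrightarrow> ml (fst i) X x Y y (dec a i) (dec b i) = Some (dec c i)"
proof -
  let ?h = "\<lambda>i\<in>I. the (ml (fst i) X x Y y (dec a i) (dec b i))"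
  have *: "finite X" "finite Y" "a \<in> car (Fin (X \<union> {x}))" "b \<in> car (Fin (Y \<union> {y}))" "c = enc ?h"
    "X \<inter> Y = {}" "x \<notin> X" "y \<notin> Y" "\<forall>i\<in>I. ml (fst i) X x Y y (dec a i) (dec b i) \<noteq> None"
    using assms by (auto simp: mul_def split: if_splits)
  have "G (Fin (X \<union> Y)) ?h" by (rule G.mul) (use * carD in auto)
  with * show "finite X" "finite Y" "a \<in> car (Fin (X \<union> {x}))" "b \<in> car (Fin (Y \<union> {y}))"
    "c \<in> car (Fin (X \<union> Y))" "i \<in> I \<Longrightarrow> ml (fst i) X x Y y (dec a i) (dec b i) = Some (dec c i)"
    by (auto simp: enc_mem)
qed

lemma conD:
  assumes "con X x y a = Some c"
  shows "finite X" "a \<in> car (Fin (X \<union> {x, y}))" "c \<in> car (Fin X)"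
    "i \<in> I \<Longrightarrow> cn (fst i) X x y (dec a i) = Some (dec c i)"
proof -
  let ?h = "\<lambda>i\<in>I. the (cn (fst i) X x y (dec a i))"
  have *: "finite X" "a \<in> car (Fin (X \<union> {x, y}))" "c = enc ?h"
    "x \<notin> X" "y \<notin> X" "x \<noteq> y" "\<forall>i\<in>I. cn (fst i) X x y (dec a i) \<noteq> None"
    using assms by (auto simp: con_def split: if_splits)
  have "G (Fin X) ?h" by (rule G.con) (use * carD in auto)
  with * show "finite X" "a \<in> car (Fin (X \<union> {x, y}))"
    "c \<in> car (Fin X)" "i \<in> I \<Longrightarrow> cn (fst i) X x y (dec a i) = Some (dec c i)"
    by (auto simp: enc_mem)
qed

lemma \<epsilon>D:
  assumes "c \<in> car Sec"
  shows "\<epsilon> c \<in> car (Fin {p, q})" "i \<in> I \<Longrightarrow> dec (\<epsilon> c) i = un (fst i) (dec c i)"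
proof -
  have "G (Fin {p, q}) (\<lambda>i\<in>I. un (fst i) (dec c i))" by (rule G.unit[OF carD(1)[OF assms]])
  with assms show "\<epsilon> c \<in> car (Fin {p, q})" "i \<in> I \<Longrightarrow> dec (\<epsilon> c) i = un (fst i) (dec c i)"
    by (auto simp: \<epsilon>_def enc_mem)
qed

text \<open>Colours of \<open>F\<close> are coded families as well, so they agree if all their
  components do. This converts "defined in every factor", by which \<open>mul\<close> and
  \<open>con\<close> are declared, into the matching of colours that the axioms demand.\<close>

lemma colour_F_eq_iff:
  assumes "finite X" "x \<in> X" "a \<in> car (Fin X)" "finite Y" "y \<in> Y" "b \<in> car (Fin Y)"
  shows "colour F X x a = dual_colour F Y y b \<longleftrightarrow>
    (\<forall>i\<in>I. colour (sp (fst i)) X x (dec a i) = dual_colour (sp (fst i)) Y y (dec b i))"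
proof -
  have "colour F X x a \<in> car Sec" "dual_colour F Y y b \<in> car Sec"
    using act_F(1)[of "Ch X x False" a] act_F(1)[of "Ch Y y True" b] assms by simp_all
  then have "colour F X x a = dual_colour F Y y b \<longleftrightarrow>
      (\<forall>i\<in>I. dec (colour F X x a) i = dec (dual_colour F Y y b) i)"
    using car_eqI by metis
  then show ?thesis
    using act_F(2)[of "Ch X x False" a] act_F(2)[of "Ch Y y True" b] assms by simp
qed

text \<open>The lift of \<open>a\<close> to the factor \<open>i\<close> is its \<open>i\<close>-th
  component. Lifts are therefore unique, the operations lift because they are computed
  componentwise, and separation is joint injectivity of the components.\<close>

sublocale logical_cover p q F mul con \<epsilon> I fst "\<lambda>i b a' a. a \<in> car b \<and> a' = dec a i"
proof
  show "mul X x Y y a b \<noteq> None \<longleftrightarrow>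
        finite X \<and> finite Y \<and> X \<inter> Y = {} \<and> x \<notin> X \<and> y \<notin> Y \<and>
        a \<in> elems F (X \<union> {x}) \<and> b \<in> elems F (Y \<union> {y}) \<and>
        colour F (X \<union> {x}) x a = dual_colour F (Y \<union> {y}) y b" for X x Y y a b
  proof (cases "finite X \<and> finite Y \<and> X \<inter> Y = {} \<and> x \<notin> X \<and> y \<notin> Y \<and>
        a \<in> car (Fin (X \<union> {x})) \<and> b \<in> car (Fin (Y \<union> {y}))")
    case True
    then have "ml (fst i) X x Y y (dec a i) (dec b i) \<noteq> None \<longleftrightarrow>
        colour (sp (fst i)) (X \<union> {x}) x (dec a i) = dual_colour (sp (fst i)) (Y \<union> {y}) y (dec b i)"
      if "i \<in> I" for i
      using dec_mem that unfolding mul_dom[OF I_mul[OF that]] by blast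
    moreover have "colour F (X \<union> {x}) x a = dual_colour F (Y \<union> {y}) y b \<longleftrightarrow>
        (\<forall>i\<in>I. colour (sp (fst i)) (X \<union> {x}) x (dec a i) = dual_colour (sp (fst i)) (Y \<union> {y}) y (dec b i))"
      using True by (intro colour_F_eq_iff) auto
    ultimately show ?thesis using True by (simp add: mul_def)
  next
    case False
    then have "mul X x Y y a b = None" unfolding mul_def by (intro if_not_P) blast
    \<comment> \<open>The carriers of \<open>F\<close> are sets of codes at finite sets only and
      \<open>undefined\<close> elsewhere, so the two descriptions of the domain may be identified
      only under the finiteness conditions.\<close>
    moreover have "finite X \<Longrightarrow> elems F (X \<union> {x}) = car (Fin (X \<union> {x}))"
      "finite Y \<Longrightarrow> elems F (Y \<union> {y}) = car (Fin (Y \<union> {y}))" by simp_all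
    ultimately show ?thesis using False by metis
  qed
  show "con X x y a \<noteq> None \<longleftrightarrow>
        finite X \<and> x \<notin> X \<and> y \<notin> X \<and> x \<noteq> y \<and> a \<in> elems F (X \<union> {x, y}) \<and>
        colour F (X \<union> {x, y}) x a = dual_colour F (X \<union> {x, y}) y a" for X x y a
  proof (cases "finite X \<and> x \<notin> X \<and> y \<notin> X \<and> x \<noteq> y \<and> a \<in> car (Fin (X \<union> {x, y}))")
    case True
    then have "cn (fst i) X x y (dec a i) \<noteq> None \<longleftrightarrow>
        colour (sp (fst i)) (X \<union> {x, y}) x (dec a i) = dual_colour (sp (fst i)) (X \<union> {x, y}) y (dec a i)"
      if "i \<in> I" for i
      using dec_mem that unfolding con_dom[OF I_con[OF that]] by blast
    moreover have "colour F (X \<union> {x, y}) x a = dual_colour F (X \<union> {x, y}) y a \<longleftrightarrow>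
        (\<forall>i\<in>I. colour (sp (fst i)) (X \<union> {x, y}) x (dec a i) = dual_colour (sp (fst i)) (X \<union> {x, y}) y (dec a i))"
      using True by (intro colour_F_eq_iff) auto
    ultimately show ?thesis using True by (simp add: con_def)
  next
    case False
    then have "con X x y a = None" unfolding con_def by (intro if_not_P) blast
    moreover have "finite X \<Longrightarrow> elems F (X \<union> {x, y}) = car (Fin (X \<union> {x, y}))" by simp
    ultimately show ?thesis using False by metis
  qed
  show "\<epsilon> \<in> colours F \<rightarrow>\<^sub>E elems F {p, q}"
    using \<epsilon>D(1) by (auto simp: \<epsilon>_def)
  show "a1 = a2" if "b \<in> Obj B_cat" "a1 \<in> fobj F b" "a2 \<in> fobj F b"
    "\<And>i. i \<in> I \<Longrightarrow> \<exists>a'. (a1 \<in> car b \<and> a' = dec a1 i) \<and> a2 \<in> car b \<and> a' = dec a2 i" for b a1 a2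
    using that by (intro car_eqI[of a1 b a2]) auto
  show "p \<noteq> q" by (rule pq)
  show "F \<in> Obj GS" by (rule F_obj)
  show "modular_operad p q (fst i)" if "i \<in> I" for i by (rule I_D(1)[OF that])
  show "a' \<in> fobj (sp (fst i)) b" if "i \<in> I" "a \<in> car b \<and> a' = dec a i" for i b a' a
    using that dec_mem by blast
  show "\<exists>a'. a \<in> car b \<and> a' = dec a i" if "b \<in> Obj B_cat" "a \<in> fobj F b" for i b a
    using that by simp
  show "act F m a \<in> car (bdom m) \<and> act (sp (fst i)) m a' = dec (act F m a) i"
    if "i \<in> I" "m \<in> Arr B_cat" "a \<in> car (bcod m) \<and> a' = dec a i" for i m a' a
    using that act_F by simp
  show "\<exists>\<chi>'. ml (fst i) X x Y y \<phi>' \<psi>' = Some \<chi>' \<and> \<chi> \<in> car (Fin (X \<union> Y)) \<and> \<chi>' = dec \<chi> i"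
    if "i \<in> I" "\<phi> \<in> car (Fin (X \<union> {x})) \<and> \<phi>' = dec \<phi> i" "\<psi> \<in> car (Fin (Y \<union> {y})) \<and> \<psi>' = dec \<psi> i"
      "mul X x Y y \<phi> \<psi> = Some \<chi>" for i X x \<phi>' \<phi> Y y \<psi>' \<psi> \<chi>
    using that mulD[OF that(4)] by blast
  show "\<exists>\<chi>'. cn (fst i) X x y \<phi>' = Some \<chi>' \<and> \<chi> \<in> car (Fin X) \<and> \<chi>' = dec \<chi> i"
    if "i \<in> I" "\<phi> \<in> car (Fin (X \<union> {x, y})) \<and> \<phi>' = dec \<phi> i" "con X x y \<phi> = Some \<chi>" for i X x y \<phi>' \<phi> \<chi>
    using that conD[OF that(3)] by blast
  show "\<epsilon> (colour F (X \<union> {x}) x \<phi>) \<in> car (Fin {p, q}) \<and>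
      un (fst i) (colour (sp (fst i)) (X \<union> {x}) x \<phi>') = dec (\<epsilon> (colour F (X \<union> {x}) x \<phi>)) i"
    if "i \<in> I" "finite X" "\<phi> \<in> car (Fin (X \<union> {x})) \<and> \<phi>' = dec \<phi> i" for i X x \<phi>' \<phi>
    using act_F[of "Ch (X \<union> {x}) x False" \<phi>] \<epsilon>D[of "colour F (X \<union> {x}) x \<phi>"] that by simp
  show "\<chi> \<in> elems F (X \<union> Y)" if "mul X x Y y \<phi> \<psi> = Some \<chi>" for X x Y y \<phi> \<psi> \<chi>
    using mulD[OF that] by simp
  show "\<chi> \<in> elems F X" if "con X x y \<phi> = Some \<chi>" for X x y \<phi> \<chi>
    using conD[OF that] by simp
qed

lemma M_simps [simp]: "sp M = F" "ml M = mul" "cn M = con" "un M = \<epsilon>"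
  by (simp_all add: M_def)

lemma modular_operad_M: "modular_operad p q M"
  unfolding M_def by (rule modular_operad)

section \<open>The universal property of the free modular operad\<close>

definition \<eta> :: "'u species_mor" where
  "\<eta> = mk_mor S F (\<lambda>b x. enc (\<lambda>i\<in>I. app (snd i) b x))"

lemma app_\<eta>: "b \<in> Obj B_cat \<Longrightarrow> x \<in> fobj S b \<Longrightarrow> app \<eta> b x = enc (\<lambda>i\<in>I. app (snd i) b x)"
  by (simp add: \<eta>_def)

lemma \<eta>_Hom: "\<eta> \<in> Hom GS S F"
  unfolding \<eta>_def
proof (rule mk_mor_Hom[OF S F_obj])
  show "enc (\<lambda>i\<in>I. app (snd i) b x) \<in> fobj F b" if "b \<in> Obj B_cat" "x \<in> fobj S b" for b x
    using enc_mem[OF gen[OF that]] that by simp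
  show "enc (\<lambda>i\<in>I. app (snd i) (bdom m) (act S m x)) = act F m (enc (\<lambda>i\<in>I. app (snd i) (bcod m) x))"
    if m: "m \<in> Arr B_cat" "x \<in> fobj S (bcod m)" for m x
  proof (rule car_eqI)
    have b: "bdom m \<in> Obj B_cat" "bcod m \<in> Obj B_cat" "act S m x \<in> fobj S (bdom m)"
      using m S by auto
    note g = gen[OF b(1,3)] gen[OF b(2) m(2)]
    show "enc (\<lambda>i\<in>I. app (snd i) (bdom m) (act S m x)) \<in> car (bdom m)" by (rule enc_mem[OF g(1)])
    show "act F m (enc (\<lambda>i\<in>I. app (snd i) (bcod m) x)) \<in> car (bdom m)" by (rule act_F[OF m(1) enc_mem[OF g(2)]])
    fix i assume i: "i \<in> I"
    show "dec (enc (\<lambda>i\<in>I. app (snd i) (bdom m) (act S m x))) i = dec (act F m (enc (\<lambda>i\<in>I. app (snd i) (bcod m) x))) i"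
      using act_F(2)[OF m(1) enc_mem[OF g(2)] i] dec_enc[OF g(1)] dec_enc[OF g(2)] i
        app_act[OF I_D(2)[OF i] m] by simp
  qed
qed

definition proj :: "'u modop \<times> 'u species_mor \<Rightarrow> 'u species_mor" where
  "proj i = mk_mor F (sp (fst i)) (\<lambda>b a. dec a i)"

lemma app_proj: "a \<in> car b \<Longrightarrow> app (proj i) b a = dec a i"
  using car_obj by (simp add: proj_def)

lemma proj_Hom:
  assumes "i \<in> I"
  shows "proj i \<in> Hom GS F (sp (fst i))"
  unfolding proj_def by (rule mk_mor_Hom[OF F_obj I_GS[OF assms]]) (use assms dec_mem act_F in auto)

lemma proj_mor:
  assumes "i \<in> I"
  shows "modular_operad_mor p q M (fst i) (proj i)"
  unfolding modop_mor_iff M_simps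
proof (intro conjI allI impI ballI)
  show "proj i \<in> Hom GS F (sp (fst i))" by (rule proj_Hom[OF assms])
  show "ml (fst i) X x Y y (app (proj i) (Fin (X \<union> {x})) \<phi>) (app (proj i) (Fin (Y \<union> {y})) \<psi>) =
    Some (app (proj i) (Fin (X \<union> Y)) \<chi>)" if "mul X x Y y \<phi> \<psi> = Some \<chi>" for X x Y y \<phi> \<psi> \<chi>
    using mulD[OF that] assms by (simp add: app_proj del: Un_insert_right)
  show "cn (fst i) X x y (app (proj i) (Fin (X \<union> {x, y})) \<phi>) = Some (app (proj i) (Fin X) \<chi>)"
    if "con X x y \<phi> = Some \<chi>" for X x y \<phi> \<chi>
    using conD[OF that] assms by (simp add: app_proj del: Un_insert_right)
  show "app (proj i) (Fin {p, q}) (\<epsilon> c) = un (fst i) (app (proj i) Sec c)" if "c \<in> colours F" for c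
    using \<epsilon>D[of c] assms that by (simp add: app_proj)
qed

text \<open>For \<open>i = (N, f)\<close> this is existence in the universal property. A generator
  is sent by \<eta> to the family of all its images, so the projection onto the factor named by
  \<open>f\<close> extends \<open>f\<close>.\<close>

lemma proj_\<eta>:
  assumes "i \<in> I"
  shows "Comp GS (proj i) \<eta> = snd i"
proof (rule GS_Hom_eqI[OF Comp_GS[OF \<eta>_Hom proj_Hom[OF assms]] I_D(2)[OF assms]])
  fix b x assume *: "b \<in> Obj B_cat" "x \<in> fobj S b"
  then show "app (Comp GS (proj i) \<eta>) b x = app (snd i) b x"
    using app_proj[OF enc_mem[OF gen[OF *]], of i] dec_enc[OF gen[OF *]] assms
    by (simp add: app_Comp[OF \<eta>_Hom] app_\<eta>)
qed

text \<open>Every element of \<open>F\<close> codes a generated family, so induction over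
  \<open>G\<close> carries agreement from the generators through all operations. In the cases of the
  operations, the code of the new family is identified with the result of the operation of
  \<open>M\<close> on codes, and there preservation applies.\<close>

lemma mor_unique:
  assumes g: "modular_operad_mor p q M N g" and g': "modular_operad_mor p q M N g'"
    and eq: "Comp GS g \<eta> = Comp GS g' \<eta>"
  shows "g = g'"
proof -
  note [simp del] = restrict_apply
  note gH = mor_Hom[OF g, simplified] and gH' = mor_Hom[OF g', simplified]
  have "app g b (enc h) = app g' b (enc h)" if "G b h" for b h
    using that
  proof (induction rule: G.induct)
    case (gen b x)
    then show ?case
      using app_Comp[OF \<eta>_Hom gen, of g] app_Comp[OF \<eta>_Hom gen, of g'] eq
      by (simp add: app_\<eta>)
  next
    case (act m h)
    have m: "enc h \<in> car (bcod m)" using enc_mem[OF act(2)] .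
    have "act F m (enc h) = enc (\<lambda>i\<in>I. act (sp (fst i)) m (h i))"
      using act m dec_enc[OF act(2)] by (simp add: F_def)
    then show ?case
      using app_act[OF gH act(1), of "enc h"] app_act[OF gH' act(1), of "enc h"] act m by simp
  next
    case (mul X Y x y h k)
    have "local.mul X x Y y (enc h) (enc k) = Some (enc (\<lambda>i\<in>I. the (ml (fst i) X x Y y (h i) (k i))))"
      unfolding mul_def dec_enc[OF mul(6)] dec_enc[OF mul(7)]
      using mul enc_mem[OF mul(6)] enc_mem[OF mul(7)] by simp
    from mor_mul[OF g, unfolded M_simps, OF this] mor_mul[OF g', unfolded M_simps, OF this]
    show ?case using mul.IH by simp
  next
    case (con X x y h)
    have "local.con X x y (enc h) = Some (enc (\<lambda>i\<in>I. the (cn (fst i) X x y (h i))))"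
      unfolding con_def dec_enc[OF con(5)]
      using con enc_mem[OF con(5)] by simp
    from mor_con[OF g, unfolded M_simps, OF this] mor_con[OF g', unfolded M_simps, OF this]
    show ?case using con.IH by simp
  next
    case (unit h)
    have m: "enc h \<in> car Sec" using enc_mem[OF unit(1)] .
    have "\<epsilon> (enc h) = enc (\<lambda>i\<in>I. un (fst i) (h i))"
      using m dec_enc[OF unit(1)] by (simp add: \<epsilon>_def restrict_apply)
    then show ?case
      using mor_unit[OF g, of "enc h"] mor_unit[OF g', of "enc h"] unit m by simp
  qed
  then have "app g b a = app g' b a" if "b \<in> Obj B_cat" "a \<in> fobj F b" for b a
    using that carD[of a b] by (metis fobj_F)
  then show ?thesis by (rule GS_Hom_eqI[OF gH gH'])
qed

end

section \<open>Quotients of modular operads and monadicity\<close>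

lemma
  assumes "multiplication S mul" "mul X x Y y \<phi> \<psi> = Some \<chi>"
  shows mul_finite: "finite X" "finite Y"
    and mul_args: "\<phi> \<in> elems S (X \<union> {x})" "\<psi> \<in> elems S (Y \<union> {y})"
  using mul_dom[OF assms(1), of X x Y y \<phi> \<psi>] assms(2) by auto

lemma
  assumes "contraction S con" "con X x y \<phi> = Some \<chi>"
  shows con_finite: "finite X" and con_arg: "\<phi> \<in> elems S (X \<union> {x, y})"
  using con_dom[OF assms(1), of X x y \<phi>] assms(2) by auto

lemma app_colour:
  assumes "f \<in> Hom GS S S'" "finite X" "x \<in> X" "\<phi> \<in> elems S X"
  shows "act S' (Ch X x b) (app f (Fin X) \<phi>) = app f Sec (act S (Ch X x b) \<phi>)"
  using app_act[OF assms(1), of "Ch X x b" \<phi>] assms by simp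

text \<open>Preservation of products is not asked of \<open>f\<close>: the domain of a
  multiplication is given by carriers and colours, and these any map of species respects. The lemma
  is applied to sections, which need not preserve products.\<close>

lemma Hom_mul_defined:
  assumes "f \<in> Hom GS S S'" "S \<in> Obj GS" "multiplication S mul" "multiplication S' mul'"
    and mul: "mul X x Y y \<phi> \<psi> = Some \<chi>"
  shows "\<exists>\<chi>'. mul' X x Y y (app f (Fin (X \<union> {x})) \<phi>) (app f (Fin (Y \<union> {y})) \<psi>) = Some \<chi>'"
proof -
  note d = mul_dom[OF assms(3), THEN iffD1, OF option.discI[OF mul]]
  have "mul' X x Y y (app f (Fin (X \<union> {x})) \<phi>) (app f (Fin (Y \<union> {y})) \<psi>) \<noteq> None"
    unfolding mul_dom[OF assms(4)]
    using d app_mem[OF assms(1)] app_colour[OF assms(1), of "X \<union> {x}" x \<phi> False]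
      app_colour[OF assms(1), of "Y \<union> {y}" y \<psi> True] by simp
  then show ?thesis by blast
qed

lemma Hom_con_defined:
  assumes "f \<in> Hom GS S S'" "S \<in> Obj GS" "contraction S con" "contraction S' con'"
    and con: "con X x y \<phi> = Some \<chi>"
  shows "\<exists>\<chi>'. con' X x y (app f (Fin (X \<union> {x, y})) \<phi>) = Some \<chi>'"
proof -
  note d = con_dom[OF assms(3), THEN iffD1, OF option.discI[OF con]]
  have "con' X x y (app f (Fin (X \<union> {x, y})) \<phi>) \<noteq> None"
    unfolding con_dom[OF assms(4)]
    using d app_mem[OF assms(1)] app_colour[OF assms(1), of "X \<union> {x, y}" x \<phi> False]
      app_colour[OF assms(1), of "X \<union> {x, y}" y \<phi> True] by simp
  then show ?thesis by blast
qed

lemma mor_Ident: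
  assumes M: "modular_operad p q M"
  shows "modular_operad_mor p q M M (Ident GS (sp M))"
  unfolding modop_mor_iff
proof (intro conjI allI impI ballI)
  show "Ident GS (sp M) \<in> Hom GS (sp M) (sp M)" by (rule Ident_GS[OF modop_GS[OF M]])
  fix X x Y y \<phi> \<psi> \<chi> assume "ml M X x Y y \<phi> \<psi> = Some \<chi>"
  note m = this mul_finite[OF modop_mul[OF M] this] mul_args[OF modop_mul[OF M] this]
    mul_mem[OF modop_mul[OF M] this]
  then show "ml M X x Y y (app (Ident GS (sp M)) (Fin (X \<union> {x})) \<phi>)
      (app (Ident GS (sp M)) (Fin (Y \<union> {y})) \<psi>) = Some (app (Ident GS (sp M)) (Fin (X \<union> Y)) \<chi>)"
    by simp
next
  fix X x y \<phi> \<chi> assume "cn M X x y \<phi> = Some \<chi>"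
  note m = this con_finite[OF modop_con[OF M] this] con_arg[OF modop_con[OF M] this]
    con_mem[OF modop_con[OF M] this]
  then show "cn M X x y (app (Ident GS (sp M)) (Fin (X \<union> {x, y})) \<phi>) =
      Some (app (Ident GS (sp M)) (Fin X) \<chi>)"
    by simp
next
  fix c assume "c \<in> colours (sp M)"
  then show "app (Ident GS (sp M)) (Fin {p, q}) (un M c) = un M (app (Ident GS (sp M)) Sec c)"
    using unit_mem[OF modop_unit[OF M]] by simp
qed

lemma mor_Comp:
  assumes L: "modular_operad p q L" and f: "modular_operad_mor p q L M f"
    and g: "modular_operad_mor p q M N g"
  shows "modular_operad_mor p q L N (Comp GS g f)"
  unfolding modop_mor_iff
proof (intro conjI allI impI ballI)
  note fH = mor_Hom[OF f]
  show "Comp GS g f \<in> Hom GS (sp L) (sp N)" by (rule Comp_GS[OF fH mor_Hom[OF g]])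
  fix X x Y y \<phi> \<psi> \<chi> assume m: "ml L X x Y y \<phi> \<psi> = Some \<chi>"
  show "ml N X x Y y (app (Comp GS g f) (Fin (X \<union> {x})) \<phi>)
      (app (Comp GS g f) (Fin (Y \<union> {y})) \<psi>) = Some (app (Comp GS g f) (Fin (X \<union> Y)) \<chi>)"
    using mor_mul[OF g mor_mul[OF f m]] mul_finite[OF modop_mul[OF L] m] mul_args[OF modop_mul[OF L] m]
      mul_mem[OF modop_mul[OF L] m]
    by (simp add: app_Comp[OF fH])
next
  note fH = mor_Hom[OF f]
  fix X x y \<phi> \<chi> assume m: "cn L X x y \<phi> = Some \<chi>"
  show "cn N X x y (app (Comp GS g f) (Fin (X \<union> {x, y})) \<phi>) =
      Some (app (Comp GS g f) (Fin X) \<chi>)"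
    using mor_con[OF g mor_con[OF f m]] con_finite[OF modop_con[OF L] m] con_arg[OF modop_con[OF L] m]
      con_mem[OF modop_con[OF L] m]
    by (simp add: app_Comp[OF fH])
next
  note fH = mor_Hom[OF f]
  fix c assume c: "c \<in> colours (sp L)"
  then show "app (Comp GS g f) (Fin {p, q}) (un L c) = un N (app (Comp GS g f) Sec c)"
    using mor_unit[OF f c] mor_unit[OF g app_mem[OF fH _ c]] unit_mem[OF modop_unit[OF L] c]
    by (simp add: app_Comp[OF fH])
qed

text \<open>The section \<open>s\<close> lifts the arguments of a product in \<open>M\<close> to
  \<open>L\<close>, where their product is again defined. Both \<open>e\<close> and \<open>g\<close>
  after \<open>e\<close> preserve the lifted product; the first identifies its image with the
  product in \<open>M\<close>, the second gives the claim for \<open>g\<close>. In the application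
  \<open>L\<close> is free on \<open>sp M\<close>, \<open>e\<close> is a morphism split by the unit,
  and \<open>s\<close> is that unit.\<close>

lemma mor_final:
  assumes L: "modular_operad p q L" and M: "modular_operad p q M"
    and e: "modular_operad_mor p q L M e" and s: "s \<in> Hom GS (sp M) (sp L)"
    and es: "Comp GS e s = Ident GS (sp M)"
    and g: "g \<in> Hom GS (sp M) (sp N)" and ge: "modular_operad_mor p q L N (Comp GS g e)"
  shows "modular_operad_mor p q M N g"
proof -
  note eH = mor_Hom[OF e]
  have es': "app e b (app s b x) = x" if "b \<in> Obj B_cat" "x \<in> fobj (sp M) b" for b x
    using app_Comp[OF s that, of e] that unfolding es by simp
  have ge': "app (Comp GS g e) b x = app g b (app e b x)" if "b \<in> Obj B_cat" "x \<in> fobj (sp L) b" for b x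
    by (rule app_Comp[OF eH that])
  note sm = app_mem[OF s]
  show ?thesis
    unfolding modop_mor_iff
  proof (intro conjI allI impI ballI g)
    fix X x Y y \<phi> \<psi> \<chi> assume m: "ml M X x Y y \<phi> \<psi> = Some \<chi>"
    obtain \<chi>' where m': "ml L X x Y y (app s (Fin (X \<union> {x})) \<phi>) (app s (Fin (Y \<union> {y})) \<psi>) = Some \<chi>'"
      by (rule exE[OF Hom_mul_defined[OF s modop_GS[OF M] modop_mul[OF M] modop_mul[OF L] m]], rule that)
    have fin: "Fin (X \<union> {x}) \<in> Obj B_cat" "Fin (Y \<union> {y}) \<in> Obj B_cat" "Fin (X \<union> Y) \<in> Obj B_cat"
      using mul_finite[OF modop_mul[OF M] m] by simp_all
    note es_args = es'[OF fin(1) mul_args(1)[OF modop_mul[OF M] m]] es'[OF fin(2) mul_args(2)[OF modop_mul[OF M] m]]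
      and ge_args = ge'[OF fin(1) mul_args(1)[OF modop_mul[OF L] m']] ge'[OF fin(2) mul_args(2)[OF modop_mul[OF L] m']]
        ge'[OF fin(3) mul_mem[OF modop_mul[OF L] m']]
    \<comment> \<open>The lifted product need not be the image of \<chi> under \<open>s\<close>, but
      \<open>e\<close> sends it to the product of \<phi> and \<psi>, which is \<chi>.\<close>
    have "\<chi> = app e (Fin (X \<union> Y)) \<chi>'"
      using mor_mul[OF e m'] m unfolding es_args by simp
    then show "ml N X x Y y (app g (Fin (X \<union> {x})) \<phi>) (app g (Fin (Y \<union> {y})) \<psi>) = Some (app g (Fin (X \<union> Y)) \<chi>)"
      using mor_mul[OF ge m'] unfolding ge_args es_args by simp
  next
    fix X x y \<phi> \<chi> assume m: "cn M X x y \<phi> = Some \<chi>"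
    obtain \<chi>' where m': "cn L X x y (app s (Fin (X \<union> {x, y})) \<phi>) = Some \<chi>'"
      by (rule exE[OF Hom_con_defined[OF s modop_GS[OF M] modop_con[OF M] modop_con[OF L] m]], rule that)
    note d = con_finite[OF modop_con[OF M] m] con_arg[OF modop_con[OF M] m]
      con_arg[OF modop_con[OF L] m'] con_mem[OF modop_con[OF L] m']
    have "\<chi> = app e (Fin X) \<chi>'"
      using mor_con[OF e m'] m d by (simp add: es')
    then show "cn N X x y (app g (Fin (X \<union> {x, y})) \<phi>) = Some (app g (Fin X) \<chi>)"
      using mor_con[OF ge m'] d by (simp add: ge' es')
  next
    fix c assume c: "c \<in> colours (sp M)"
    have sc: "app s Sec c \<in> colours (sp L)" using sm[OF _ c] by simp
    have "app e (Fin {p, q}) (un L (app s Sec c)) = un M c"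
      using mor_unit[OF e sc] es'[OF _ c] by simp
    then show "app g (Fin {p, q}) (un M c) = un N (app g Sec c)"
      using mor_unit[OF ge sc] ge'[OF _ sc] ge'[of "Fin {p, q}" "un L (app s Sec c)"]
        unit_mem[OF modop_unit[OF L] sc] es'[OF _ c] by simp
  qed
qed

text \<open>An identity that is a morphism in both directions forces the graphs of the partial
  operations to include each other, hence to be equal. For the total map of units, extensionality
  completes the argument.\<close>

lemma mor_antisym:
  assumes M: "modular_operad p q M" and N: "modular_operad p q N" and eq: "sp M = sp N"
    and f: "modular_operad_mor p q M N (Ident GS (sp M))" and g: "modular_operad_mor p q N M (Ident GS (sp M))"
  shows "M = N"
proof -
  have mul: "ml N X x Y y \<phi> \<psi> = Some \<chi>"
    if "modular_operad p q M" "modular_operad_mor p q M N (Ident GS (sp M))" "ml M X x Y y \<phi> \<psi> = Some \<chi>"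
    for M N X x Y y \<phi> \<psi> \<chi>
    using mor_mul[OF that(2,3)] mul_finite[OF modop_mul that(3)] mul_args[OF modop_mul that(3)]
      mul_mem[OF modop_mul that(3)] that(1) by simp
  have con: "cn N X x y \<phi> = Some \<chi>"
    if "modular_operad p q M" "modular_operad_mor p q M N (Ident GS (sp M))" "cn M X x y \<phi> = Some \<chi>"
    for M N X x y \<phi> \<chi>
    using mor_con[OF that(2,3)] con_finite[OF modop_con that(3)] con_arg[OF modop_con that(3)]
      con_mem[OF modop_con that(3)] that(1) by simp
  have "ml M X x Y y \<phi> \<psi> = ml N X x Y y \<phi> \<psi>" for X x Y y \<phi> \<psi>
    using mul[OF M f, of X x Y y \<phi> \<psi>] mul[OF N g[unfolded eq], of X x Y y \<phi> \<psi>]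
    by (cases "ml M X x Y y \<phi> \<psi>"; cases "ml N X x Y y \<phi> \<psi>") auto
  moreover have "cn M X x y \<phi> = cn N X x y \<phi>" for X x y \<phi>
    using con[OF M f, of X x y \<phi>] con[OF N g[unfolded eq], of X x y \<phi>]
    by (cases "cn M X x y \<phi>"; cases "cn N X x y \<phi>") auto
  moreover have "un M = un N"
  proof (rule extensionalityI)
    show "un M \<in> extensional (colours (sp M))" "un N \<in> extensional (colours (sp M))"
      using unit_PiE[OF modop_unit[OF M]] unit_PiE[OF modop_unit[OF N]] eq by (auto simp: PiE_def)
    show "un M c = un N c" if "c \<in> colours (sp M)" for c
      using mor_unit[OF f that] that unit_mem[OF modop_unit[OF M] that] by simp
  qed
  ultimately show ?thesis using eq by (intro prod_eqI ext) auto
qed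

text \<open>The operations on \<open>A\<close> are those of \<open>M\<close> on representatives
  chosen by \<open>s\<close>, followed by \<theta>. The congruence assumptions say that passing from
  arguments to the representatives of their classes keeps an operation defined and does not change
  the class of the result. The axioms follow with \<open>M\<close> as the only member of a
  cover.\<close>

lemma quotient_modular_operad:
  assumes pq: "p \<noteq> q" and M: "modular_operad p q M"
    and \<theta>: "\<theta> \<in> Hom GS (sp M) A" and s: "s \<in> Hom GS A (sp M)" and \<theta>s: "Comp GS \<theta> s = Ident GS A"
    and cong_mul: "\<And>X x Y y a b c. ml M X x Y y a b = Some c \<Longrightarrow>
      \<exists>c'. ml M X x Y y (app s (Fin (X \<union> {x})) (app \<theta> (Fin (X \<union> {x})) a))
                         (app s (Fin (Y \<union> {y})) (app \<theta> (Fin (Y \<union> {y})) b)) = Some c' \<and>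
           app \<theta> (Fin (X \<union> Y)) c' = app \<theta> (Fin (X \<union> Y)) c"
    and cong_con: "\<And>X x y a c. cn M X x y a = Some c \<Longrightarrow>
      \<exists>c'. cn M X x y (app s (Fin (X \<union> {x, y})) (app \<theta> (Fin (X \<union> {x, y})) a)) = Some c' \<and>
           app \<theta> (Fin X) c' = app \<theta> (Fin X) c"
    and cong_unit: "\<And>c. c \<in> colours (sp M) \<Longrightarrow>
      app \<theta> (Fin {p, q}) (un M (app s Sec (app \<theta> Sec c))) = app \<theta> (Fin {p, q}) (un M c)"
  shows "\<exists>N. modular_operad p q N \<and> sp N = A \<and> modular_operad_mor p q M N \<theta>"
proof -
  note [simp del] = Un_insert_right Un_insert_left
  have A: "A \<in> Obj GS" using GS_Hom_obj[OF \<theta>] by blast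
  note MGS = modop_GS[OF M] and Mmul = modop_mul[OF M] and Mcon = modop_con[OF M] and Munit = modop_unit[OF M]
  have \<theta>s': "app \<theta> b (app s b x) = x" if "b \<in> Obj B_cat" "x \<in> fobj A b" for b x
    using app_Comp[OF s that, of \<theta>] that unfolding \<theta>s by simp
  note sm = app_mem[OF s] and \<theta>m = app_mem[OF \<theta>]
  \<comment> \<open>Membership in \<open>A\<close> is tested explicitly: outside its carrier
    \<open>app s\<close> returns \<open>undefined\<close>, which might happen to be an element of
    \<open>M\<close> with a defined product.\<close>
  define mul where "mul X x Y y \<phi> \<psi> = (if \<phi> \<in> elems A (X \<union> {x}) \<and> \<psi> \<in> elems A (Y \<union> {y})
    then map_option (app \<theta> (Fin (X \<union> Y))) (ml M X x Y y (app s (Fin (X \<union> {x})) \<phi>) (app s (Fin (Y \<union> {y})) \<psi>))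
    else None)" for X x Y y \<phi> \<psi>
  define con where "con X x y \<phi> = (if \<phi> \<in> elems A (X \<union> {x, y})
    then map_option (app \<theta> (Fin X)) (cn M X x y (app s (Fin (X \<union> {x, y})) \<phi>)) else None)" for X x y \<phi>
  define \<epsilon> where "\<epsilon> = (\<lambda>c\<in>colours A. app \<theta> (Fin {p, q}) (un M (app s Sec c)))"
  \<comment> \<open>Since \<theta> is a left inverse of \<open>s\<close>, representatives have
    matching colours in \<open>M\<close> exactly when the given elements match in \<open>A\<close>.
    This settles the domains of the new operations.\<close>
  have s_eq_iff: "app s Sec c = app s Sec c' \<longleftrightarrow> c = c'" if "c \<in> colours A" "c' \<in> colours A" for c c'
    using \<theta>s'[OF B_obj_iff(1) that(1)] \<theta>s'[OF B_obj_iff(1) that(2)] by metis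
  have dom_mul: "mul X x Y y \<phi> \<psi> \<noteq> None \<longleftrightarrow>
        finite X \<and> finite Y \<and> X \<inter> Y = {} \<and> x \<notin> X \<and> y \<notin> Y \<and>
        \<phi> \<in> elems A (X \<union> {x}) \<and> \<psi> \<in> elems A (Y \<union> {y}) \<and>
        colour A (X \<union> {x}) x \<phi> = dual_colour A (Y \<union> {y}) y \<psi>" for X x Y y \<phi> \<psi>
  proof (cases "finite X \<and> finite Y \<and> \<phi> \<in> elems A (X \<union> {x}) \<and> \<psi> \<in> elems A (Y \<union> {y})")
    case True
    then have "mul X x Y y \<phi> \<psi> \<noteq> None \<longleftrightarrow>
        ml M X x Y y (app s (Fin (X \<union> {x})) \<phi>) (app s (Fin (Y \<union> {y})) \<psi>) \<noteq> None"
      by (simp add: mul_def)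
    moreover have "colour (sp M) (X \<union> {x}) x (app s (Fin (X \<union> {x})) \<phi>) =
        dual_colour (sp M) (Y \<union> {y}) y (app s (Fin (Y \<union> {y})) \<psi>) \<longleftrightarrow>
        colour A (X \<union> {x}) x \<phi> = dual_colour A (Y \<union> {y}) y \<psi>"
      using True s_eq_iff colour_mem[OF A, of "X \<union> {x}" x \<phi> False] colour_mem[OF A, of "Y \<union> {y}" y \<psi> True]
      by (simp add: app_colour[OF s])
    ultimately show ?thesis
      unfolding mul_dom[OF Mmul] using True sm[of "Fin (X \<union> {x})" \<phi>] sm[of "Fin (Y \<union> {y})" \<psi>] by simp
  next
    case False
    then have "mul X x Y y \<phi> \<psi> = None"
      using mul_dom[OF Mmul, of X x Y y "app s (Fin (X \<union> {x})) \<phi>" "app s (Fin (Y \<union> {y})) \<psi>"]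
      by (auto simp: mul_def)
    then show ?thesis using False by blast
  qed
  have dom_con: "con X x y \<phi> \<noteq> None \<longleftrightarrow>
        finite X \<and> x \<notin> X \<and> y \<notin> X \<and> x \<noteq> y \<and> \<phi> \<in> elems A (X \<union> {x, y}) \<and>
        colour A (X \<union> {x, y}) x \<phi> = dual_colour A (X \<union> {x, y}) y \<phi>" for X x y \<phi>
  proof (cases "finite X \<and> \<phi> \<in> elems A (X \<union> {x, y})")
    case True
    then have "con X x y \<phi> \<noteq> None \<longleftrightarrow> cn M X x y (app s (Fin (X \<union> {x, y})) \<phi>) \<noteq> None"
      by (simp add: con_def)
    moreover have "colour (sp M) (X \<union> {x, y}) x (app s (Fin (X \<union> {x, y})) \<phi>) =
        dual_colour (sp M) (X \<union> {x, y}) y (app s (Fin (X \<union> {x, y})) \<phi>) \<longleftrightarrow>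
        colour A (X \<union> {x, y}) x \<phi> = dual_colour A (X \<union> {x, y}) y \<phi>"
      using True s_eq_iff colour_mem[OF A, of "X \<union> {x, y}" x \<phi> False] colour_mem[OF A, of "X \<union> {x, y}" y \<phi> True]
      by (simp add: app_colour[OF s])
    ultimately show ?thesis
      unfolding con_dom[OF Mcon] using True sm[of "Fin (X \<union> {x, y})" \<phi>] by simp
  next
    case False
    then have "con X x y \<phi> = None"
      using con_dom[OF Mcon, of X x y "app s (Fin (X \<union> {x, y})) \<phi>"] by (auto simp: con_def)
    then show ?thesis using False by blast
  qed
  \<comment> \<open>All colours of \<open>a\<close> come from \<open>A\<close> along \<open>s\<close>.  This makes a product in \<open>M\<close> defined as soon as its
    image in \<open>A\<close> is; arbitrary elements of \<open>M\<close> may have colours outside the image of \<open>s\<close>.\<close>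
  define good where "good b a \<longleftrightarrow> (\<forall>m\<in>Arr B_cat. bdom m = Sec \<and> bcod m = b \<longrightarrow>
    app s Sec (app \<theta> Sec (act (sp M) m a)) = act (sp M) m a)" for b a
  have good_Ch: "app s Sec (act A (Ch X x k) (app \<theta> (Fin X) a)) = act (sp M) (Ch X x k) a"
    if "good (Fin X) a" "finite X" "x \<in> X" "a \<in> elems (sp M) X" for X x k a
    using that app_colour[OF \<theta> that(2-4), of k] by (simp add: good_def)
  have goodI: "good (Fin X) a"
    if "\<And>x k. x \<in> X \<Longrightarrow> app s Sec (app \<theta> Sec (act (sp M) (Ch X x k) a)) = act (sp M) (Ch X x k) a" for X a
    unfolding good_def using that by (auto elim!: B_arrE)
  \<comment> \<open>Both \<theta> and \<open>s\<close> commute with the involution, so goodness of a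
    colour passes to its dual; only the plain colours remain to be checked.\<close>
  have good_dual: "app s Sec (app \<theta> Sec (act (sp M) (Ch X x k) a)) = act (sp M) (Ch X x k) a"
    if "app s Sec (app \<theta> Sec (colour (sp M) X x a)) = colour (sp M) X x a"
      "finite X" "x \<in> X" "a \<in> elems (sp M) X" for X x k a
  proof (cases k)
    case True
    have c: "colour (sp M) X x a \<in> colours (sp M)" by (rule colour_mem[OF MGS that(2-4)])
    show ?thesis
      using True dual_colour_eq[OF MGS that(2-4)] that(1) app_act[OF \<theta>, of "SecMor True" "colour (sp M) X x a"]
        app_act[OF s, of "SecMor True" "app \<theta> Sec (colour (sp M) X x a)"] c \<theta>m[of Sec, OF _ c] by simp
  qed (use that in simp)
  \<comment> \<open>There is one factor, indexed by the element of type \<open>unit\<close>. Besides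
    lying over \<open>a\<close>, a lift has to be good; the representative chosen by
    \<open>s\<close> always is, which gives totality.\<close>
  let ?R = "\<lambda>(_ :: unit) b a' a. a' \<in> fobj (sp M) b \<and> a = app \<theta> b a' \<and> good b a'"
  have cover: "logical_cover p q A mul con \<epsilon> UNIV (\<lambda>_. M) ?R"
  proof
    show "mul X x Y y \<phi> \<psi> \<noteq> None \<longleftrightarrow>
        finite X \<and> finite Y \<and> X \<inter> Y = {} \<and> x \<notin> X \<and> y \<notin> Y \<and>
        \<phi> \<in> elems A (X \<union> {x}) \<and> \<psi> \<in> elems A (Y \<union> {y}) \<and>
        colour A (X \<union> {x}) x \<phi> = dual_colour A (Y \<union> {y}) y \<psi>" for X x Y y \<phi> \<psi>
      by (rule dom_mul)
    show "con X x y \<phi> \<noteq> None \<longleftrightarrow>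
        finite X \<and> x \<notin> X \<and> y \<notin> X \<and> x \<noteq> y \<and> \<phi> \<in> elems A (X \<union> {x, y}) \<and>
        colour A (X \<union> {x, y}) x \<phi> = dual_colour A (X \<union> {x, y}) y \<phi>" for X x y \<phi>
      by (rule dom_con)
    show "\<chi> \<in> elems A (X \<union> Y)" if \<chi>: "mul X x Y y \<phi> \<psi> = Some \<chi>" for X x Y y \<phi> \<psi> \<chi>
    proof -
      obtain c where c: "ml M X x Y y (app s (Fin (X \<union> {x})) \<phi>) (app s (Fin (Y \<union> {y})) \<psi>) = Some c"
        "\<chi> = app \<theta> (Fin (X \<union> Y)) c"
        using \<chi> unfolding mul_def by (auto simp only: map_option_eq_Some split: if_split_asm)
      then show ?thesis using \<theta>m[OF _ mul_mem[OF Mmul c(1)]] mul_finite[OF Mmul c(1)] by simp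
    qed
    show "\<chi> \<in> elems A X" if \<chi>: "con X x y \<phi> = Some \<chi>" for X x y \<phi> \<chi>
    proof -
      obtain c where c: "cn M X x y (app s (Fin (X \<union> {x, y})) \<phi>) = Some c"
        "\<chi> = app \<theta> (Fin X) c"
        using \<chi> unfolding con_def by (auto simp only: map_option_eq_Some split: if_split_asm)
      then show ?thesis using \<theta>m[OF _ con_mem[OF Mcon c(1)]] con_finite[OF Mcon c(1)] by simp
    qed
    show "\<epsilon> \<in> colours A \<rightarrow>\<^sub>E elems A {p, q}"
      using \<theta>m[of "Fin {p, q}"] unit_mem[OF Munit] sm[of Sec] by (simp add: \<epsilon>_def)
    show "\<exists>a'. a' \<in> fobj (sp M) b \<and> a = app \<theta> b a' \<and> good b a'" if "b \<in> Obj B_cat" "a \<in> fobj A b" for b a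
    proof (intro exI conjI)
      show "app s b a \<in> fobj (sp M) b" "a = app \<theta> b (app s b a)" using that sm \<theta>s' by simp_all
      show "good b (app s b a)"
        unfolding good_def
      proof (intro ballI impI)
        fix m assume m: "m \<in> Arr B_cat" "bdom m = Sec \<and> bcod m = b"
        then show "app s Sec (app \<theta> Sec (act (sp M) m (app s b a))) = act (sp M) m (app s b a)"
          using app_act[OF s m(1), of a] \<theta>s'[of Sec "act A m a"] act_mem[OF A m(1), of a] that by simp
      qed
    qed
    show "a1 = a2" if "\<And>i. i \<in> UNIV \<Longrightarrow> \<exists>a'. (a' \<in> fobj (sp M) b \<and> a1 = app \<theta> b a' \<and> good b a') \<and>
        a' \<in> fobj (sp M) b \<and> a2 = app \<theta> b a' \<and> good b a'" for b a1 a2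
      using that by blast
    show "act (sp M) m a' \<in> fobj (sp M) (bdom m) \<and> act A m a = app \<theta> (bdom m) (act (sp M) m a') \<and>
        good (bdom m) (act (sp M) m a')"
      if m: "m \<in> Arr B_cat" and a: "a' \<in> fobj (sp M) (bcod m) \<and> a = app \<theta> (bcod m) a' \<and> good (bcod m) a'"
      for m a' a
    proof (intro conjI)
      show "act (sp M) m a' \<in> fobj (sp M) (bdom m)" using act_mem[OF MGS m] a by blast
      show "act A m a = app \<theta> (bdom m) (act (sp M) m a')" using app_act[OF \<theta> m] a by simp
      show "good (bdom m) (act (sp M) m a')"
        unfolding good_def
      proof (intro ballI impI)
        fix n assume n: "n \<in> Arr B_cat" "bdom n = Sec \<and> bcod n = bdom m"
        then have "act (sp M) n (act (sp M) m a') = act (sp M) (bcomp m n) a'"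
          using act_comp[OF MGS m n(1)] a by blast
        moreover have "bcomp m n \<in> Arr B_cat" "bdom (bcomp m n) = Sec \<and> bcod (bcomp m n) = bcod m"
          using m n by simp_all
        ultimately show "app s Sec (app \<theta> Sec (act (sp M) n (act (sp M) m a'))) = act (sp M) n (act (sp M) m a')"
          using a unfolding good_def by simp
      qed
    qed
    show "\<exists>\<chi>'. ml M X x Y y \<phi>' \<psi>' = Some \<chi>' \<and> \<chi>' \<in> elems (sp M) (X \<union> Y) \<and>
        \<chi> = app \<theta> (Fin (X \<union> Y)) \<chi>' \<and> good (Fin (X \<union> Y)) \<chi>'"
      if \<phi>: "\<phi>' \<in> elems (sp M) (X \<union> {x}) \<and> \<phi> = app \<theta> (Fin (X \<union> {x})) \<phi>' \<and> good (Fin (X \<union> {x})) \<phi>'"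
        and \<psi>: "\<psi>' \<in> elems (sp M) (Y \<union> {y}) \<and> \<psi> = app \<theta> (Fin (Y \<union> {y})) \<psi>' \<and> good (Fin (Y \<union> {y})) \<psi>'"
        and \<chi>: "mul X x Y y \<phi> \<psi> = Some \<chi>" for X x \<phi>' \<phi> Y y \<psi>' \<psi> \<chi>
    proof -
      note d = dom_mul[of X x Y y \<phi> \<psi>, THEN iffD1, OF option.discI[OF \<chi>]]
      have "colour (sp M) (X \<union> {x}) x \<phi>' = dual_colour (sp M) (Y \<union> {y}) y \<psi>'"
        using good_Ch[of "X \<union> {x}" \<phi>' x False] good_Ch[of "Y \<union> {y}" \<psi>' y True] \<phi> \<psi> d by auto
      then have "ml M X x Y y \<phi>' \<psi>' \<noteq> None" unfolding mul_dom[OF Mmul] using d \<phi> \<psi> by blast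
      then obtain \<chi>' where \<chi>': "ml M X x Y y \<phi>' \<psi>' = Some \<chi>'" by blast
      have mem: "\<chi>' \<in> elems (sp M) (X \<union> Y)" by (rule mul_mem[OF Mmul \<chi>'])
      \<comment> \<open>The product in \<open>A\<close> was computed from the representatives of
        \<phi> and \<psi>, whereas \<chi>' comes from arbitrary good lifts; by
        \<open>cong_mul\<close> the two have the same class.\<close>
      have "\<chi> = app \<theta> (Fin (X \<union> Y)) \<chi>'"
        using cong_mul[OF \<chi>'] \<chi> \<phi> \<psi> d by (auto simp: mul_def)
      moreover have "good (Fin (X \<union> Y)) \<chi>'"
      proof (rule goodI, rule good_dual)
        fix e assume e: "e \<in> X \<union> Y"
        show "app s Sec (app \<theta> Sec (colour (sp M) (X \<union> Y) e \<chi>')) = colour (sp M) (X \<union> Y) e \<chi>'"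
        proof (cases "e \<in> X")
          case True
          then have "app s Sec (app \<theta> Sec (colour (sp M) (X \<union> {x}) e \<phi>')) = colour (sp M) (X \<union> {x}) e \<phi>'"
            using \<phi> d unfolding good_def by simp
          then show ?thesis using mul_colour1[OF Mmul \<chi>' True] by simp
        next
          case False
          then have y: "e \<in> Y" using e by blast
          then have "app s Sec (app \<theta> Sec (colour (sp M) (Y \<union> {y}) e \<psi>')) = colour (sp M) (Y \<union> {y}) e \<psi>'"
            using \<psi> d unfolding good_def by simp
          then show ?thesis using mul_colour2[OF Mmul \<chi>' y] by simp
        qed
      qed (use d mem in auto)
      ultimately show ?thesis using \<chi>' mem by blast
    qed
    show "\<exists>\<chi>'. cn M X x y \<phi>' = Some \<chi>' \<and> \<chi>' \<in> elems (sp M) X \<and> \<chi> = app \<theta> (Fin X) \<chi>' \<and> good (Fin X) \<chi>'"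
      if \<phi>: "\<phi>' \<in> elems (sp M) (X \<union> {x, y}) \<and> \<phi> = app \<theta> (Fin (X \<union> {x, y})) \<phi>' \<and> good (Fin (X \<union> {x, y})) \<phi>'"
        and \<chi>: "con X x y \<phi> = Some \<chi>" for X x y \<phi>' \<phi> \<chi>
    proof -
      note d = dom_con[of X x y \<phi>, THEN iffD1, OF option.discI[OF \<chi>]]
      have "colour (sp M) (X \<union> {x, y}) x \<phi>' = dual_colour (sp M) (X \<union> {x, y}) y \<phi>'"
        using good_Ch[of "X \<union> {x, y}" \<phi>' x False] good_Ch[of "X \<union> {x, y}" \<phi>' y True] \<phi> d by auto
      then have "cn M X x y \<phi>' \<noteq> None" unfolding con_dom[OF Mcon] using d \<phi> by blast
      then obtain \<chi>' where \<chi>': "cn M X x y \<phi>' = Some \<chi>'" by blast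
      have mem: "\<chi>' \<in> elems (sp M) X" by (rule con_mem[OF Mcon \<chi>'])
      have "\<chi> = app \<theta> (Fin X) \<chi>'"
        using cong_con[OF \<chi>'] \<chi> \<phi> d by (auto simp: con_def)
      moreover have "good (Fin X) \<chi>'"
      proof (rule goodI, rule good_dual)
        fix e assume e: "e \<in> X"
        then have "app s Sec (app \<theta> Sec (colour (sp M) (X \<union> {x, y}) e \<phi>')) = colour (sp M) (X \<union> {x, y}) e \<phi>'"
          using \<phi> d unfolding good_def by simp
        then show "app s Sec (app \<theta> Sec (colour (sp M) X e \<chi>')) = colour (sp M) X e \<chi>'"
          using con_colour[OF Mcon \<chi>' e] by simp
      qed (use d mem in auto)
      ultimately show ?thesis using \<chi>' mem by blast
    qed
    show "un M (colour (sp M) (X \<union> {x}) x \<phi>') \<in> elems (sp M) {p, q} \<and>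
        \<epsilon> (colour A (X \<union> {x}) x \<phi>) = app \<theta> (Fin {p, q}) (un M (colour (sp M) (X \<union> {x}) x \<phi>')) \<and>
        good (Fin {p, q}) (un M (colour (sp M) (X \<union> {x}) x \<phi>'))"
      if X: "finite X" "x \<notin> X" "p \<notin> X" and
        \<phi>: "\<phi>' \<in> elems (sp M) (X \<union> {x}) \<and> \<phi> = app \<theta> (Fin (X \<union> {x})) \<phi>' \<and> good (Fin (X \<union> {x})) \<phi>'"
      for X x \<phi>' \<phi>
    proof (intro conjI)
      let ?c = "colour (sp M) (X \<union> {x}) x \<phi>'" and ?f = "\<lambda>e. if e = p then x else e"
      have c: "?c \<in> colours (sp M)" by (rule colour_mem[OF MGS]) (use X \<phi> in auto)
      show u: "un M ?c \<in> elems (sp M) {p, q}" by (rule unit_mem[OF Munit c])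
      show "\<epsilon> (colour A (X \<union> {x}) x \<phi>) = app \<theta> (Fin {p, q}) (un M ?c)"
        using cong_unit[OF c] \<theta>m[OF _ c] \<phi> X app_colour[OF \<theta>, of "X \<union> {x}" x \<phi>' False]
        by (simp add: \<epsilon>_def)
      have c_good: "app s Sec (app \<theta> Sec ?c) = ?c" using \<phi> X unfolding good_def by simp
      \<comment> \<open>The axioms constrain the colours of a unit only through products, so they
        are read off from the product with \<phi>': the colour at \<open>p\<close> survives in the
        product, which is a relabelling of \<phi>', and the colour at \<open>q\<close> is the one
        matched against \<open>?c\<close>.\<close>
      have prod: "ml M X x {p} q \<phi>' (un M ?c) = Some (relabel (sp M) (X \<union> {p}) (X \<union> {x}) ?f \<phi>')"
        using unit_right[OF Munit X] \<phi> by blast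
      have f: "bij_betw ?f (X \<union> {p}) (X \<union> {x})" using X by (auto simp: bij_betw_def inj_on_def)
      have eq: "{p} \<union> {q} = {p, q}" by auto
      have "colour (sp M) (X \<union> {p}) p (relabel (sp M) (X \<union> {p}) (X \<union> {x}) ?f \<phi>') = ?c"
        using colour_relabel[OF MGS _ _ f conjunct1[OF \<phi>], of p False] X(1) by simp
      then have col_p: "colour (sp M) {p, q} p (un M ?c) = ?c"
        using mul_colour2[OF Mmul prod, of p] unfolding eq by simp
      have "?c = dual_colour (sp M) {p, q} q (un M ?c)"
        using mul_dom[OF Mmul, THEN iffD1, OF option.discI[OF prod]] by (simp add: eq)
      then have col_q: "act (sp M) (SecMor True) ?c = colour (sp M) {p, q} q (un M ?c)"
        using dual_colour_eq[OF MGS _ _ u, of q] act_involution[OF MGS colour_mem[OF MGS _ _ u, of q False]] by simp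
      \<comment> \<open>The colour of the unit at \<open>q\<close> is the involution of
        \<open>?c\<close>; so it is fixed by \<open>s\<close> after \<theta> because
        \<open>?c\<close> is.\<close>
      have "app s Sec (app \<theta> Sec (act (sp M) (SecMor True) ?c)) = act (sp M) (SecMor True) ?c"
        using app_act[OF \<theta>, of "SecMor True" ?c] app_act[OF s, of "SecMor True" "app \<theta> Sec ?c"]
          c \<theta>m[OF _ c] c_good by simp
      then have "app s Sec (app \<theta> Sec (colour (sp M) {p, q} e (un M ?c))) = colour (sp M) {p, q} e (un M ?c)"
        if "e \<in> {p, q}" for e
        using that c_good col_p col_q by auto
      then show "good (Fin {p, q}) (un M ?c)"
        by (rule goodI[OF good_dual]) (use u in auto)
    qed
  qed (use pq A M in \<open>blast+\<close>)
  have N: "modular_operad p q (A, mul, con, \<epsilon>)" by (rule logical_cover.modular_operad[OF cover])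
  moreover have "modular_operad_mor p q M (A, mul, con, \<epsilon>) \<theta>"
    unfolding modop_mor_iff fst_conv snd_conv
  proof (intro conjI allI impI ballI)
    show "\<theta> \<in> Hom GS (sp M) A" by (rule \<theta>)
    show "mul X x Y y (app \<theta> (Fin (X \<union> {x})) \<phi>) (app \<theta> (Fin (Y \<union> {y})) \<psi>) = Some (app \<theta> (Fin (X \<union> Y)) \<chi>)"
      if "ml M X x Y y \<phi> \<psi> = Some \<chi>" for X x Y y \<phi> \<psi> \<chi>
      using cong_mul[OF that] \<theta>m[OF _ mul_args(1)[OF Mmul that]] \<theta>m[OF _ mul_args(2)[OF Mmul that]]
        mul_finite[OF Mmul that] by (auto simp: mul_def)
    show "con X x y (app \<theta> (Fin (X \<union> {x, y})) \<phi>) = Some (app \<theta> (Fin X) \<chi>)"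
      if "cn M X x y \<phi> = Some \<chi>" for X x y \<phi> \<chi>
      using cong_con[OF that] \<theta>m[OF _ con_arg[OF Mcon that]] con_finite[OF Mcon that] by (auto simp: con_def)
    show "app \<theta> (Fin {p, q}) (un M c) = \<epsilon> (app \<theta> Sec c)" if "c \<in> colours (sp M)" for c
      using cong_unit[OF that] \<theta>m[OF _ that] by (simp add: \<epsilon>_def)
  qed
  ultimately show ?thesis by (intro exI[of _ "(A, mul, con, \<epsilon>)"]) simp
qed

text \<open>In the application \<open>M\<close> is free on \<open>A\<close>, \<open>L\<close> is
  free on \<open>sp M\<close>, the sections \<open>s\<close> and \<open>r\<close> are the units, and
  \<open>t\<close>, \<open>m\<close> are the parallel pair of the algebra law. To see the congruence
  for a product \<open>c\<close> of \<open>a\<close> and \<open>b\<close> in \<open>M\<close>,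
  multiply their images under \<open>r\<close> in \<open>L\<close> and call the result
  \<open>z\<close>. The morphism \<open>m\<close> undoes \<open>r\<close> and sends \<open>z\<close>
  to \<open>c\<close>; the morphism \<open>t\<close> sends \<open>z\<close> to the product of the
  representatives of \<open>a\<close> and \<open>b\<close>. As \<theta> equalizes \<open>t\<close>
  and \<open>m\<close>, both products have the same class. Contractions and units go the same
  way.\<close>

lemma algebra_modular_operad:
  assumes pq: "p \<noteq> q" and L: "modular_operad p q L" and M: "modular_operad p q M"
    and \<theta>: "\<theta> \<in> Hom GS (sp M) A" and s: "s \<in> Hom GS A (sp M)" and \<theta>s: "Comp GS \<theta> s = Ident GS A"
    and r: "r \<in> Hom GS (sp M) (sp L)"
    and t: "modular_operad_mor p q L M t" and tr: "Comp GS t r = Comp GS s \<theta>"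
    and m: "modular_operad_mor p q L M m" and mr: "Comp GS m r = Ident GS (sp M)"
    and \<theta>tm: "Comp GS \<theta> t = Comp GS \<theta> m"
  shows "\<exists>N. modular_operad p q N \<and> sp N = A \<and> modular_operad_mor p q M N \<theta>"
proof (rule quotient_modular_operad[OF pq M \<theta> s \<theta>s])
  note [simp del] = Un_insert_right Un_insert_left
  have tr': "app t b (app r b x) = app s b (app \<theta> b x)" if "b \<in> Obj B_cat" "x \<in> fobj (sp M) b" for b x
    using app_Comp[OF r that, of t] app_Comp[OF \<theta> that, of s] unfolding tr by simp
  have mr': "app m b (app r b x) = x" if "b \<in> Obj B_cat" "x \<in> fobj (sp M) b" for b x
    using app_Comp[OF r that, of m] that unfolding mr by simp
  have \<theta>tm': "app \<theta> b (app t b x) = app \<theta> b (app m b x)" if "b \<in> Obj B_cat" "x \<in> fobj (sp L) b" for b x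
    using app_Comp[OF mor_Hom[OF t] that, of \<theta>] app_Comp[OF mor_Hom[OF m] that, of \<theta>] unfolding \<theta>tm by simp
  note Mmul = modop_mul[OF M] and Lmul = modop_mul[OF L] and Mcon = modop_con[OF M] and Lcon = modop_con[OF L]
  show "\<exists>c'. ml M X x Y y (app s (Fin (X \<union> {x})) (app \<theta> (Fin (X \<union> {x})) a))
                         (app s (Fin (Y \<union> {y})) (app \<theta> (Fin (Y \<union> {y})) b)) = Some c' \<and>
           app \<theta> (Fin (X \<union> Y)) c' = app \<theta> (Fin (X \<union> Y)) c"
    if c: "ml M X x Y y a b = Some c" for X x Y y a b c
  proof -
    obtain z where z: "ml L X x Y y (app r (Fin (X \<union> {x})) a) (app r (Fin (Y \<union> {y})) b) = Some z"
      by (rule exE[OF Hom_mul_defined[OF r modop_GS[OF M] Mmul Lmul c]], rule that)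
    note d = mul_finite[OF Mmul c] mul_args[OF Mmul c] mul_mem[OF Lmul z]
    have fin: "Fin (X \<union> {x}) \<in> Obj B_cat" "Fin (Y \<union> {y}) \<in> Obj B_cat" "Fin (X \<union> Y) \<in> Obj B_cat"
      using d(1,2) by simp_all
    have "app m (Fin (X \<union> Y)) z = c"
      using mor_mul[OF m z] unfolding mr'[OF fin(1) d(3)] mr'[OF fin(2) d(4)] c by simp
    then show ?thesis
      using mor_mul[OF t z] \<theta>tm'[OF fin(3) d(5)] unfolding tr'[OF fin(1) d(3)] tr'[OF fin(2) d(4)]
      by blast
  qed
  show "\<exists>c'. cn M X x y (app s (Fin (X \<union> {x, y})) (app \<theta> (Fin (X \<union> {x, y})) a)) = Some c' \<and>
           app \<theta> (Fin X) c' = app \<theta> (Fin X) c"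
    if c: "cn M X x y a = Some c" for X x y a c
  proof -
    obtain z where z: "cn L X x y (app r (Fin (X \<union> {x, y})) a) = Some z"
      by (rule exE[OF Hom_con_defined[OF r modop_GS[OF M] Mcon Lcon c]], rule that)
    note d = con_finite[OF Mcon c] con_arg[OF Mcon c] con_mem[OF Lcon z]
    have fin: "Fin (X \<union> {x, y}) \<in> Obj B_cat" "Fin X \<in> Obj B_cat"
      using d(1) by simp_all
    have "app m (Fin X) z = c"
      using mor_con[OF m z] unfolding mr'[OF fin(1) d(2)] c by simp
    then show ?thesis
      using mor_con[OF t z] \<theta>tm'[OF fin(2) d(3)] unfolding tr'[OF fin(1) d(2)] by blast
  qed
  show "app \<theta> (Fin {p, q}) (un M (app s Sec (app \<theta> Sec c))) = app \<theta> (Fin {p, q}) (un M c)"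
    if c: "c \<in> colours (sp M)" for c
  proof -
    have r': "app r Sec c \<in> colours (sp L)" using app_mem[OF r _ c] by simp
    then show ?thesis
      using mor_unit[OF t r'] mor_unit[OF m r'] tr'[OF _ c] mr'[OF _ c]
        \<theta>tm'[of "Fin {p, q}" "un L (app r Sec c)"] unit_mem[OF modop_unit[OF L] r'] by (simp add: finite.intros)
  qed
qed

theorem theorem0p1:
  fixes one two :: 'u
  assumes "infinite (UNIV :: 'u set)" and "one \<noteq> two"
  shows "\<exists>T \<eta> \<mu>. monad (GS :: ('u species, 'u species_mor) cat) T \<eta> \<mu> \<and>
           isomorphic_cats (MO one two) (EM_cat GS T \<eta> \<mu>)"
proof -
  have fm: "free_modop one two S" if "S \<in> Obj GS" for S :: "'u species"
    using assms that by (rule free_modop.intro)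
  let ?F = "free_modop.M one two" and ?\<eta> = "free_modop.\<eta> one two"
  note FM = free_modop.modular_operad_M[OF fm] and sF = free_modop.M_simps(1)[OF fm]
  interpret concrete_monadic "GS :: ('u species, 'u species_mor) cat" "{M. modular_operad one two M}" fst
    "modular_operad_mor one two" ?F ?\<eta>
  proof
    show \<eta>: "?\<eta> X \<in> Hom GS X (sp (?F X))" if "X \<in> Obj GS" for X
      using free_modop.\<eta>_Hom[OF fm[OF that]] sF[OF that] by simp
    show "\<exists>!g. modular_operad_mor one two (?F X) M g \<and> Comp GS g (?\<eta> X) = f"
      if X: "X \<in> Obj GS" and M: "M \<in> {M. modular_operad one two M}" and f: "f \<in> Hom GS X (sp M)" for X M f
    proof -
      \<comment> \<open>The pair names a factor of the product from which the free object is cut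
        out, so its projection is the required extension.\<close>
      have i: "(M, f) \<in> free_modop.I one two X"
        using M f by (simp add: free_modop.I_def[OF fm[OF X]])
      let ?g = "free_modop.proj one two X (M, f)"
      have g: "modular_operad_mor one two (?F X) M ?g" "Comp GS ?g (?\<eta> X) = f"
        using free_modop.proj_mor[OF fm[OF X] i] free_modop.proj_\<eta>[OF fm[OF X] i]
        by simp_all
      show ?thesis
      proof (rule ex1I[of _ ?g])
        fix h assume h: "modular_operad_mor one two (?F X) M h \<and> Comp GS h (?\<eta> X) = f"
        show "h = ?g"
          by (rule free_modop.mor_unique[OF fm[OF X] conjunct1[OF h] g(1)])
            (simp only: conjunct2[OF h] g(2))
      qed (use g in blast)
    qed
    show "modular_operad_mor one two M N g"
      if "M \<in> {M. modular_operad one two M}" "N \<in> {M. modular_operad one two M}"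
        "modular_operad_mor one two (?F (sp M)) M e" "Comp GS e (?\<eta> (sp M)) = Ident GS (sp M)"
        "g \<in> Hom GS (sp M) (sp N)" "modular_operad_mor one two (?F (sp M)) N (Comp GS g e)" for M N e g
    proof -
      have M: "modular_operad one two M" using that(1) by blast
      note MGS = modop_GS[OF M]
      show ?thesis by (rule mor_final[OF FM[OF MGS] M that(3) \<eta>[OF MGS] that(4-6)])
    qed
    show "\<exists>M\<in>{M. modular_operad one two M}. sp M = A \<and> modular_operad_mor one two (?F A) M \<theta>"
      if A: "A \<in> Obj GS" and "\<theta> \<in> Hom GS (sp (?F A)) A" "Comp GS \<theta> (?\<eta> A) = Ident GS A"
        "modular_operad_mor one two (?F (sp (?F A))) (?F A) t" "Comp GS t (?\<eta> (sp (?F A))) = Comp GS (?\<eta> A) \<theta>"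
        "modular_operad_mor one two (?F (sp (?F A))) (?F A) m" "Comp GS m (?\<eta> (sp (?F A))) = Ident GS (sp (?F A))"
        "Comp GS \<theta> t = Comp GS \<theta> m" for A \<theta> t m
    proof -
      have F: "sp (?F A) \<in> Obj GS" by (rule modop_GS[OF FM[OF A]])
      show ?thesis
        using algebra_modular_operad[OF assms(2) FM[OF F] FM[OF A] that(2) \<eta>[OF A] that(3) \<eta>[OF F] that(4-8)]
        by blast
    qed
    show "category (GS :: ('u species, 'u species_mor) cat)" by (rule category_GS)
    show "sp M \<in> Obj GS" if "M \<in> {M. modular_operad one two M}" for M :: "'u modop"
      by (rule modop_GS[of one two]) (use that in blast)
    show "f \<in> Hom GS (sp M) (sp N)" if "modular_operad_mor one two M N f" for M N f
      by (rule mor_Hom[OF that])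
    show "modular_operad_mor one two M M (Ident GS (sp M))"
      if "M \<in> {M. modular_operad one two M}" for M :: "'u modop"
      by (rule mor_Ident) (use that in blast)
    show "modular_operad_mor one two L N (Comp GS g f)"
      if "L \<in> {M. modular_operad one two M}" "modular_operad_mor one two L M f"
        "modular_operad_mor one two M N g" for L M N :: "'u modop" and f g
      by (rule mor_Comp[OF _ that(2,3)]) (use that in blast)
    show "?F X \<in> {M. modular_operad one two M}" if "X \<in> Obj GS" for X
      using FM[OF that] by blast
    show "M = N"
      if "M \<in> {M. modular_operad one two M}" "N \<in> {M. modular_operad one two M}" "sp M = sp N"
        "modular_operad_mor one two M N (Ident GS (sp M))" "modular_operad_mor one two N M (Ident GS (sp M))"
      for M N :: "'u modop"
      by (rule mor_antisym[OF _ _ that(3-5)]) (use that in blast)+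
  qed
  have "MO one two = D"
    by (simp add: MO_def D_def)
  then show ?thesis using monad_T isomorphic_EM by auto
qed

end
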